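(* Let $C=\operatorname{Spec}A_0$ be a smooth affine curve over $\mathbb{C}$, let $D_+,D_-$ be $\mathbb{Q}$-divisors on $C$ with $D_++D_-\le0$, let $A=A_0[D_+,D_-]\subseteq\operatorname{Frac}(A_0)[u,u^{-1}]$, $V=\operatorname{Spec}A$, and let $\pi:V\to C$ be the projection. For a point $a\in C$ write $$D_+(a)=-e_+/m_+\quad\text{and}\quad D_-(a)=e_-/m_-$$ with integers such that $m_+>0$, $m_-<0$, $\gcd(e_+,m_+)=\gcd(e_-,m_-)=1$, and $m_+=1$ if $D_+(a)=0$, $m_-=-1$ if $D_-(a)=0$. Let $q_+$ be defined by $0\le q_+<m_+$ and $q_+e_+\equiv-1\mod m_+$, and $q_-$ by $0\le q_-<-m_-$ and $q_-e_-\equiv1\mod m_-$. Then the exceptional orbits of $V$ are located over $|D_+|\cup|D_-|$, and the orbits over a given point $a\in|D_+|\cup|D_-|$ are as follows. (a) If $D_+(a)+D_-(a)=0$ then $\pi^*(a)=m_+O$ consists of one orbit $O$ of type $(m_+,q_+)$ with multiplicity $m_+$. Moreover, $O$ appears with coefficient $-e_+$ in $\operatorname{div}u$. (b) If $D_+(a)+D_-(a)<0$ then $\pi^{-1}(a)$ contains two orbits $O^+$ and $O^-$ of types $(m_+,q_+)$ and $(-m_-,q_-)$, respectively. Their closures $\bar O^\pm$ intersect in the unique fixed point of the fiber, and $\pi^*(a)=m_+\bar O^+-m_-\bar O^-$. Moreover, $\bar O^\pm$ appears with multiplicity $\mp e_\pm$ in $\operatorname{div}u$.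
   Context: For a $\mathbb{Q}$-divisor $D=\sum D(a)\,a$ on $C$, $\lfloor D\rfloor=\sum\lfloor D(a)\rfloor a$ and $|D|$ denotes the support of $D$. For $\mathbb{Q}$-divisors with $D_++D_-\le0$, the normal graded $A_0$-algebra $A_0[D_+,D_-]=\bigoplus_{n\in\mathbb{Z}}A_n\subseteq\operatorname{Frac}(A_0)[u,u^{-1}]$ ($u$ an indeterminate of degree $1$) is defined by $A_n=H^0(C,\mathcal{O}_C(\lfloor nD_+\rfloor))\cdot u^n$ and $A_{-n}=H^0(C,\mathcal{O}_C(\lfloor nD_-\rfloor))\cdot u^{-n}$ for $n\ge0$. The grading defines a $\mathbb{C}^*$-action on $V$ ($\lambda\in\mathbb{C}^*$ acts on $f\in A_i$ by $\lambda.f=\lambda^if$, i.e. $f(\lambda z)=\lambda^i f(z)$), and $\pi$ is induced by $A_0\subseteq A$. The element $u$ is a rational function on $V$, and $\operatorname{div}u$ is its divisor on $V$. Orbit types: let $F\subseteq V$ be the fixed point set and $O=\mathbb{C}^*z$ the orbit of a point $z\in V\setminus F$. The orbit $O$ is of type $(d,q)$ if $d$ is the order of the stabilizer $\operatorname{Stab}_z=\langle\zeta\rangle\cong\mathbb{Z}_d\subseteq\mathbb{C}^*$ and $q$, $0\le q<d$, is determined by the tangent representation of $\operatorname{Stab}_z$ on $T_zV$, which in a suitable basis is $\zeta\mapsto\begin{pmatrix}1&0\\0&\zeta^q\end{pmatrix}$. The orbit $O$ is called principal if $d=1$ and exceptional otherwise. *)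

theory Defs
  imports
    "HOL-Analysis.Abstract_Topology"
    "HOL-Algebra.Algebraic_Closure_Type"
    "HOL-Algebra.Ideal_Product"
    "HOL-Algebra.Generated_Rings"
    "HOL-Algebra.Group_Action"
    "HOL-Number_Theory.Cong"
    "HOL-Library.Poly_Mapping"
    "HOL-Library.Function_Algebras"
begin

text \<open>
  A coordinate ring is a subset \<open>A\<close> of an ambient commutative ring type, and its \<open>\<complex>\<close>-algebra
  structure is given by a ring homomorphism \<open>\<iota>\<close> from the complex numbers.  The affine variety
  \<open>Spec A\<close> is represented by its closed points, i.e. the maximal ideals of \<open>A\<close>, with the Zariski
  topology.
\<close>

section \<open>Affine varieties\<close>

abbreviation subr :: "'r::comm_ring_1 set \<Rightarrow> 'r ring" where
  "subr A \<equiv> ring_of_type_algebra\<lparr>carrier := A\<rparr>"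

definition Spm :: "'r::comm_ring_1 set \<Rightarrow> 'r set set" where
  "Spm A = {z. maximalideal z (subr A)}"

definition zariski :: "'r::comm_ring_1 set \<Rightarrow> 'r set topology" where
  "zariski A = topology_generated_by {{z \<in> Spm A. f \<notin> z} | f. f \<in> A}"

definition vanishing_ideal :: "'r::comm_ring_1 set \<Rightarrow> 'r set set \<Rightarrow> 'r set" where
  "vanishing_ideal A Y = {f \<in> A. \<forall>z\<in>Y. f \<in> z}"

text \<open>The value \<open>f(z)\<close>; it exists and is unique when the residue field at \<open>z\<close> is \<open>\<complex>\<close>.\<close>

definition value_at :: "(complex \<Rightarrow> 'r::comm_ring_1) \<Rightarrow> 'r set \<Rightarrow> 'r \<Rightarrow> complex" where
  "value_at \<iota> z f = (THE c. f - \<iota> c \<in> z)"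

text \<open>
  The Zariski tangent space at \<open>z\<close>, as the space of \<open>\<complex>\<close>-linear point derivations \<open>A \<rightarrow> \<complex>\<close> at \<open>z\<close>,
  extended by zero outside \<open>A\<close>.
\<close>

definition tangent_space ::
    "(complex \<Rightarrow> 'r::comm_ring_1) \<Rightarrow> 'r set \<Rightarrow> 'r set \<Rightarrow> ('r \<Rightarrow> complex) set" where
  "tangent_space \<iota> A z = {\<delta>.
     (\<forall>f. f \<notin> A \<longrightarrow> \<delta> f = 0) \<and>
     (\<forall>f\<in>A. \<forall>g\<in>A. \<delta> (f + g) = \<delta> f + \<delta> g) \<and>
     (\<forall>c. \<forall>f\<in>A. \<delta> (\<iota> c * f) = c * \<delta> f) \<and>
     (\<forall>f\<in>A. \<forall>g\<in>A. \<delta> (f * g) = value_at \<iota> z f * \<delta> g + value_at \<iota> z g * \<delta> f)}"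

definition fscale :: "complex \<Rightarrow> ('r \<Rightarrow> complex) \<Rightarrow> 'r \<Rightarrow> complex" where
  "fscale c \<delta> = (\<lambda>f. c * \<delta> f)"

lemma vector_space_fscale: "vector_space fscale"
  by unfold_locales (auto simp: fscale_def fun_eq_iff algebra_simps)

definition prime_chain :: "'r::comm_ring_1 set \<Rightarrow> nat \<Rightarrow> (nat \<Rightarrow> 'r set) \<Rightarrow> bool" where
  "prime_chain A n p \<longleftrightarrow>
     (\<forall>i\<le>n. primeideal (p i) (subr A)) \<and> (\<forall>i<n. p i \<subset> p (Suc i))"

definition has_krull_dim :: "'r::comm_ring_1 set \<Rightarrow> nat \<Rightarrow> bool" where
  "has_krull_dim A n \<longleftrightarrow> (\<exists>p. prime_chain A n p) \<and> \<not> (\<exists>p. prime_chain A (Suc n) p)"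

definition has_height :: "'r::comm_ring_1 set \<Rightarrow> 'r set \<Rightarrow> nat \<Rightarrow> bool" where
  "has_height A P n \<longleftrightarrow>
     (\<exists>p. prime_chain A n p \<and> p n = P) \<and> \<not> (\<exists>p. prime_chain A (Suc n) p \<and> p (Suc n) = P)"

text \<open>
  \<open>Spec A\<^sub>0\<close> is a smooth affine curve over \<open>\<complex>\<close>, where \<open>A\<^sub>0\<close> is a subring of its fraction field,
  the type \<open>'k\<close>.
\<close>

definition smooth_affine_curve :: "(complex \<Rightarrow> 'k::field) \<Rightarrow> 'k set \<Rightarrow> bool" where
  "smooth_affine_curve \<iota> A\<^sub>0 \<longleftrightarrow>
     \<iota> \<in> ring_hom ring_of_type_algebra ring_of_type_algebra \<and>
     (\<exists>S. finite S \<and> A\<^sub>0 = generate_ring ring_of_type_algebra (range \<iota> \<union> S)) \<and>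
     (\<forall>x. \<exists>f\<in>A\<^sub>0. \<exists>g\<in>A\<^sub>0. g \<noteq> 0 \<and> x = f / g) \<and>
     has_krull_dim A\<^sub>0 1 \<and>
     (\<forall>a\<in>Spm A\<^sub>0. vector_space.dim fscale (tangent_space \<iota> A\<^sub>0 a) = 1)"

section \<open>Orders of vanishing and divisors\<close>

text \<open>
  For a prime \<open>P\<close> of a domain \<open>A\<close> such that \<open>A\<^sub>P\<close> is a discrete valuation ring: the valuation of
  \<open>g \<in> A\<close>, \<open>g \<noteq> 0\<close>, is the largest \<open>n\<close> with \<open>g \<in> P\<^sup>n A\<^sub>P\<close>, i.e. with \<open>s g \<in> P\<^sup>n\<close> for some
  \<open>s \<in> A - P\<close>.  It extends to the nonzero elements \<open>f = g / h\<close> of \<open>Frac A\<close> that lie in the ambient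
  ring.
\<close>

definition prime_ord :: "'r::comm_ring_1 set \<Rightarrow> 'r set \<Rightarrow> 'r \<Rightarrow> nat" where
  "prime_ord A P g =
     (GREATEST n. \<exists>s\<in>A - P. s * g \<in> P [^]\<^bsub>ideals_set (subr A)\<^esub> (n::nat))"

definition frac_ord :: "'r::idom set \<Rightarrow> 'r set \<Rightarrow> 'r \<Rightarrow> int" where
  "frac_ord A P f = (THE k. \<exists>g\<in>A. \<exists>h\<in>A. g \<noteq> 0 \<and> h \<noteq> 0 \<and> f * h = g \<and>
     k = int (prime_ord A P g) - int (prime_ord A P h))"

definition prime_divisor :: "'r::comm_ring_1 set \<Rightarrow> 'r set set \<Rightarrow> bool" where
  "prime_divisor A Y \<longleftrightarrow> closedin (zariski A) Y \<and> has_height A (vanishing_ideal A Y) 1"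

text \<open>Weil divisors are functions on sets of points that vanish outside the prime divisors.\<close>

definition principal_divisor :: "'r::idom set \<Rightarrow> 'r \<Rightarrow> 'r set set \<Rightarrow> int" where
  "principal_divisor A f Y =
     (if prime_divisor A Y then frac_ord A (vanishing_ideal A Y) f else 0)"

text \<open>On a curve the prime divisors are the points, and divisors are functions on points.\<close>

definition supp :: "('k set \<Rightarrow> rat) \<Rightarrow> 'k set set" where
  "supp D = {a. D a \<noteq> 0}"

definition Q_divisor :: "'k::field set \<Rightarrow> ('k set \<Rightarrow> rat) \<Rightarrow> bool" where
  "Q_divisor A\<^sub>0 D \<longleftrightarrow> finite (supp D) \<and> supp D \<subseteq> Spm A\<^sub>0"

definition H0 :: "'k::field set \<Rightarrow> ('k set \<Rightarrow> int) \<Rightarrow> 'k set" where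
  "H0 A\<^sub>0 E = {f. f = 0 \<or> (\<forall>a\<in>Spm A\<^sub>0. frac_ord A\<^sub>0 a f + E a \<ge> 0)}"

section \<open>The graded algebra \<open>A\<^sub>0[D\<^sub>+, D\<^sub>-]\<close>\<close>

text \<open>
  The ring \<open>Frac(A\<^sub>0)[u, u\<^sup>-\<^sup>1]\<close> of Laurent polynomials is the type \<open>int \<Rightarrow>\<^sub>0 'k\<close>.
\<close>

definition u :: "int \<Rightarrow>\<^sub>0 'k::field" where
  "u = Poly_Mapping.single 1 1"

definition const :: "'k \<Rightarrow> int \<Rightarrow>\<^sub>0 'k::field" where
  "const f = Poly_Mapping.single 0 f"

definition dpd_algebra ::
    "'k::field set \<Rightarrow> ('k set \<Rightarrow> rat) \<Rightarrow> ('k set \<Rightarrow> rat) \<Rightarrow> (int \<Rightarrow>\<^sub>0 'k) set" where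
  "dpd_algebra A\<^sub>0 Dp Dm = {p. \<forall>n::nat.
     Poly_Mapping.lookup p (int n) \<in> H0 A\<^sub>0 (\<lambda>a. \<lfloor>of_nat n * Dp a\<rfloor>) \<and>
     Poly_Mapping.lookup p (- int n) \<in> H0 A\<^sub>0 (\<lambda>a. \<lfloor>of_nat n * Dm a\<rfloor>)}"

text \<open>The projection \<open>Spec A \<rightarrow> Spec A\<^sub>0\<close> induced by \<open>A\<^sub>0 \<subseteq> A\<close>.\<close>

definition proj :: "'k::field set \<Rightarrow> (int \<Rightarrow>\<^sub>0 'k) set \<Rightarrow> 'k set" where
  "proj A\<^sub>0 z = {f \<in> A\<^sub>0. const f \<in> z}"

text \<open>
  The pullback along \<open>proj\<close> of the divisor \<open>E\<close> on the curve: its coefficient at a prime divisor \<open>Y\<close>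
  is the order along \<open>Y\<close> of a local equation \<open>f\<close> of \<open>E\<close> on a neighbourhood \<open>W\<close> of the image of
  some point of \<open>Y\<close>.
\<close>

definition pullback_divisor ::
    "'k::field set \<Rightarrow> (int \<Rightarrow>\<^sub>0 'k) set \<Rightarrow> ('k set \<Rightarrow> int) \<Rightarrow> (int \<Rightarrow>\<^sub>0 'k) set set \<Rightarrow> int" where
  "pullback_divisor A\<^sub>0 A E Y =
     (if prime_divisor A Y
      then (THE k. \<exists>z\<in>Y. \<exists>W f. openin (zariski A\<^sub>0) W \<and> proj A\<^sub>0 z \<in> W \<and> f \<noteq> 0 \<and>
              (\<forall>b\<in>W. frac_ord A\<^sub>0 b f = E b) \<and>
              k = frac_ord A (vanishing_ideal A Y) (const f))
      else 0)"

section \<open>The \<open>\<complex>\<^sup>*\<close>-action\<close>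

abbreviation Cstar :: "complex monoid" where
  "Cstar \<equiv> units_of ring_of_type_algebra"

text \<open>\<open>t.f = t\<^sup>i f\<close> for \<open>f\<close> homogeneous of degree \<open>i\<close>.\<close>

definition act :: "(complex \<Rightarrow> 'k::field) \<Rightarrow> complex \<Rightarrow> (int \<Rightarrow>\<^sub>0 'k) \<Rightarrow> (int \<Rightarrow>\<^sub>0 'k)" where
  "act \<iota> t f = (\<Sum>i\<in>Poly_Mapping.keys f.
     Poly_Mapping.single i (\<iota> (t powi i) * Poly_Mapping.lookup f i))"

text \<open>On points: \<open>f(t z) = (t.f)(z)\<close>, so \<open>f\<close> vanishes at \<open>t z\<close> iff \<open>t.f\<close> vanishes at \<open>z\<close>.\<close>

definition act_pt ::
    "(complex \<Rightarrow> 'k::field) \<Rightarrow> (int \<Rightarrow>\<^sub>0 'k) set \<Rightarrow> complex \<Rightarrow> (int \<Rightarrow>\<^sub>0 'k) set \<Rightarrow> (int \<Rightarrow>\<^sub>0 'k) set" where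
  "act_pt \<iota> A t z = {f \<in> A. act \<iota> t f \<in> z}"

abbreviation Stab ::
    "(complex \<Rightarrow> 'k::field) \<Rightarrow> (int \<Rightarrow>\<^sub>0 'k) set \<Rightarrow> (int \<Rightarrow>\<^sub>0 'k) set \<Rightarrow> complex set" where
  "Stab \<iota> A z \<equiv> stabilizer Cstar (act_pt \<iota> A) z"

definition fixed_points ::
    "(complex \<Rightarrow> 'k::field) \<Rightarrow> (int \<Rightarrow>\<^sub>0 'k) set \<Rightarrow> (int \<Rightarrow>\<^sub>0 'k) set set" where
  "fixed_points \<iota> A = {z \<in> Spm A. \<forall>t\<in>carrier Cstar. act_pt \<iota> A t z = z}"

definition nonfixed_orbits ::
    "(complex \<Rightarrow> 'k::field) \<Rightarrow> (int \<Rightarrow>\<^sub>0 'k) set \<Rightarrow> (int \<Rightarrow>\<^sub>0 'k) set set set" where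
  "nonfixed_orbits \<iota> A = orbits Cstar (Spm A - fixed_points \<iota> A) (act_pt \<iota> A)"

text \<open>
  Orbits of type \<open>(d, q)\<close>.  The \<open>\<complex>\<close>-algebra structure map of \<open>A\<close> is \<open>const \<circ> \<iota>\<close>.  The tangent map
  of a stabilizing \<open>\<zeta>\<close> sends a derivation \<open>\<delta>\<close> to \<open>f \<mapsto> \<delta> (f \<circ> \<zeta>) = \<delta> (\<zeta>.f)\<close>.
\<close>

definition orbit_type ::
    "(complex \<Rightarrow> 'k::field) \<Rightarrow> (int \<Rightarrow>\<^sub>0 'k) set \<Rightarrow> (int \<Rightarrow>\<^sub>0 'k) set set \<Rightarrow> int \<Rightarrow> int \<Rightarrow> bool" where
  "orbit_type \<iota> A Orb d q \<longleftrightarrow>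
     Orb \<in> nonfixed_orbits \<iota> A \<and> 0 \<le> q \<and> q < d \<and>
     (\<forall>z\<in>Orb.
        finite (Stab \<iota> A z) \<and> int (card (Stab \<iota> A z)) = d \<and>
        (\<exists>v w. v \<noteq> w \<and> \<not> module.dependent fscale {v, w} \<and>
           module.span fscale {v, w} = tangent_space (const \<circ> \<iota>) A z \<and>
           (\<forall>\<zeta>\<in>Stab \<iota> A z. v \<circ> act \<iota> \<zeta> = v \<and> w \<circ> act \<iota> \<zeta> = fscale (\<zeta> powi q) w)))"

definition exceptional_orbit ::
    "(complex \<Rightarrow> 'k::field) \<Rightarrow> (int \<Rightarrow>\<^sub>0 'k) set \<Rightarrow> (int \<Rightarrow>\<^sub>0 'k) set set \<Rightarrow> bool" where
  "exceptional_orbit \<iota> A Orb \<longleftrightarrow>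
     Orb \<in> nonfixed_orbits \<iota> A \<and> (\<forall>z\<in>Orb. card (Stab \<iota> A z) \<noteq> 1)"

end

theory Submission
  imports Defs "HOL-Analysis.Continuum_Not_Denumerable"
begin

text \<open>
  At a point \<open>a\<close> of the curve with local parameter \<open>t\<close>, the algebra is spanned over the local ring by
  the monomials \<open>t\<^sup>k u\<^sup>n\<close> with \<open>(n, k)\<close> in the cone cut out by \<open>k m\<^sub>+ \<ge> n e\<^sub>+\<close> and
  \<open>k m\<^sub>- \<le> n e\<^sub>-\<close>, and the points over \<open>a\<close> correspond to the faces of this cone: a boundary ray is
  an orbit and the apex, if there is one, is the fixed point.  Each bounding half plane defines the
  valuation \<open>v(t\<^sup>k u\<^sup>n) = k M - n E\<close> along the closure of the orbit of its boundary ray, from which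
  all multiplicities are read off.  Along the orbit, \<open>t\<^sup>E u\<^sup>M\<close> is invertible and a monomial with
  \<open>v = 1\<close> is a transversal coordinate; its degree is congruent to \<open>q\<close> modulo \<open>M\<close>, which gives the weight
  of the stabilizer on the tangent space.
\<close>

section \<open>Subrings of a commutative ring type\<close>

text \<open>Nothing is shown about \<open>A\<close> being Noetherian or finitely generated, so
  points and multiplicities are reached by other means. Residue fields are complex because
  \<open>A\<close> has countable dimension over the complex numbers. Localizations are never formed:
  statements about them become equations \<open>s * g = s' * \<pi> ^ n\<close> in the ring itself,
  with \<open>s\<close> and \<open>s'\<close> outside the prime. Smoothness is given only as a
  one-dimensional space of derivations; duality and Nakayama turn it into a local parameter.

  Two devices carry the arithmetic of exponents over to functions. Every lattice point of the cone
  is the exponent of some homogeneous element of \<open>A\<close>, since poles elsewhere can be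
  cancelled by functions that do not vanish at \<open>a\<close>. Two functions of equal order at
  \<open>a\<close> differ by a quotient of functions that do not vanish there. A division allowed by
  one half plane may be forbidden by the other; a power of the boundary ray repairs this, and the
  ray is invertible along the orbit. Both orbits are treated at once through a sign \<sigma>, with
  boundary slope \<open>E / M\<close> in lowest terms and \<open>M\<close> positive.\<close>

definition sring :: "'r::comm_ring_1 set \<Rightarrow> bool" where
  "sring A \<longleftrightarrow> 1 \<in> A \<and> (\<forall>x\<in>A. \<forall>y\<in>A. x - y \<in> A \<and> x * y \<in> A)"

lemma sringD:
  assumes "sring A"
  shows "0 \<in> A" "1 \<in> A" "x \<in> A \<Longrightarrow> y \<in> A \<Longrightarrow> x - y \<in> A" "x \<in> A \<Longrightarrow> y \<in> A \<Longrightarrow> x * y \<in> A"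
    "x \<in> A \<Longrightarrow> - x \<in> A" "x \<in> A \<Longrightarrow> y \<in> A \<Longrightarrow> x + y \<in> A" "x \<in> A \<Longrightarrow> x ^ n \<in> A"
proof -
  have d: "x - y \<in> A" "x * y \<in> A" if "x \<in> A" "y \<in> A" for x y
    using assms that by (auto simp: sring_def)
  show o: "1 \<in> A" using assms by (auto simp: sring_def)
  show z: "0 \<in> A" using d(1)[OF o o] by simp
  show m: "- x \<in> A" if "x \<in> A" for x using d(1)[OF z that] by simp
  show "x \<in> A \<Longrightarrow> y \<in> A \<Longrightarrow> x + y \<in> A" using d(1)[OF _ m] by fastforce
  show "x \<in> A \<Longrightarrow> y \<in> A \<Longrightarrow> x - y \<in> A" "x \<in> A \<Longrightarrow> y \<in> A \<Longrightarrow> x * y \<in> A" using d by auto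
  show "x \<in> A \<Longrightarrow> x ^ n \<in> A" by (induction n) (auto intro: o d)
qed

lemma sring_sum: "sring A \<Longrightarrow> (\<And>i. i \<in> I \<Longrightarrow> f i \<in> A) \<Longrightarrow> sum f I \<in> A"
  by (induction I rule: infinite_finite_induct) (auto intro: sringD)

lemma sring_prod: "sring A \<Longrightarrow> (\<And>i. i \<in> I \<Longrightarrow> f i \<in> A) \<Longrightarrow> prod f I \<in> A"
  by (induction I rule: infinite_finite_induct) (auto intro: sringD)

lemma rta_simps [simp]:
  "carrier ring_of_type_algebra = UNIV" "x \<otimes>\<^bsub>ring_of_type_algebra\<^esub> y = x * y"
  "x \<oplus>\<^bsub>ring_of_type_algebra\<^esub> y = x + y" "\<one>\<^bsub>ring_of_type_algebra\<^esub> = 1"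
  "\<zero>\<^bsub>ring_of_type_algebra\<^esub> = 0"
  by (auto simp: ring_of_type_algebra_def)

lemma subr_simps [simp]:
  "x \<otimes>\<^bsub>subr A\<^esub> y = x * y" "x \<oplus>\<^bsub>subr A\<^esub> y = x + y" "\<one>\<^bsub>subr A\<^esub> = 1" "\<zero>\<^bsub>subr A\<^esub> = 0"
  by (auto simp: ring_of_type_algebra_def)

lemma rta_uminus [simp]: "\<ominus>\<^bsub>ring_of_type_algebra\<^esub> x = - (x::'a::comm_ring_1)"
proof -
  interpret ring "ring_of_type_algebra :: 'a ring" by (rule ring_from_type_algebra)
  show ?thesis by (rule minus_equality[symmetric, symmetric]) auto
qed

lemma cring_subr: assumes "sring A" shows "cring (subr A)"
proof (rule cringI)
  show "abelian_group (subr A)"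
    by (rule abelian_groupI) (auto intro: sringD[OF assms] bexI[of _ "- x" for x])
  show "Group.comm_monoid (subr A)"
    by (rule comm_monoidI) (auto intro: sringD[OF assms])
qed (auto simp: algebra_simps)

text \<open>Negation needs no clause of its own: \<open>- 1\<close> lies in \<open>A\<close>, and
  \<open>- x\<close> is the product \<open>- 1 * x\<close>.\<close>

lemma ideal_subr_iff:
  assumes "sring A"
  shows "ideal I (subr A) \<longleftrightarrow>
    I \<subseteq> A \<and> 0 \<in> I \<and> (\<forall>x\<in>I. \<forall>y\<in>I. x + y \<in> I) \<and> (\<forall>x\<in>A. \<forall>y\<in>I. x * y \<in> I)"
proof
  assume "ideal I (subr A)"
  then interpret ideal I "subr A" .
  show "I \<subseteq> A \<and> 0 \<in> I \<and> (\<forall>x\<in>I. \<forall>y\<in>I. x + y \<in> I) \<and> (\<forall>x\<in>A. \<forall>y\<in>I. x * y \<in> I)"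
    using Icarr I_l_closed additive_subgroup.zero_closed[OF additive_subgroup_axioms]
      additive_subgroup.a_closed[OF additive_subgroup_axioms] by auto
next
  interpret cring "subr A" by (rule cring_subr[OF assms])
  assume h: "I \<subseteq> A \<and> 0 \<in> I \<and> (\<forall>x\<in>I. \<forall>y\<in>I. x + y \<in> I) \<and> (\<forall>x\<in>A. \<forall>y\<in>I. x * y \<in> I)"
  have h': "\<forall>x\<in>A. \<forall>y\<in>I. y * x \<in> I" using h by (simp add: mult.commute)
  have neg: "- x \<in> I" if "x \<in> I" for x
  proof -
    have "- 1 \<in> A" using sringD[OF assms] by blast
    then have "- 1 * x \<in> I" using h that by blast
    then show ?thesis by simp
  qed
  have inv: "\<ominus>\<^bsub>subr A\<^esub> x = - x" if "x \<in> A" for x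
    by (rule minus_equality) (use that sringD(5)[OF assms] in auto)
  have inv': "inv\<^bsub>add_monoid (subr A)\<^esub> x \<in> I" if "x \<in> I" for x
    using inv[of x] neg[OF that] that h by (auto simp only: a_inv_def subset_iff)
  show "ideal I (subr A)"
  proof (rule idealI)
    show "subgroup I (add_monoid (subr A))"
      by (rule subgroup.intro[OF _ _ _ inv']) (use h in auto)
  qed (use h h' in \<open>auto simp: ring_axioms\<close>)
qed

lemma idealD:
  assumes "sring A" "ideal I (subr A)"
  shows "x \<in> I \<Longrightarrow> x \<in> A" "0 \<in> I" "x \<in> I \<Longrightarrow> y \<in> I \<Longrightarrow> x + y \<in> I"
    "x \<in> A \<Longrightarrow> y \<in> I \<Longrightarrow> x * y \<in> I" "y \<in> A \<Longrightarrow> x \<in> I \<Longrightarrow> x * y \<in> I"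
    "x \<in> I \<Longrightarrow> - x \<in> I" "x \<in> I \<Longrightarrow> y \<in> I \<Longrightarrow> x - y \<in> I"
proof -
  note h = assms(2)[unfolded ideal_subr_iff[OF assms(1)]]
  show "x \<in> I \<Longrightarrow> x \<in> A" "0 \<in> I" "x \<in> I \<Longrightarrow> y \<in> I \<Longrightarrow> x + y \<in> I"
    "x \<in> A \<Longrightarrow> y \<in> I \<Longrightarrow> x * y \<in> I" "y \<in> A \<Longrightarrow> x \<in> I \<Longrightarrow> x * y \<in> I"
    using h by (auto simp: mult.commute)
  have neg: "- x \<in> I" if "x \<in> I" for x
  proof -
    have "- 1 \<in> A" using sringD[OF assms(1)] by blast
    then have "- 1 * x \<in> I" using h that by blast
    then show ?thesis by simp
  qed
  then show "x \<in> I \<Longrightarrow> - x \<in> I" .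
  show "x \<in> I \<Longrightarrow> y \<in> I \<Longrightarrow> x - y \<in> I" using neg[of y] h by (metis add_uminus_conv_diff)
qed

lemma ideal_sum: "sring A \<Longrightarrow> ideal I (subr A) \<Longrightarrow> (\<And>i. i \<in> J \<Longrightarrow> f i \<in> I) \<Longrightarrow> sum f J \<in> I"
  by (induction J rule: infinite_finite_induct) (auto intro: idealD)

lemma primeideal_subr_iff:
  assumes "sring A"
  shows "primeideal P (subr A) \<longleftrightarrow>
    ideal P (subr A) \<and> 1 \<notin> P \<and> (\<forall>x\<in>A. \<forall>y\<in>A. x * y \<in> P \<longrightarrow> x \<in> P \<or> y \<in> P)"
    (is "_ \<longleftrightarrow> ?R")
proof
  assume "primeideal P (subr A)"
  then interpret primeideal P "subr A" .
  have "1 \<notin> P"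
    using I_notcarr idealD(4)[OF assms is_ideal, of _ 1] idealD(1)[OF assms is_ideal] by auto
  then show ?R using is_ideal I_prime by auto
next
  assume R: ?R
  then interpret ideal P "subr A" by auto
  show "primeideal P (subr A)"
    by (rule primeidealI) (use R sringD(2)[OF assms] is_ideal cring_subr[OF assms] in auto)
qed

lemma primeD:
  assumes "sring A" "primeideal P (subr A)"
  shows "ideal P (subr A)" "1 \<notin> P" "x \<in> A \<Longrightarrow> y \<in> A \<Longrightarrow> x * y \<in> P \<Longrightarrow> x \<in> P \<or> y \<in> P"
    "x \<in> A - P \<Longrightarrow> y \<in> A - P \<Longrightarrow> x * y \<in> A - P" "1 \<in> A - P" "x \<in> A - P \<Longrightarrow> x ^ n \<in> A - P"
    "x \<in> A \<Longrightarrow> x ^ n \<in> P \<Longrightarrow> x \<in> P"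
proof -
  note h = assms(2)[unfolded primeideal_subr_iff[OF assms(1)]]
  show "ideal P (subr A)" "1 \<notin> P" "x \<in> A \<Longrightarrow> y \<in> A \<Longrightarrow> x * y \<in> P \<Longrightarrow> x \<in> P \<or> y \<in> P"
    using h by auto
  show m: "x \<in> A - P \<Longrightarrow> y \<in> A - P \<Longrightarrow> x * y \<in> A - P" for x y
    using h sringD(4)[OF assms(1)] by auto
  show o: "1 \<in> A - P" using h sringD(2)[OF assms(1)] by auto
  show p: "x \<in> A - P \<Longrightarrow> x ^ n \<in> A - P" for x by (induction n) (use m o in auto)
  show "x \<in> A \<Longrightarrow> x ^ n \<in> P \<Longrightarrow> x \<in> P" using p by auto
qed

lemma prime_prod:
  assumes "sring A" "primeideal P (subr A)" "\<And>i. i \<in> I \<Longrightarrow> f i \<in> A - P"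
  shows "prod f I \<in> A - P"
  using assms(3)
proof (induction I rule: infinite_finite_induct)
  case (insert x F)
  have "f x * prod f F \<in> A - P"
    by (rule primeD(4)[OF assms(1,2)]) (use insert in auto)
  then show ?case using insert by simp
qed (use primeD(5)[OF assms(1,2)] in auto)

text \<open>For \<open>x\<close> outside \<open>z\<close>, maximality applied to the ideal
  \<open>z + x A\<close> produces an inverse of \<open>x\<close> modulo \<open>z\<close>.
  Conversely, such an inverse puts 1 into every ideal that properly contains
  \<open>z\<close>.\<close>

lemma Spm_iff:
  assumes "sring A"
  shows "z \<in> Spm A \<longleftrightarrow> ideal z (subr A) \<and> 1 \<notin> z \<and> (\<forall>x\<in>A - z. \<exists>y\<in>A. 1 - x * y \<in> z)"
    (is "_ \<longleftrightarrow> ?R")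
proof
  assume "z \<in> Spm A"
  then interpret maximalideal z "subr A" by (simp add: Spm_def)
  have 1: "1 \<notin> z"
    using I_notcarr idealD(4)[OF assms is_ideal, of _ 1] idealD(1)[OF assms is_ideal] by auto
  have "\<exists>y\<in>A. 1 - x * y \<in> z" if x: "x \<in> A - z" for x
  proof -
    let ?J = "{p + x * y | p y. p \<in> z \<and> y \<in> A}"
    have in1: "p \<in> ?J" if "p \<in> z" for p using that sringD(1)[OF assms] by force
    have inx: "x \<in> ?J" using idealD(2)[OF assms is_ideal] sringD(2)[OF assms] by force
    have J: "ideal ?J (subr A)"
      unfolding ideal_subr_iff[OF assms]
    proof (intro conjI ballI)
      show "?J \<subseteq> A" using x by (auto intro!: sringD(6)[OF assms] sringD(4)[OF assms] intro: idealD(1)[OF assms is_ideal])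
      show "0 \<in> ?J" by (rule in1) (rule idealD(2)[OF assms is_ideal])
      fix a b assume "a \<in> ?J" "b \<in> ?J"
      then obtain p y q w where "a = p + x * y" "b = q + x * w" "p \<in> z" "q \<in> z" "y \<in> A" "w \<in> A"
        by blast
      then have "a + b = (p + q) + x * (y + w)" "p + q \<in> z" "y + w \<in> A"
        by (auto simp: algebra_simps intro: sringD[OF assms] idealD[OF assms is_ideal])
      then show "a + b \<in> ?J" by blast
    next
      fix a b assume a: "a \<in> A" and "b \<in> ?J"
      then obtain p y where "b = p + x * y" "p \<in> z" "y \<in> A" by blast
      then have "a * b = a * p + x * (a * y)" "a * p \<in> z" "a * y \<in> A"
        using a by (auto simp: algebra_simps intro: sringD[OF assms] idealD[OF assms is_ideal])
      then show "a * b \<in> ?J" by blast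
    qed
    have "z \<subseteq> ?J" "?J \<subseteq> carrier (subr A)"
      using in1 J[unfolded ideal_subr_iff[OF assms]] by (blast, simp del: mem_Collect_eq)
    then have "?J = z \<or> ?J = carrier (subr A)" by (rule I_maximal[OF J])
    moreover have "?J \<noteq> z" using inx x by blast
    moreover have "carrier (subr A) = A" by simp
    ultimately have "?J = A" by metis
    then have "1 \<in> ?J" using sringD(2)[OF assms] by (simp only:)
    then obtain p y where "1 = p + x * y" "p \<in> z" "y \<in> A" by blast
    then show ?thesis by (metis add_diff_cancel_right')
  qed
  then show ?R using 1 is_ideal by auto
next
  assume R: ?R
  then have I: "ideal z (subr A)" by auto
  show "z \<in> Spm A" unfolding Spm_def mem_Collect_eq
  proof (rule maximalidealI[OF I])
    show "carrier (subr A) \<noteq> z" using R sringD(2)[OF assms] by auto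
    fix J assume J: "ideal J (subr A)" "z \<subseteq> J" "J \<subseteq> carrier (subr A)"
    show "J = z \<or> J = carrier (subr A)"
    proof (cases "J = z")
      case False
      then obtain x where x: "x \<in> J" "x \<in> A - z" using J by auto
      then obtain y where y: "y \<in> A" "1 - x * y \<in> z" using R by blast
      have "x * y \<in> J" using x y idealD[OF assms J(1)] by auto
      then have "(1 - x * y) + x * y \<in> J" using idealD(3)[OF assms J(1)] J y by blast
      then have "1 \<in> J" by simp
      then have "J = A" using idealD(4)[OF assms J(1), of _ 1] J by auto
      then show ?thesis by simp
    qed simp
  qed
qed

lemma Spm_ideal: "sring A \<Longrightarrow> z \<in> Spm A \<Longrightarrow> ideal z (subr A)"
  by (simp add: Spm_iff)

lemma Spm_prime: assumes "sring A" "z \<in> Spm A" shows "primeideal z (subr A)"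
proof -
  interpret cring "subr A" by (rule cring_subr[OF assms(1)])
  show ?thesis by (rule maximalideal_prime) (use assms in \<open>simp add: Spm_def\<close>)
qed

lemma Spm_eqI: assumes "sring A" "z \<in> Spm A" "ideal J (subr A)" "z \<subseteq> J" "1 \<notin> J" shows "J = z"
proof -
  have "maximalideal z (subr A)" using assms by (simp add: Spm_def)
  then have "J = z \<or> J = A"
    using maximalideal.I_maximal[of z "subr A" J] assms(3-4) idealD(1)[OF assms(1,3)] by auto
  then show ?thesis using assms(5) sringD(2)[OF assms(1)] by auto
qed

text \<open>Source of functions that vanish at one point and not at another.\<close>

lemma Spm_diff: assumes "sring A" "a \<in> Spm A" "b \<in> Spm A" "a \<noteq> b" shows "\<exists>x. x \<in> b \<and> x \<notin> a"
  using Spm_eqI[OF assms(1,3) Spm_ideal[OF assms(1,2)]] assms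
    Spm_iff[OF assms(1), of a] by auto

text \<open>Zorn's lemma among the ideals above \<open>I\<close> that omit 1: the union of a
  nonempty chain of them is again one of them.\<close>

lemma exists_Spm:
  assumes "sring A" "ideal I (subr A)" "1 \<notin> I"
  shows "\<exists>z\<in>Spm A. I \<subseteq> z"
proof -
  let ?S = "{J. ideal J (subr A) \<and> 1 \<notin> J \<and> I \<subseteq> J}"
  have "\<exists>M\<in>?S. \<forall>Z\<in>?S. M \<subseteq> Z \<longrightarrow> Z = M"
  proof (rule subset_Zorn_nonempty)
    show "?S \<noteq> {}" using assms by auto
    fix C assume C: "C \<noteq> {}" "subset.chain ?S C"
    then have CS: "C \<subseteq> ?S" and lin: "\<And>Z Y. Z \<in> C \<Longrightarrow> Y \<in> C \<Longrightarrow> Z \<subseteq> Y \<or> Y \<subseteq> Z"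
      by (auto simp: subset.chain_def)
    have id: "\<And>J. J \<in> C \<Longrightarrow> ideal J (subr A)" using CS by auto
    have CI: "ideal (\<Union>C) (subr A)" unfolding ideal_subr_iff[OF assms(1)]
    proof (intro conjI ballI)
      show "\<Union>C \<subseteq> A" using idealD(1)[OF assms(1) id] by blast
      show "0 \<in> \<Union>C" using idealD(2)[OF assms(1) id] C(1) by blast
      fix x y assume "x \<in> \<Union>C" "y \<in> \<Union>C"
      then obtain Z Y where XY: "Z \<in> C" "Y \<in> C" "x \<in> Z" "y \<in> Y" by blast
      with lin[OF XY(1,2)] show "x + y \<in> \<Union>C"
        using idealD(3)[OF assms(1) id] by blast
    next
      fix x y assume "x \<in> A" "y \<in> \<Union>C"
      then show "x * y \<in> \<Union>C" using idealD(4)[OF assms(1) id] by blast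
    qed
    then show "\<Union>C \<in> ?S" using CS C(1) by auto
  qed
  then obtain M where M: "M \<in> ?S" and "\<forall>Z\<in>?S. M \<subseteq> Z \<longrightarrow> Z = M" by (rule bexE)
  then have max: "Z = M" if "ideal Z (subr A)" "1 \<notin> Z" "I \<subseteq> Z" "M \<subseteq> Z" for Z
    using that by (auto simp only: mem_Collect_eq)
  have "maximalideal M (subr A)"
  proof (rule maximalidealI)
    show "ideal M (subr A)" "carrier (subr A) \<noteq> M" using M sringD(2)[OF assms(1)] by auto
    fix J assume J: "ideal J (subr A)" "M \<subseteq> J" "J \<subseteq> carrier (subr A)"
    show "J = M \<or> J = carrier (subr A)"
    proof (cases "1 \<in> J")
      case True
      then have "J = A" using idealD(4)[OF assms(1) J(1), of _ 1] J by auto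
      then show ?thesis by simp
    qed (use max[of J] J M in \<open>auto simp del: subset_iff\<close>)
  qed
  then show ?thesis using M by (auto simp: Spm_def)
qed

section \<open>Discrete valuations\<close>

text \<open>
  \<open>unif A P \<pi>\<close> says that \<open>A\<^sub>P\<close> is a discrete valuation ring with uniformizer \<open>\<pi>\<close>.
\<close>

definition unif :: "'r::idom set \<Rightarrow> 'r set \<Rightarrow> 'r \<Rightarrow> bool" where
  "unif A P \<pi> \<longleftrightarrow> sring A \<and> primeideal P (subr A) \<and> \<pi> \<in> P \<and> \<pi> \<noteq> 0 \<and>
     (\<forall>g\<in>A. g \<noteq> 0 \<longrightarrow> (\<exists>n. \<exists>s\<in>A - P. \<exists>s'\<in>A - P. s * g = s' * \<pi> ^ n))"

text \<open>The equation \<open>g = (s' / s) \<pi>^n\<close> in the local ring, with unit factor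
  \<open>s' / s\<close>, cleared of denominators.\<close>

definition fraction_order :: "'r::idom set \<Rightarrow> 'r set \<Rightarrow> 'r \<Rightarrow> 'r \<Rightarrow> nat \<Rightarrow> bool" where
  "fraction_order A P \<pi> g n \<longleftrightarrow> (\<exists>s\<in>A - P. \<exists>s'\<in>A - P. s * g = s' * \<pi> ^ n)"

lemma ideals_set_pow_Suc:
  "P [^]\<^bsub>ideals_set R\<^esub> (0::nat) = carrier R"
  "P [^]\<^bsub>ideals_set R\<^esub> (Suc n) = ideal_prod R (P [^]\<^bsub>ideals_set R\<^esub> n) P"
  by (auto simp: nat_pow_def ideals_set_def)

lemma prime_ord_eqI:
  "prime_ord A P g = n" if "\<And>m. (\<exists>s\<in>A - P. s * g \<in> P [^]\<^bsub>ideals_set (subr A)\<^esub> m) \<longleftrightarrow> m \<le> n"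
  unfolding prime_ord_def that by (rule Greatest_equality) auto

context
  fixes A :: "'r::idom set" and P \<pi>
  assumes U: "unif A P \<pi>"
begin

lemma unif_facts: "sring A" "primeideal P (subr A)" "ideal P (subr A)" "\<pi> \<in> P" "\<pi> \<noteq> 0" "\<pi> \<in> A"
  using U primeD(1) idealD(1) by (auto simp: unif_def) blast+

lemma fraction_order_exists: "g \<in> A \<Longrightarrow> g \<noteq> 0 \<Longrightarrow> \<exists>n. fraction_order A P \<pi> g n"
  using U by (auto simp: unif_def fraction_order_def)

text \<open>Otherwise cancelling \<open>\<pi> ^ n\<close> in the domain would show \<open>s\<close>
  to be a multiple of \<pi>, hence an element of \<open>P\<close>.\<close>

lemma unif_power_le:
  assumes "s \<in> A - P" "g \<in> A" "s * \<pi> ^ n = g * \<pi> ^ m"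
  shows "m \<le> n"
proof (rule ccontr)
  assume "\<not> m \<le> n"
  then obtain k where k: "m = n + Suc k" by (metis add_Suc_right less_imp_Suc_add not_le)
  have "s * \<pi> ^ n = (g * \<pi> ^ k * \<pi>) * \<pi> ^ n"
    using assms(3) unfolding k by (simp add: power_add algebra_simps)
  then have "s = g * \<pi> ^ k * \<pi>" using unif_facts(5) by simp
  moreover have "g * \<pi> ^ k * \<pi> \<in> P"
    by (rule idealD(4)[OF unif_facts(1,3)]) (auto intro: sringD[OF unif_facts(1)] unif_facts assms)
  ultimately show False using assms by auto
qed

text \<open>Locally \<open>P\<close> is generated by \<pi>, hence its \<open>n\<close>-th power by
  \<open>\<pi> ^ n\<close>. The ideal product is generated by products under sums, and the
  denominators \<open>s\<close> of the pieces are multiplied together.\<close>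

lemma prime_power_local:
  assumes "f \<in> P [^]\<^bsub>ideals_set (subr A)\<^esub> (n::nat)"
  shows "f \<in> A \<and> (\<exists>s\<in>A - P. \<exists>b\<in>A. s * f = b * \<pi> ^ n)"
  using assms
proof (induction n arbitrary: f)
  case 0
  then have "f \<in> A" unfolding ideals_set_pow_Suc by simp
  then show ?case using primeD(5)[OF unif_facts(1,2)] by (auto intro!: bexI[of _ 1])
next
  case (Suc n)
  note s = sringD[OF unif_facts(1)]
  from Suc.prems[unfolded ideals_set_pow_Suc] show ?case
  proof (induction f rule: ideal_prod.induct)
    case (prod i j)
    have i: "i \<in> A" "\<exists>s\<in>A - P. \<exists>b\<in>A. s * i = b * \<pi> ^ n" using Suc.IH prod by auto
    have j: "j \<in> A" using prod idealD(1)[OF unif_facts(1,3)] by auto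
    \<comment> \<open>The exponent of an element of \<open>P\<close> is positive, since exponent 0
      would put the unit factor \<open>t'\<close> into \<open>P\<close>; so one factor \<pi> splits
      off.\<close>
    have "\<exists>s\<in>A - P. \<exists>b\<in>A. s * j = b * \<pi>"
    proof (cases "j = 0")
      case True then show ?thesis using primeD(5)[OF unif_facts(1,2)] s(1) by (auto intro!: bexI[of _ 1] bexI[of _ 0])
    next
      case False
      then obtain m t t' where t: "t \<in> A - P" "t' \<in> A - P" "t * j = t' * \<pi> ^ m"
        using fraction_order_exists[OF j] by (auto simp: fraction_order_def)
      have "t * j \<in> P" using t(1,2) prod(2) idealD(4)[OF unif_facts(1,3)] by blast
      then have "t' * \<pi> ^ m \<in> P" by (simp only: t(3))
      then have "m \<noteq> 0" using t(2) by (cases m) auto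
      then obtain l where "m = Suc l" by (cases m) auto
      then have "t * j = (t' * \<pi> ^ l) * \<pi>" "t' * \<pi> ^ l \<in> A"
        using t s unif_facts by (auto simp: algebra_simps)
      then show ?thesis using t by blast
    qed
    then obtain t c where t: "t \<in> A - P" "c \<in> A" "t * j = c * \<pi>" by blast
    obtain r b where r: "r \<in> A - P" "b \<in> A" "r * i = b * \<pi> ^ n" using i by blast
    have "(r * t) * (i * j) = (r * i) * (t * j)" by (simp add: algebra_simps)
    also have "\<dots> = (b * c) * \<pi> ^ Suc n" unfolding t(3) r(3) by (simp add: algebra_simps)
    finally have "(r * t) * (i * j) = (b * c) * \<pi> ^ Suc n" .
    moreover have "r * t \<in> A - P" by (rule primeD(4)[OF unif_facts(1,2) r(1) t(1)])
    moreover have "b * c \<in> A" "i * j \<in> A" by (rule s(4)[OF r(2) t(2)], rule s(4)[OF i(1) j])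
    ultimately show ?case unfolding subr_simps by (intro conjI bexI)
  next
    case (sum f g)
    then obtain t c where t: "t \<in> A - P" "c \<in> A" "t * f = c * \<pi> ^ Suc n" "f \<in> A" by blast
    obtain r b where r: "r \<in> A - P" "b \<in> A" "r * g = b * \<pi> ^ Suc n" "g \<in> A" using sum by blast
    have "(r * t) * (f + g) = r * (t * f) + t * (r * g)" by (simp add: algebra_simps)
    then have "(r * t) * (f + g) = (r * c + t * b) * \<pi> ^ Suc n"
      unfolding t(3) r(3) by (simp add: algebra_simps)
    moreover have "r * t \<in> A - P" by (rule primeD(4)[OF unif_facts(1,2) r(1) t(1)])
    moreover have "r * c + t * b \<in> A" using r(1) t(1) by (intro s(6) s(4) t(2) r(2)) auto
    moreover have "f + g \<in> A" by (rule s(6)[OF t(4) r(4)])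
    ultimately show ?case unfolding subr_simps by (intro conjI bexI)
  qed
qed

lemma pi_power_mem: "b \<in> A \<Longrightarrow> b * \<pi> ^ n \<in> P [^]\<^bsub>ideals_set (subr A)\<^esub> (n::nat)"
proof (induction n)
  case 0
  then show ?case unfolding ideals_set_pow_Suc by simp
next
  case (Suc n)
  have "(b * \<pi> ^ n) \<otimes>\<^bsub>subr A\<^esub> \<pi> \<in> P [^]\<^bsub>ideals_set (subr A)\<^esub> (Suc n)"
    unfolding ideals_set_pow_Suc by (rule ideal_prod.prod) (use Suc unif_facts in auto)
  then show ?case by (simp add: algebra_simps)
qed

lemma prime_ord_eq:
  assumes "g \<in> A" "fraction_order A P \<pi> g n"
  shows "prime_ord A P g = n"
proof (rule prime_ord_eqI)
  note s = sringD[OF unif_facts(1)]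
  obtain t t' where t: "t \<in> A - P" "t' \<in> A - P" "t * g = t' * \<pi> ^ n"
    using assms by (auto simp: fraction_order_def)
  fix m
  show "(\<exists>s\<in>A - P. s * g \<in> P [^]\<^bsub>ideals_set (subr A)\<^esub> m) \<longleftrightarrow> m \<le> n"
  proof
    assume "\<exists>s\<in>A - P. s * g \<in> P [^]\<^bsub>ideals_set (subr A)\<^esub> m"
    then obtain r where r: "r \<in> A - P" "r * g \<in> P [^]\<^bsub>ideals_set (subr A)\<^esub> m" by blast
    obtain q b where q: "q \<in> A - P" "b \<in> A" "q * (r * g) = b * \<pi> ^ m"
      using prime_power_local[OF r(2)] by blast
    have "(q * r * t') * \<pi> ^ n = (q * r) * (t * g)" unfolding t by (simp add: algebra_simps)
    also have "\<dots> = (t * b) * \<pi> ^ m" using q(3) by (simp add: algebra_simps)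
    finally have eq: "(q * r * t') * \<pi> ^ n = (t * b) * \<pi> ^ m" .
    note pm = primeD(4)[OF unif_facts(1,2)]
    have "t * b \<in> A" using t(1) q(2) s(4) by auto
    then show "m \<le> n" by (rule unif_power_le[OF pm[OF pm[OF q(1) r(1)] t(2)] _ eq])
  next
    assume "m \<le> n"
    then obtain k where "n = k + m" by (metis add.commute le_iff_add)
    then have "t * g = (t' * \<pi> ^ k) * \<pi> ^ m" unfolding t(3) by (simp add: power_add algebra_simps)
    moreover have "(t' * \<pi> ^ k) * \<pi> ^ m \<in> P [^]\<^bsub>ideals_set (subr A)\<^esub> m"
      by (rule pi_power_mem) (use t s unif_facts in auto)
    ultimately have "t * g \<in> P [^]\<^bsub>ideals_set (subr A)\<^esub> m" by (simp only:)
    then show "\<exists>s\<in>A - P. s * g \<in> P [^]\<^bsub>ideals_set (subr A)\<^esub> m" using t(1) by blast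
  qed
qed

lemma fraction_order_prime_ord:
  "g \<in> A \<Longrightarrow> g \<noteq> 0 \<Longrightarrow> fraction_order A P \<pi> g (prime_ord A P g)"
  using fraction_order_exists prime_ord_eq by blast

lemma prime_ord_mult:
  assumes "g \<in> A" "h \<in> A" "g \<noteq> 0" "h \<noteq> 0"
  shows "prime_ord A P (g * h) = prime_ord A P g + prime_ord A P h"
proof (rule prime_ord_eq)
  show "g * h \<in> A" using sringD[OF unif_facts(1)] assms by auto
  obtain s s' where s: "s \<in> A - P" "s' \<in> A - P" "s * g = s' * \<pi> ^ prime_ord A P g"
    using fraction_order_prime_ord[of g] assms by (auto simp: fraction_order_def)
  obtain r r' where r: "r \<in> A - P" "r' \<in> A - P" "r * h = r' * \<pi> ^ prime_ord A P h"
    using fraction_order_prime_ord[of h] assms by (auto simp: fraction_order_def)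
  have "(s * r) * (g * h) = (s * g) * (r * h)" by (simp add: algebra_simps)
  also have "\<dots> = (s' * r') * \<pi> ^ (prime_ord A P g + prime_ord A P h)"
    unfolding s r by (simp add: algebra_simps power_add)
  finally show "fraction_order A P \<pi> (g * h) (prime_ord A P g + prime_ord A P h)"
    using primeD(4)[OF unif_facts(1,2)] s r unfolding fraction_order_def by blast
qed

lemma prime_ord_pos_iff: "g \<in> A \<Longrightarrow> g \<noteq> 0 \<Longrightarrow> prime_ord A P g > 0 \<longleftrightarrow> g \<in> P"
proof -
  assume g: "g \<in> A" "g \<noteq> 0"
  obtain s s' where s: "s \<in> A - P" "s' \<in> A - P" "s * g = s' * \<pi> ^ prime_ord A P g"
    using fraction_order_prime_ord[of g] g by (auto simp: fraction_order_def)
  note i = idealD[OF unif_facts(1,3)] and a = sringD[OF unif_facts(1)]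
  show ?thesis
  proof
    assume "prime_ord A P g > 0"
    then obtain k where k: "prime_ord A P g = Suc k" by (metis gr0_implies_Suc)
    have "s * g \<in> P" unfolding s k power_Suc2 mult.assoc[symmetric]
      by (rule i(4)) (use s a unif_facts in auto)
    then show "g \<in> P" using primeD(3)[OF unif_facts(1,2), of s g] s g by auto
  next
    assume "g \<in> P"
    then have "s * g \<in> P" using i(4) s(1,2) by auto
    then show "prime_ord A P g > 0" using s by (cases "prime_ord A P g") auto
  qed
qed

text \<open>The description in \<open>frac_ord\<close> denotes: two presentations of
  \<open>f\<close> as a fraction satisfy \<open>g * h' = g' * h\<close>, and
  \<open>prime_ord\<close> is additive.\<close>

lemma frac_ord_eq:
  assumes "g \<in> A" "h \<in> A" "g \<noteq> 0" "h \<noteq> 0" "f * h = g"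
  shows "frac_ord A P f = int (prime_ord A P g) - int (prime_ord A P h)"
  unfolding frac_ord_def
proof (rule the_equality)
  show "\<exists>g'\<in>A. \<exists>h'\<in>A. g' \<noteq> 0 \<and> h' \<noteq> 0 \<and> f * h' = g' \<and> int (prime_ord A P g) - int (prime_ord A P h) = int (prime_ord A P g') - int (prime_ord A P h')"
    using assms by blast
  fix k assume "\<exists>g'\<in>A. \<exists>h'\<in>A. g' \<noteq> 0 \<and> h' \<noteq> 0 \<and> f * h' = g' \<and> k = int (prime_ord A P g') - int (prime_ord A P h')"
  then obtain g' h' where w: "g' \<in> A" "h' \<in> A" "g' \<noteq> 0" "h' \<noteq> 0" "f * h' = g'" "k = int (prime_ord A P g') - int (prime_ord A P h')"
    by blast
  have "g * h' = g' * h" using w assms by (auto simp: algebra_simps)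
  then have "prime_ord A P g + prime_ord A P h' = prime_ord A P g' + prime_ord A P h"
    using prime_ord_mult w assms by metis
  then show "k = int (prime_ord A P g) - int (prime_ord A P h)" using w by simp
qed

text \<open>A nonzero element of \<open>Q\<close> is, up to factors outside \<open>P\<close>, a
  power of \<pi>; so \<pi> itself lies in \<open>Q\<close>. Every element of \<open>P\<close> is
  locally a multiple of \<pi>, hence in \<open>Q\<close> as well.\<close>

lemma unif_no_between:
  assumes "primeideal Q (subr A)" "Q \<subset> P" "Q \<noteq> {0}"
  shows False
proof -
  note Q = primeD[OF unif_facts(1) assms(1)]
  obtain g where g: "g \<in> Q" "g \<noteq> 0" using assms(3) idealD(2)[OF unif_facts(1) Q(1)] by blast
  then have gA: "g \<in> A" using idealD(1)[OF unif_facts(1) Q(1)] by auto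
  obtain n s s' where s: "s \<in> A - P" "s' \<in> A - P" "s * g = s' * \<pi> ^ n"
    using fraction_order_exists[OF gA g(2)] by (auto simp: fraction_order_def)
  have "s' * \<pi> ^ n \<in> Q" unfolding s(3)[symmetric] using idealD(4)[OF unif_facts(1) Q(1)] g s(1,2) by auto
  then have "\<pi> ^ n \<in> Q"
    using Q(3)[of s' "\<pi> ^ n"] s assms(2) sringD(7)[OF unif_facts(1,6)] by auto
  then have pi: "\<pi> \<in> Q" using Q(7) unif_facts(6) by auto
  obtain p where p: "p \<in> P" "p \<notin> Q" using assms(2) by auto
  have pA: "p \<in> A" "p \<noteq> 0" using p idealD(1)[OF unif_facts(1,3)] idealD(2)[OF unif_facts(1) Q(1)] by auto
  obtain n s s' where s: "s \<in> A - P" "s' \<in> A - P" "s * p = s' * \<pi> ^ n"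
    using fraction_order_exists[OF pA] by (auto simp: fraction_order_def)
  have "s * p \<in> P" using idealD(4)[OF unif_facts(1,3)] p s(1,2) by auto
  then have "n \<noteq> 0" using s by (cases n) auto
  then obtain l where l: "n = Suc l" by (cases n) auto
  have "s * p \<in> Q" unfolding s l power_Suc2 mult.assoc[symmetric]
    by (rule idealD(4)[OF unif_facts(1) Q(1)]) (use pi s sringD[OF unif_facts(1)] unif_facts in auto)
  then show False using Q(3)[of s p] s p pA assms(2) by auto
qed

lemma unif_height: "has_height A P 1"
proof -
  have z: "primeideal {0} (subr A)"
    unfolding primeideal_subr_iff[OF unif_facts(1)] ideal_subr_iff[OF unif_facts(1)]
    using sringD(1)[OF unif_facts(1)] by auto
  have "{0} \<subset> P" using unif_facts idealD(2)[OF unif_facts(1,3)] by auto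
  then have "prime_chain A 1 (\<lambda>i. if i = 0 then {0} else P)"
    using z unif_facts by (auto simp: prime_chain_def)
  moreover have "\<not> (\<exists>p. prime_chain A (Suc 1) p \<and> p (Suc 1) = P)"
  proof safe
    fix p assume p: "prime_chain A (Suc 1) p" "P = p (Suc 1)"
    have p0: "primeideal (p 0) (subr A)" "p 0 \<subset> p 1" "primeideal (p 1) (subr A)" "p 1 \<subset> P"
      using p by (auto simp: prime_chain_def)
    have "p 1 \<noteq> {0}"
      using p0(2) idealD(2)[OF unif_facts(1) primeD(1)[OF unif_facts(1) p0(1)]] by auto
    then show False using unif_no_between p0 by blast
  qed
  ultimately show ?thesis unfolding has_height_def by force
qed

end

text \<open>Only primality of \<open>P\<close> is known here, so \<open>prime_ord\<close> itself
  need not be meaningful. Still, \<open>f * h = g\<close> gives \<open>y * g = x * h\<close> with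
  \<open>x\<close> and \<open>y\<close> outside \<open>P\<close>, so \<open>g\<close> and
  \<open>h\<close> admit the same exponents in the definition of \<open>prime_ord\<close>, and
  whatever value it has cancels.\<close>

lemma frac_ord_unit:
  assumes "sring A" "primeideal P (subr A)" "x \<in> A - P" "y \<in> A - P" "f * y = x"
  shows "frac_ord A P f = 0"
  unfolding frac_ord_def
proof (rule the_equality)
  have nz: "x \<noteq> 0" "y \<noteq> 0" using assms idealD(2)[OF assms(1) primeD(1)[OF assms(1,2)]] by auto
  have eq: "prime_ord A P g = prime_ord A P h" if "g \<in> A" "h \<in> A" "f * h = g" for g h
  proof -
    have e: "y * g = x * h" using that assms by (auto simp: algebra_simps)
    have I: "ideal (P [^]\<^bsub>ideals_set (subr A)\<^esub> n) (subr A)" for n :: nat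
    proof (induction n)
      case 0 then show ?case using cring_subr[OF assms(1)]
        by (metis cring_def ideals_set_pow_Suc(1) ring.oneideal)
    next
      case (Suc n) then show ?case unfolding ideals_set_pow_Suc
        using cring_subr[OF assms(1)] primeD(1)[OF assms(1,2)]
        by (metis cring_def ring.ideal_prod_is_ideal)
    qed
    have aux: "\<exists>s\<in>A - P. s * h \<in> P [^]\<^bsub>ideals_set (subr A)\<^esub> n"
      if "\<exists>s\<in>A - P. s * g \<in> P [^]\<^bsub>ideals_set (subr A)\<^esub> n" "y * g = x * h" "y \<in> A - P" "x \<in> A - P" for n :: nat and g h y x
    proof -
      from that obtain s where s: "s \<in> A - P" "s * g \<in> P [^]\<^bsub>ideals_set (subr A)\<^esub> n" by blast
      have "y * (s * g) \<in> P [^]\<^bsub>ideals_set (subr A)\<^esub> n" using idealD(4)[OF assms(1) I] s that by auto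
      moreover have "y * (s * g) = (s * x) * h" using that(2) by (simp add: algebra_simps)
      moreover have "s * x \<in> A - P" using primeD(4)[OF assms(1,2)] s(1) that(4) by blast
      ultimately show ?thesis by auto
    qed
    have "(\<exists>s\<in>A - P. s * g \<in> P [^]\<^bsub>ideals_set (subr A)\<^esub> n) \<longleftrightarrow> (\<exists>s\<in>A - P. s * h \<in> P [^]\<^bsub>ideals_set (subr A)\<^esub> n)" for n :: nat
      using aux[of g n y x h, OF _ e assms(4,3)] aux[of h n x y g, OF _ e[symmetric] assms(3,4)] by blast
    then show ?thesis unfolding prime_ord_def by (simp only:)
  qed
  have "x \<in> A" "y \<in> A" "0 = int (prime_ord A P x) - int (prime_ord A P y)"
    using eq[of x y] assms by auto
  then show "\<exists>g\<in>A. \<exists>h\<in>A. g \<noteq> 0 \<and> h \<noteq> 0 \<and> f * h = g \<and> 0 = int (prime_ord A P g) - int (prime_ord A P h)"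
    by (intro bexI[of _ x] bexI[of _ y] conjI nz assms(5))
  fix k assume "\<exists>g\<in>A. \<exists>h\<in>A. g \<noteq> 0 \<and> h \<noteq> 0 \<and> f * h = g \<and> k = int (prime_ord A P g) - int (prime_ord A P h)"
  then obtain g h where "g \<in> A" "h \<in> A" "f * h = g" "k = int (prime_ord A P g) - int (prime_ord A P h)"
    by blast
  then show "k = 0" using eq[of g h] by linarith
qed

section \<open>Residue fields of algebras of countable dimension\<close>

definition chom :: "(complex \<Rightarrow> 'r::comm_ring_1) \<Rightarrow> bool" where
  "chom \<iota> \<longleftrightarrow> (\<forall>x y. \<iota> (x + y) = \<iota> x + \<iota> y \<and> \<iota> (x * y) = \<iota> x * \<iota> y) \<and> \<iota> 1 = 1"

lemma chomD:
  assumes "chom \<iota>"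
  shows "\<iota> (x + y) = \<iota> x + \<iota> y" "\<iota> (x * y) = \<iota> x * \<iota> y" "\<iota> 1 = 1" "\<iota> 0 = 0" "\<iota> (- x) = - \<iota> x"
    "\<iota> (x - y) = \<iota> x - \<iota> y" "\<iota> (x ^ n) = \<iota> x ^ n"
proof -
  show a: "\<iota> (x + y) = \<iota> x + \<iota> y" and m: "\<iota> (x * y) = \<iota> x * \<iota> y" and o: "\<iota> 1 = 1" for x y
    using assms by (auto simp: chom_def)
  show z: "\<iota> 0 = 0" using a[of 0 0] by simp
  show u: "\<iota> (- x) = - \<iota> x" for x using a[of x "- x"] z by (simp add: eq_neg_iff_add_eq_0 add.commute)
  show "\<iota> (x - y) = \<iota> x - \<iota> y" using a[of x "- y"] u[of y] by simp
  show "\<iota> (x ^ n) = \<iota> x ^ n" by (induction n) (auto simp: m o)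
qed

definition cscale :: "(complex \<Rightarrow> 'r::comm_ring_1) \<Rightarrow> complex \<Rightarrow> 'r \<Rightarrow> 'r" where
  "cscale \<iota> c x = \<iota> c * x"

lemma vector_space_cscale: "chom \<iota> \<Longrightarrow> vector_space (cscale \<iota>)"
  by unfold_locales (auto simp: cscale_def chomD algebra_simps)

definition poly_value :: "(complex \<Rightarrow> 'r::comm_ring_1) \<Rightarrow> 'r \<Rightarrow> complex poly \<Rightarrow> 'r" where
  "poly_value \<iota> f p = fold_coeffs (\<lambda>a b. \<iota> a + f * b) p 0"

context
  fixes \<iota> :: "complex \<Rightarrow> 'r::comm_ring_1" and f :: 'r
  assumes hom: "chom \<iota>"
begin

lemma poly_value_0 [simp]: "poly_value \<iota> f 0 = 0"
  by (simp add: poly_value_def)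

lemma poly_value_pCons [simp]: "poly_value \<iota> f (pCons a p) = \<iota> a + f * poly_value \<iota> f p"
  by (cases "p = 0"; cases "a = 0") (auto simp: poly_value_def chomD[OF hom])

lemma poly_value_add: "poly_value \<iota> f (p + q) = poly_value \<iota> f p + poly_value \<iota> f q"
  by (induction p q rule: poly_induct2) (auto simp: chomD[OF hom] algebra_simps)

lemma poly_value_smult: "poly_value \<iota> f (smult c p) = \<iota> c * poly_value \<iota> f p"
  by (induction p) (auto simp: chomD[OF hom] algebra_simps)

lemma poly_value_mult: "poly_value \<iota> f (p * q) = poly_value \<iota> f p * poly_value \<iota> f q"
  by (induction p) (auto simp: chomD[OF hom] algebra_simps poly_value_add poly_value_smult)

lemma poly_value_1: "poly_value \<iota> f 1 = 1"
  by (simp add: one_pCons chomD[OF hom])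

lemma poly_value_sum: "poly_value \<iota> f (sum g I) = (\<Sum>i\<in>I. poly_value \<iota> f (g i))"
  by (induction I rule: infinite_finite_induct) (auto simp: poly_value_add)

lemma poly_value_prod: "poly_value \<iota> f (prod g I) = (\<Prod>i\<in>I. poly_value \<iota> f (g i))"
  by (induction I rule: infinite_finite_induct) (auto simp: poly_value_mult poly_value_1)

lemma poly_value_in: "sring A \<Longrightarrow> range \<iota> \<subseteq> A \<Longrightarrow> f \<in> A \<Longrightarrow> poly_value \<iota> f p \<in> A"
  by (induction p) (auto intro!: sringD(4,6) sringD(1))

text \<open>Over the complex numbers \<open>p\<close> splits into linear factors. Each of them takes
  a value \<open>f - \<iota> r\<close> outside the prime, and a nonzero constant is a unit.\<close>

lemma poly_value_notin:
  assumes A: "sring A" "range \<iota> \<subseteq> A" "f \<in> A" and z: "primeideal z (subr A)"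
    and nz: "\<And>c. f - \<iota> c \<notin> z" and p: "p \<noteq> 0"
  shows "poly_value \<iota> f p \<notin> z"
  using p
proof (induction "degree p" arbitrary: p)
  case 0
  then obtain a where a: "p = [:a:]" "a \<noteq> 0" by (metis degree_eq_zeroE pCons_0_0)
  have "\<iota> a \<notin> z"
  proof
    assume "\<iota> a \<in> z"
    then have "\<iota> (inverse a) * \<iota> a \<in> z" using idealD(4)[OF A(1) primeD(1)[OF A(1) z]] A(2) by blast
    then show False using a primeD(2)[OF A(1) z] by (simp flip: chomD(2)[OF hom] add: chomD(3)[OF hom])
  qed
  then show ?case using a by simp
next
  case (Suc n)
  then have "\<not> constant (poly p)" by (simp add: constant_degree)
  then obtain r where "poly p r = 0" using fundamental_theorem_of_algebra by blast
  then obtain q where q: "p = [:- r, 1:] * q" by (metis dvdE poly_eq_0_iff_dvd)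
  then have "q \<noteq> 0" using Suc by auto
  then have "degree p = Suc (degree q)" unfolding q by (subst degree_mult_eq) auto
  then have "poly_value \<iota> f q \<notin> z" using Suc \<open>q \<noteq> 0\<close> by auto
  moreover have "poly_value \<iota> f p = (f - \<iota> r) * poly_value \<iota> f q"
    unfolding q poly_value_mult by (simp add: chomD[OF hom])
  moreover have "f - \<iota> r \<in> A" "poly_value \<iota> f q \<in> A" using A by (auto intro!: sringD(3) poly_value_in)
  ultimately show ?case using primeD(3)[OF A(1) z] nz[of r] by metis
qed

end

text \<open>
  Amitsur's trick: if no \<open>f - \<iota> c\<close> vanished at \<open>z\<close>, the uncountably many elements
  \<open>1 / (f - \<iota> c)\<close> of the residue field would be linearly independent.
\<close>

lemma residue_field_complex:
  fixes \<iota> :: "complex \<Rightarrow> 'r::comm_ring_1"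
  assumes hom: "chom \<iota>" and A: "sring A" "range \<iota> \<subseteq> A" and z: "z \<in> Spm A"
    and T: "countable T" "A \<subseteq> module.span (cscale \<iota>) T" and f: "f \<in> A"
  shows "\<exists>c. f - \<iota> c \<in> z"
proof (rule ccontr)
  assume "\<not> ?thesis"
  then have nz: "\<And>c. f - \<iota> c \<notin> z" by auto
  interpret V: vector_space "cscale \<iota>" by (rule vector_space_cscale[OF hom])
  note I = Spm_ideal[OF A(1) z] and P = Spm_prime[OF A(1) z]
  have cA: "\<iota> c \<in> A" "f - \<iota> c \<in> A" for c using A f by (auto intro: sringD(3))
  have "\<exists>y\<in>A. 1 - (f - \<iota> c) * y \<in> z" for c
    using z[unfolded Spm_iff[OF A(1)]] cA nz by blast
  then obtain g where g: "\<And>c. g c \<in> A" "\<And>c. 1 - (f - \<iota> c) * g c \<in> z" by metis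
  \<comment> \<open>Linear independence modulo \<open>z\<close>: clearing denominators in a relation
    among the \<open>g c\<close> yields a polynomial in \<open>f\<close> with value in
    \<open>z\<close>, which must therefore be the zero polynomial.\<close>
  have claim: "\<alpha> c0 = 0" if S: "finite S" "c0 \<in> S" "(\<Sum>c\<in>S. \<iota> (\<alpha> c) * g c) \<in> z" for S \<alpha> c0
  proof (rule ccontr)
    assume ne: "\<alpha> c0 \<noteq> 0"
    define Q where "Q c = (\<Prod>d\<in>S - {c}. (f - \<iota> d))" for c
    define q where "q c = (\<Prod>d\<in>S - {c}. [:- d, 1:])" for c :: complex
    have QA: "Q c \<in> A" for c unfolding Q_def by (rule sring_prod[OF A(1)]) (use cA in auto)
    have Qq: "poly_value \<iota> f (q c) = Q c" for c
      by (simp add: Q_def q_def poly_value_prod[OF hom] poly_value_pCons[OF hom] poly_value_0[OF hom] chomD[OF hom])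
    define p where "p = (\<Sum>c\<in>S. smult (\<alpha> c) (q c))"
    \<comment> \<open>All summands with \<open>c \<noteq> c0\<close> contain the factor
      \<open>c0 - c0\<close>, so evaluation at \<open>c0\<close> isolates the coefficient
      \<open>\<alpha> c0\<close>.\<close>
    have "poly p c0 = (\<Sum>c\<in>S. \<alpha> c * poly (q c) c0)" by (simp add: p_def poly_sum)
    also have "\<dots> = (\<Sum>c\<in>S. if c = c0 then \<alpha> c0 * poly (q c0) c0 else 0)"
      by (rule sum.cong) (use S in \<open>auto simp: q_def poly_prod\<close>)
    also have "\<dots> = \<alpha> c0 * poly (q c0) c0" using S by simp
    finally have "poly p c0 \<noteq> 0" using ne S by (auto simp: q_def poly_prod)
    then have "p \<noteq> 0" by auto
    have "poly_value \<iota> f p = (\<Sum>c\<in>S. \<iota> (\<alpha> c) * Q c)"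
      by (simp add: p_def poly_value_sum[OF hom] poly_value_smult[OF hom] Qq)
    also have "\<dots> = (\<Sum>c\<in>S. (\<iota> (\<alpha> c) * Q c) * (1 - (f - \<iota> c) * g c) + (\<Prod>d\<in>S. f - \<iota> d) * (\<iota> (\<alpha> c) * g c))"
    proof (rule sum.cong[OF refl])
      fix c assume "c \<in> S"
      then have e: "(\<Prod>d\<in>S. f - \<iota> d) = (f - \<iota> c) * Q c"
        unfolding Q_def using S(1) by (simp add: prod.remove)
      show "\<iota> (\<alpha> c) * Q c = (\<iota> (\<alpha> c) * Q c) * (1 - (f - \<iota> c) * g c) + (\<Prod>d\<in>S. f - \<iota> d) * (\<iota> (\<alpha> c) * g c)"
        unfolding e by (simp add: algebra_simps)
    qed
    also have "\<dots> = (\<Sum>c\<in>S. (\<iota> (\<alpha> c) * Q c) * (1 - (f - \<iota> c) * g c)) + (\<Prod>d\<in>S. f - \<iota> d) * (\<Sum>c\<in>S. \<iota> (\<alpha> c) * g c)"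
      by (simp add: sum.distrib sum_distrib_left)
    also have "\<dots> \<in> z"
    proof (rule idealD(3)[OF A(1) I])
      show "(\<Sum>c\<in>S. (\<iota> (\<alpha> c) * Q c) * (1 - (f - \<iota> c) * g c)) \<in> z"
      proof (rule ideal_sum[OF A(1) I])
        fix c show "(\<iota> (\<alpha> c) * Q c) * (1 - (f - \<iota> c) * g c) \<in> z"
          by (rule idealD(4)[OF A(1) I]) (use g(2) cA(1) QA sringD(4)[OF A(1)] in auto)
      qed
      show "(\<Prod>d\<in>S. f - \<iota> d) * (\<Sum>c\<in>S. \<iota> (\<alpha> c) * g c) \<in> z"
        by (rule idealD(4)[OF A(1) I sring_prod[OF A(1)]]) (use S(3) cA(2) in auto)
    qed
    finally show False using poly_value_notin[OF hom A f P nz \<open>p \<noteq> 0\<close>] by simp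
  qed
  have inj: "inj g"
  proof (rule injI, rule ccontr)
    fix c d assume cd: "g c = g d" "c \<noteq> d"
    define \<alpha> where "\<alpha> e = (if e = c then 1 else (-1 :: complex))" for e
    have "(\<Sum>e\<in>{c, d}. \<iota> (\<alpha> e) * g e) = 0"
      using cd by (simp add: \<alpha>_def chomD[OF hom])
    then have "\<alpha> c = 0" using claim[of "{c, d}" c \<alpha>] idealD(2)[OF A(1) I] by auto
    then show False by (simp add: \<alpha>_def)
  qed
  have indep: "V.independent (range g)"
    unfolding V.independent_explicit_module
  proof (intro allI impI)
    fix t u v assume t: "finite t" "t \<subseteq> range g" "(\<Sum>v\<in>t. cscale \<iota> (u v) v) = 0" "v \<in> t"
    then obtain S where S: "finite S" "t = g ` S" by (metis finite_subset_image)
    then obtain c where c: "v = g c" "c \<in> S" using t by auto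
    have "(\<Sum>c\<in>S. \<iota> (u (g c)) * g c) = 0"
      using t(3) unfolding S(2) by (subst (asm) sum.reindex) (auto simp: cscale_def inj_on_def injD[OF inj])
    then show "u v = 0" using claim[OF S(1) c(2), of "\<lambda>c. u (g c)"] idealD(2)[OF A(1) I] c by simp
  qed
  \<comment> \<open>Every element lies in the span of a finite subset of \<open>T\<close>. There are
    countably many such subsets, and each span contains only finitely many of the independent
    \<open>g c\<close>; so only countably many \<open>c\<close> would exist.\<close>
  define \<F> where "\<F> = {F. F \<subseteq> T \<and> finite F}"
  have "countable \<F>" unfolding \<F>_def using countable_Collect_finite_subset[OF T(1)] by (simp add: conj_commute)
  moreover have "finite {c. g c \<in> V.span F}" if "F \<in> \<F>" for F
  proof -
    have "finite (g ` {c. g c \<in> V.span F})"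
      using V.independent_span_bound[of F "g ` {c. g c \<in> V.span F}"] that
        V.independent_mono[OF indep] by (auto simp: \<F>_def image_subset_iff)
    then show ?thesis by (rule finite_imageD) (use inj in \<open>auto simp: inj_on_def dest: injD\<close>)
  qed
  ultimately have "countable (\<Union>F\<in>\<F>. {c. g c \<in> V.span F})"
    by (intro countable_UN) (auto intro: countable_finite)
  moreover have "(\<Union>F\<in>\<F>. {c. g c \<in> V.span F}) = UNIV"
  proof (intro equalityI subsetI)
    fix c
    have "g c \<in> V.span T" using g T by auto
    then obtain F r where "finite F" "F \<subseteq> T" "g c = (\<Sum>a\<in>F. cscale \<iota> (r a) a)"
      unfolding V.span_explicit by blast
    then have "F \<in> \<F>" "g c \<in> V.span F"
      by (simp add: \<F>_def, simp only:) (intro V.span_sum V.span_scale V.span_base)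
    then show "c \<in> (\<Union>F\<in>\<F>. {c. g c \<in> V.span F})" by blast
  qed simp
  ultimately show False using uncountable_UNIV_complex by simp
qed

lemma residue_unique:
  fixes \<iota> :: "complex \<Rightarrow> 'r::comm_ring_1"
  assumes hom: "chom \<iota>" and A: "sring A" "range \<iota> \<subseteq> A" and z: "ideal z (subr A)" "1 \<notin> z"
    and c: "f - \<iota> c \<in> z" "f - \<iota> d \<in> z"
  shows "c = d"
proof (rule ccontr)
  assume ne: "c \<noteq> d"
  have "(f - \<iota> d) - (f - \<iota> c) \<in> z" using idealD(7)[OF A(1) z(1) c(2) c(1)] .
  then have "\<iota> (c - d) \<in> z" by (simp add: chomD[OF hom])
  then have "\<iota> (inverse (c - d)) * \<iota> (c - d) \<in> z" using idealD(4)[OF A(1) z(1)] A(2) by blast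
  then show False using z(2) ne by (simp flip: chomD(2)[OF hom] add: chomD(3)[OF hom])
qed

lemma span_mult_closed:
  fixes \<iota> :: "complex \<Rightarrow> 'r::comm_ring_1"
  assumes hom: "chom \<iota>" and M: "\<And>x y. x \<in> M \<Longrightarrow> y \<in> M \<Longrightarrow> x * y \<in> M"
    and x: "x \<in> module.span (cscale \<iota>) M" and y: "y \<in> module.span (cscale \<iota>) M"
  shows "x * y \<in> module.span (cscale \<iota>) M"
proof -
  interpret V: vector_space "cscale \<iota>" by (rule vector_space_cscale[OF hom])
  have 1: "x * y \<in> V.span M" if "x \<in> M" for x
    using y
  proof (induction y rule: V.span_induct_alt)
    case (step c w v)
    have "x * (cscale \<iota> c w + v) = cscale \<iota> c (x * w) + x * v"
      by (simp add: cscale_def algebra_simps)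
    then show ?case using step that by (metis M V.span_add V.span_base V.span_scale)
  qed (simp add: V.span_zero)
  show ?thesis using x
  proof (induction x rule: V.span_induct_alt)
    case (step c w v)
    have "(cscale \<iota> c w + v) * y = cscale \<iota> c (w * y) + v * y"
      by (simp add: cscale_def algebra_simps)
    then show ?case using step 1 by (metis V.span_add V.span_scale)
  qed (simp add: V.span_zero)
qed

text \<open>Nakayama's lemma, with the unit \<open>r\<close> making room for the elimination of generators.\<close>

lemma nakayama_elim:
  assumes A: "sring A" and a: "primeideal a (subr A)" and t: "t \<in> A" and Y: "finite Y" "Y \<subseteq> A"
    and eq: "\<And>y. y \<in> Y \<Longrightarrow> \<exists>r\<in>A - a. \<exists>b\<in>A. \<exists>m. (\<forall>x\<in>Y. m x \<in> a) \<and> r * y = t * b + (\<Sum>x\<in>Y. m x * x)"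
  shows "\<exists>s\<in>A - a. \<forall>y\<in>Y. \<exists>b\<in>A. s * y = t * b"
  using Y eq
proof (induction Y rule: finite_induct)
  case empty
  then show ?case using primeD(5)[OF A a] by blast
next
  case (insert y F)
  note s = sringD[OF A] and I = idealD[OF A primeD(1)[OF A a]] and pm = primeD(4)[OF A a]
  obtain r b m where r: "r \<in> A - a" "b \<in> A" "\<And>x. x \<in> insert y F \<Longrightarrow> m x \<in> a"
      "r * y = t * b + (\<Sum>x\<in>insert y F. m x * x)"
    using insert.prems(2)[of y] by blast
  \<comment> \<open>The term \<open>m y * y\<close> is moved to the left. As \<open>m y\<close> lies
    in the prime and \<open>r\<close> does not, \<open>r'\<close> stays outside it.\<close>
  define r' where "r' = r - m y"
  have r': "r' \<in> A - a"
  proof -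
    have "r' \<in> A" unfolding r'_def using r(1) I(1)[OF r(3)] by (intro s(3)) auto
    moreover have "r = r' + m y" by (simp add: r'_def)
    then have "r' \<notin> a" using r(1) r(3)[of y] I(3) by (metis DiffD2 insertI1)
    ultimately show ?thesis by simp
  qed
  have ry: "r' * y = t * b + (\<Sum>x\<in>F. m x * x)"
    using r(4) insert.hyps by (simp add: r'_def algebra_simps)
  have "\<exists>s\<in>A - a. \<forall>y\<in>F. \<exists>b\<in>A. s * y = t * b"
  proof (rule insert.IH)
    show "F \<subseteq> A" using insert.prems by auto
    fix x assume x: "x \<in> F"
    obtain q c n where q: "q \<in> A - a" "c \<in> A" "\<And>x. x \<in> insert y F \<Longrightarrow> n x \<in> a"
        "q * x = t * c + (\<Sum>x\<in>insert y F. n x * x)"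
      using insert.prems(2)[of x] x by blast
    have qx: "q * x = t * c + n y * y + (\<Sum>x\<in>F. n x * x)"
      using q(4) insert.hyps by (simp add: add.assoc)
    \<comment> \<open>After multiplication by \<open>r'\<close> the product \<open>r' * y\<close>
      can be replaced by its own equation, which eliminates \<open>y\<close> from the equation of
      \<open>x\<close>.\<close>
    have "(r' * q) * x = r' * (t * c + n y * y + (\<Sum>x\<in>F. n x * x))"
      unfolding mult.assoc qx ..
    also have "\<dots> = r' * (t * c) + n y * (r' * y) + (\<Sum>x\<in>F. r' * n x * x)"
      by (simp add: algebra_simps sum_distrib_left)
    also have "\<dots> = t * (r' * c + n y * b) + (\<Sum>x\<in>F. (r' * n x + n y * m x) * x)"
      unfolding ry by (simp add: algebra_simps sum_distrib_left sum.distrib)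
    finally have e: "(r' * q) * x = t * (r' * c + n y * b) + (\<Sum>x\<in>F. (r' * n x + n y * m x) * x)" .
    have "r' * q \<in> A - a" by (rule pm[OF r' q(1)])
    moreover have "r' * c + n y * b \<in> A"
      using r' q(2) r(2) I(1)[OF q(3)] by (intro s(6) s(4)) auto
    moreover have "\<forall>x\<in>F. r' * n x + n y * m x \<in> a"
    proof
      fix x assume "x \<in> F"
      then show "r' * n x + n y * m x \<in> a"
        using r' q(3)[of x] r(3)[of x] I(1)[OF q(3), of y] by (intro I(3) I(4)) auto
    qed
    ultimately show "\<exists>r\<in>A - a. \<exists>b\<in>A. \<exists>m. (\<forall>x\<in>F. m x \<in> a) \<and> r * x = t * b + (\<Sum>x\<in>F. m x * x)"
      using e by (intro bexI exI conjI)
  qed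
  then obtain q where q: "q \<in> A - a" "\<And>x. x \<in> F \<Longrightarrow> \<exists>b\<in>A. q * x = t * b" by blast
  then obtain B where B: "\<And>x. x \<in> F \<Longrightarrow> B x \<in> A" "\<And>x. x \<in> F \<Longrightarrow> q * x = t * B x" by metis
  have "r' * q \<in> A - a" by (rule pm[OF r' q(1)])
  moreover have "\<exists>b\<in>A. (r' * q) * x = t * b" if "x \<in> insert y F" for x
  proof (cases "x = y")
    case True
    have "(r' * q) * y = q * (r' * y)" by (simp add: algebra_simps)
    also have "\<dots> = t * (q * b) + (\<Sum>x\<in>F. m x * (q * x))"
      unfolding ry by (simp add: algebra_simps sum_distrib_left)
    also have "\<dots> = t * (q * b) + (\<Sum>x\<in>F. m x * (t * B x))" using B(2) by simp
    also have "\<dots> = t * (q * b + (\<Sum>x\<in>F. m x * B x))" by (simp add: algebra_simps sum_distrib_left)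
    finally have "(r' * q) * x = t * (q * b + (\<Sum>x\<in>F. m x * B x))" using True by simp
    moreover have "q * b + (\<Sum>x\<in>F. m x * B x) \<in> A"
      using q(1) r(2) B(1) I(1)[OF r(3)] by (intro s(6) s(4) sring_sum[OF A]) auto
    ultimately show ?thesis by blast
  next
    case False
    then have x: "x \<in> F" using that by auto
    have "(r' * q) * x = r' * (q * x)" by (simp add: algebra_simps)
    also have "\<dots> = t * (r' * B x)" unfolding B(2)[OF x] by (simp add: algebra_simps)
    finally show ?thesis using s(4)[of r' "B x"] r' B(1)[OF x] by blast
  qed
  ultimately show ?case by blast
qed

section \<open>Smooth affine curves\<close>

lemma smooth_affine_curveD:
  assumes "smooth_affine_curve \<iota> A\<^sub>0"
  shows "chom \<iota>" "sring A\<^sub>0" "range \<iota> \<subseteq> A\<^sub>0"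
proof -
  obtain S where S: "A\<^sub>0 = generate_ring ring_of_type_algebra (range \<iota> \<union> S)"
      and h: "\<iota> \<in> ring_hom ring_of_type_algebra ring_of_type_algebra"
    using assms by (auto simp: smooth_affine_curve_def)
  show "chom \<iota>"
    using h by (auto simp: ring_hom_def chom_def)
  show "range \<iota> \<subseteq> A\<^sub>0"
    using generate_ring.incl[of _ "range \<iota> \<union> S" ring_of_type_algebra] S by auto
  have 1: "1 \<in> A\<^sub>0" using generate_ring.one[of ring_of_type_algebra "range \<iota> \<union> S"] S by simp
  have 2: "- x \<in> A\<^sub>0" if "x \<in> A\<^sub>0" for x
    using generate_ring.a_inv[of x ring_of_type_algebra "range \<iota> \<union> S"] S that by simp
  have 3: "x * y \<in> A\<^sub>0" if "x \<in> A\<^sub>0" "y \<in> A\<^sub>0" for x y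
    using generate_ring.eng_mult[of x ring_of_type_algebra "range \<iota> \<union> S" y] S that by simp
  have 4: "x + y \<in> A\<^sub>0" if "x \<in> A\<^sub>0" "y \<in> A\<^sub>0" for x y
    using generate_ring.eng_add[of x ring_of_type_algebra "range \<iota> \<union> S" y] S that by simp
  show "sring A\<^sub>0" unfolding sring_def using 1 3 4[OF _ 2] by (metis add_uminus_conv_diff)
qed

locale curve =
  fixes \<iota> :: "complex \<Rightarrow> 'k::field" and A\<^sub>0 :: "'k set"
  assumes curve: "smooth_affine_curve \<iota> A\<^sub>0"
begin

lemmas hom = smooth_affine_curveD(1)[OF curve]
lemmas A0 = smooth_affine_curveD(2)[OF curve]
lemmas A0_iota = smooth_affine_curveD(3)[OF curve]
lemmas chom_simps = chomD[OF hom]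
lemmas s0 = sringD[OF A0]

sublocale V: vector_space "cscale \<iota>" by (rule vector_space_cscale[OF hom])
sublocale T: vector_space fscale by (rule vector_space_fscale)

lemma A0_gens:
  obtains S where "finite S" "A\<^sub>0 = generate_ring ring_of_type_algebra (range \<iota> \<union> S)"
  using curve by (auto simp: smooth_affine_curve_def)

text \<open>The words in the finitely many generators form a countable set of monomials closed under
  multiplication, and they span.\<close>

lemma A0_countable_dim: "\<exists>T. countable T \<and> A\<^sub>0 \<subseteq> V.span T"
proof -
  obtain S where S: "finite S" "A\<^sub>0 = generate_ring ring_of_type_algebra (range \<iota> \<union> S)"
    using A0_gens .
  define M where "M = prod_list ` lists S"
  have c: "countable M" unfolding M_def using S(1) by (auto intro: countable_finite)
  have MM: "x * y \<in> M" if xy: "x \<in> M" "y \<in> M" for x y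
  proof -
    obtain l k where lk: "x = prod_list l" "l \<in> lists S" "y = prod_list k" "k \<in> lists S"
      using xy by (auto simp: M_def)
    show ?thesis unfolding M_def by (rule image_eqI[of _ _ "l @ k"]) (use lk in auto)
  qed
  have M1: "1 \<in> M" unfolding M_def by (rule image_eqI[of _ _ "[]"]) auto
  have "f \<in> V.span M" if "f \<in> generate_ring ring_of_type_algebra (range \<iota> \<union> S)" for f
    using that
  proof (induction f rule: generate_ring.induct)
    case one then show ?case using M1 by (simp add: V.span_base)
  next
    case (incl h)
    then show ?case
    proof
      assume "h \<in> range \<iota>"
      then obtain d where "h = cscale \<iota> d 1" by (auto simp: cscale_def)
      then show ?thesis using M1 by (simp add: V.span_base V.span_scale)
    next
      assume "h \<in> S"
      then have "h \<in> M" unfolding M_def by (intro image_eqI[of _ _ "[h]"]) auto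
      then show ?thesis by (rule V.span_base)
    qed
  next
    case (a_inv h) then show ?case by (simp add: V.span_neg)
  next
    case (eng_add h1 h2) then show ?case by (simp add: V.span_add)
  next
    case (eng_mult h1 h2) then show ?case using span_mult_closed[OF hom MM] by simp
  qed
  then show ?thesis using c S by blast
qed

lemma residue_exists: "a \<in> Spm A\<^sub>0 \<Longrightarrow> f \<in> A\<^sub>0 \<Longrightarrow> \<exists>c. f - \<iota> c \<in> a"
  using A0_countable_dim residue_field_complex[OF hom A0 A0_iota] by blast

lemma frac: "\<exists>f\<in>A\<^sub>0. \<exists>g\<in>A\<^sub>0. g \<noteq> 0 \<and> x = f / g"
  using curve by (auto simp: smooth_affine_curve_def)

context
  fixes a assumes a: "a \<in> Spm A\<^sub>0"
begin

lemmas aP = Spm_prime[OF A0 a]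
lemmas aI = Spm_ideal[OF A0 a]
lemmas ai = idealD[OF A0 aI]
lemmas ap = primeD[OF A0 aP]

definition res :: "'k \<Rightarrow> complex" where "res f = (THE c. f - \<iota> c \<in> a)"

lemma res: "f \<in> A\<^sub>0 \<Longrightarrow> f - \<iota> (res f) \<in> a"
  and res_eq: "f - \<iota> c \<in> a \<Longrightarrow> res f = c"
proof -
  have u: "c = d" if "f - \<iota> c \<in> a" "f - \<iota> d \<in> a" for f c d
    using residue_unique[OF hom A0 A0_iota aI ap(2) that] .
  show e: "res f = c" if "f - \<iota> c \<in> a" for f c
    unfolding res_def using that u by blast
  show "f - \<iota> (res f) \<in> a" if "f \<in> A\<^sub>0"
    using residue_exists[OF a that] e by auto
qed

lemma iota_A0 [simp]: "\<iota> c \<in> A\<^sub>0" using A0_iota by auto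

lemma res_hom:
  assumes "f \<in> A\<^sub>0" "g \<in> A\<^sub>0"
  shows "res (f + g) = res f + res g" "res (f * g) = res f * res g"
proof -
  note h = res[OF assms(1)] res[OF assms(2)]
  have e: "f + g - \<iota> (res f + res g) = (f - \<iota> (res f)) + (g - \<iota> (res g))"
    by (simp add: chom_simps algebra_simps)
  have "f + g - \<iota> (res f + res g) \<in> a" unfolding e by (rule ai(3)[OF h])
  then show "res (f + g) = res f + res g" by (rule res_eq)
  have "f * g - \<iota> (res f * res g) = f * (g - \<iota> (res g)) + \<iota> (res g) * (f - \<iota> (res f))"
    by (simp add: chom_simps algebra_simps)
  then have "f * g - \<iota> (res f * res g) \<in> a"
    using ai(3)[OF ai(4)[OF assms(1) h(2)] ai(4)[OF iota_A0 h(1)]] by simp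
  then show "res (f * g) = res f * res g" by (rule res_eq)
qed

lemma res_iota [simp]: "res (\<iota> c) = c" by (rule res_eq) (simp add: ai(2))

lemma res_0_iff: "f \<in> A\<^sub>0 \<Longrightarrow> res f = 0 \<longleftrightarrow> f \<in> a"
  using res[of f] res_eq[of f 0] by (auto simp: chom_simps)

lemma value_at_res: "value_at \<iota> a = res" by (simp add: value_at_def res_def fun_eq_iff)

text \<open>The square of the ideal \<open>a\<close>, taken as a complex subspace so that linear
  functionals vanishing on it can be extended from a basis.\<close>

definition sq :: "'k set" where "sq = V.span {x * y | x y. x \<in> a \<and> y \<in> a}"

text \<open>The algebra generators, shifted by their values at \<open>a\<close>, generate
  \<open>a\<close>: by induction over the generated ring, \<open>f - \<iota> (res f)\<close> lies in
  the ideal \<open>J\<close> of their combinations, and \<open>res f\<close> is 0 on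
  \<open>a\<close>.\<close>

lemma maximal_ideal_fg:
  obtains Y where "finite Y" "Y \<subseteq> a" "\<And>f. f \<in> a \<Longrightarrow> \<exists>h. (\<forall>y\<in>Y. h y \<in> A\<^sub>0) \<and> f = (\<Sum>y\<in>Y. h y * y)"
proof -
  obtain S where S: "finite S" "A\<^sub>0 = generate_ring ring_of_type_algebra (range \<iota> \<union> S)"
    using A0_gens .
  have SA: "S \<subseteq> A\<^sub>0" unfolding S(2) by (auto intro: generate_ring.incl)
  define Y where "Y = (\<lambda>s. s - \<iota> (res s)) ` S"
  define J where "J = {\<Sum>y\<in>Y. h y * y | h. \<forall>y\<in>Y. h y \<in> A\<^sub>0}"
  have Y: "finite Y" "Y \<subseteq> a" unfolding Y_def using S(1) SA res by auto
  have JI: "(\<Sum>y\<in>Y. h y * y) \<in> J" if "\<And>y. y \<in> Y \<Longrightarrow> h y \<in> A\<^sub>0" for h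
    unfolding J_def using that by blast
  have Jadd: "f + g \<in> J" if fg: "f \<in> J" "g \<in> J" for f g
  proof -
    obtain h k where "f = (\<Sum>y\<in>Y. h y * y)" "g = (\<Sum>y\<in>Y. k y * y)" "\<forall>y\<in>Y. h y \<in> A\<^sub>0" "\<forall>y\<in>Y. k y \<in> A\<^sub>0"
      using fg unfolding J_def by blast
    then show ?thesis using JI[of "\<lambda>y. h y + k y"] s0(6) by (simp add: sum.distrib distrib_right)
  qed
  have Jmult: "r * f \<in> J" if fg: "f \<in> J" "r \<in> A\<^sub>0" for f r
  proof -
    obtain h where "f = (\<Sum>y\<in>Y. h y * y)" "\<forall>y\<in>Y. h y \<in> A\<^sub>0"
      using fg unfolding J_def by blast
    then show ?thesis using JI[of "\<lambda>y. r * h y"] s0(4) fg by (simp add: sum_distrib_left mult.assoc)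
  qed
  have J0: "0 \<in> J" using JI[of "\<lambda>_. 0"] s0(1) by simp
  have YJ: "y \<in> J" if "y \<in> Y" for y
  proof -
    have "(\<Sum>x\<in>Y. (if x = y then 1 else 0) * x) = (\<Sum>x\<in>Y. if x = y then y else 0)"
      by (rule sum.cong) auto
    also have "\<dots> = y" using Y(1) that by simp
    finally show ?thesis using JI[of "\<lambda>x. if x = y then 1 else 0"] s0(1,2) by simp
  qed
  have "f \<in> A\<^sub>0 \<and> f - \<iota> (res f) \<in> J" if "f \<in> generate_ring ring_of_type_algebra (range \<iota> \<union> S)" for f
    using that
  proof (induction f rule: generate_ring.induct)
    case one then show ?case using res_iota[of 1] J0 s0(2) by (simp add: chom_simps)
  next
    case (incl h)
    then show ?case
    proof
      assume "h \<in> range \<iota>" then show ?thesis using J0 by auto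
    next
      assume "h \<in> S"
      then have "h - \<iota> (res h) \<in> Y" by (auto simp: Y_def)
      then show ?thesis using YJ SA \<open>h \<in> S\<close> by auto
    qed
  next
    case (a_inv h)
    have "res (- h) = - res h" using res_hom(2)[of "\<iota> (-1)" h] a_inv by (simp add: chom_simps del: iota_A0)  (simp add: chom_simps(3,5)[symmetric])
    then show ?case using Jmult[of "h - \<iota> (res h)" "-1"] a_inv s0(2,5) by (simp add: chom_simps)
  next
    case (eng_add f g)
    then have "res (f + g) = res f + res g" using res_hom by auto
    then show ?case using Jadd[of "f - \<iota> (res f)" "g - \<iota> (res g)"] eng_add s0(6)
      by (simp add: chom_simps algebra_simps)
  next
    case (eng_mult f g)
    then have m: "f \<in> A\<^sub>0" "g \<in> A\<^sub>0" "f - \<iota> (res f) \<in> J" "g - \<iota> (res g) \<in> J" by auto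
    have "f * g - \<iota> (res f * res g) = f * (g - \<iota> (res g)) + \<iota> (res g) * (f - \<iota> (res f))"
      by (simp add: chom_simps algebra_simps)
    then have "f * g - \<iota> (res (f * g)) \<in> J"
      using Jadd[OF Jmult[OF m(4,1)] Jmult[OF m(3) iota_A0]] res_hom(2)[OF m(1,2)] by simp
    then show ?case using s0(4) m by simp
  qed
  then have "f \<in> J" if "f \<in> a" for f
  proof -
    have "f \<in> A\<^sub>0" "res f = 0" using that ai(1) res_0_iff by auto
    then show ?thesis using S(2) \<open>\<And>f. f \<in> generate_ring _ _ \<Longrightarrow> _\<close>[of f] by (simp add: chom_simps)
  qed
  then show thesis using that[OF Y] by (auto simp: J_def)
qed

text \<open>The Leibniz rule holds because
  \<open>(f - \<iota> (res f)) * (g - \<iota> (res g))\<close> is a product of two elements of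
  \<open>a\<close>, on which \<open>l\<close> vanishes.\<close>

lemma tangent_of_functional:
  assumes l: "Vector_Spaces.linear (cscale \<iota>) (*) l" and sq: "\<And>x. x \<in> sq \<Longrightarrow> l x = 0"
  shows "(\<lambda>f. if f \<in> A\<^sub>0 then l (f - \<iota> (res f)) else 0) \<in> tangent_space \<iota> A\<^sub>0 a"
proof -
  interpret l: Vector_Spaces.linear "cscale \<iota>" "(*)" l by (rule l)
  have ls: "l (\<iota> c * x) = c * l x" for c x using l.scale[of c x] by (simp add: cscale_def)
  show ?thesis unfolding tangent_space_def mem_Collect_eq value_at_res
  proof (intro conjI allI ballI impI)
    fix f g assume fg: "f \<in> A\<^sub>0" "g \<in> A\<^sub>0"
    have "f + g - \<iota> (res (f + g)) = (f - \<iota> (res f)) + (g - \<iota> (res g))"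
      unfolding res_hom(1)[OF fg] by (simp add: chom_simps algebra_simps)
    then have "l (f + g - \<iota> (res (f + g))) = l (f - \<iota> (res f)) + l (g - \<iota> (res g))"
      by (simp only: l.add)
    then show "(if f + g \<in> A\<^sub>0 then l (f + g - \<iota> (res (f + g))) else 0) =
      (if f \<in> A\<^sub>0 then l (f - \<iota> (res f)) else 0) + (if g \<in> A\<^sub>0 then l (g - \<iota> (res g)) else 0)"
      using fg s0(6) by simp
    have "f * g - \<iota> (res (f * g)) = (f - \<iota> (res f)) * (g - \<iota> (res g)) +
       (\<iota> (res f) * (g - \<iota> (res g)) + \<iota> (res g) * (f - \<iota> (res f)))"
      using res_hom(2)[OF fg] by (simp add: chom_simps algebra_simps)
    moreover have "l ((f - \<iota> (res f)) * (g - \<iota> (res g))) = 0"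
      by (rule sq) (use res fg in \<open>auto simp: sq_def intro!: V.span_base\<close>)
    ultimately have "l (f * g - \<iota> (res (f * g))) = res f * l (g - \<iota> (res g)) + res g * l (f - \<iota> (res f))"
      by (simp only: l.add ls add_0)
    then show "(if f * g \<in> A\<^sub>0 then l (f * g - \<iota> (res (f * g))) else 0) =
       res f * (if g \<in> A\<^sub>0 then l (g - \<iota> (res g)) else 0) +
       res g * (if f \<in> A\<^sub>0 then l (f - \<iota> (res f)) else 0)"
      using fg s0(4) by simp
  next
    fix c f assume f: "f \<in> A\<^sub>0"
    have "\<iota> c * f - \<iota> (res (\<iota> c * f)) = \<iota> c * (f - \<iota> (res f))"
      using res_hom(2)[OF iota_A0 f] by (simp add: chom_simps algebra_simps)
    then show "(if \<iota> c * f \<in> A\<^sub>0 then l (\<iota> c * f - \<iota> (res (\<iota> c * f))) else 0) =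
        c * (if f \<in> A\<^sub>0 then l (f - \<iota> (res f)) else 0)"
      using f s0(4) ls by simp
  qed auto
qed

text \<open>Duality between derivations at \<open>a\<close> and functionals on \<open>a\<close>
  modulo its square. The spanning derivation \<delta> is nonzero on \<open>a\<close>, and
  \<open>t\<close> is scaled to \<open>\<delta> t = 1\<close>. If
  \<open>x - \<iota> (\<delta> x) * t\<close> were outside \<open>sq\<close>, a functional
  separating it from \<open>sq\<close> would give a second derivation, yet that one is a multiple of
  \<delta>, which kills this element.\<close>

lemma cotangent_dim_1:
  obtains t where "t \<in> a" "\<And>x. x \<in> a \<Longrightarrow> \<exists>c. x - \<iota> c * t \<in> sq"
proof -
  have dim: "T.dim (tangent_space \<iota> A\<^sub>0 a) = 1"
    using curve a by (auto simp: smooth_affine_curve_def)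
  obtain B where B: "B \<subseteq> tangent_space \<iota> A\<^sub>0 a" "T.independent B" "tangent_space \<iota> A\<^sub>0 a \<subseteq> T.span B" "card B = 1"
    using T.basis_exists[of "tangent_space \<iota> A\<^sub>0 a"] dim by metis
  obtain \<delta> where \<delta>: "B = {\<delta>}" using B(4) by (auto simp: card_1_singleton_iff)
  have \<delta>T: "\<delta> \<in> tangent_space \<iota> A\<^sub>0 a" using B \<delta> by auto
  then have d: "\<And>f. f \<notin> A\<^sub>0 \<Longrightarrow> \<delta> f = 0" "\<And>f g. f \<in> A\<^sub>0 \<Longrightarrow> g \<in> A\<^sub>0 \<Longrightarrow> \<delta> (f + g) = \<delta> f + \<delta> g"
      "\<And>c f. f \<in> A\<^sub>0 \<Longrightarrow> \<delta> (\<iota> c * f) = c * \<delta> f"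
      "\<And>f g. f \<in> A\<^sub>0 \<Longrightarrow> g \<in> A\<^sub>0 \<Longrightarrow> \<delta> (f * g) = res f * \<delta> g + res g * \<delta> f"
    unfolding tangent_space_def value_at_res by auto
  have d1: "\<delta> 1 = 0" using d(4)[of 1 1] s0(2) res_iota[of 1] by (simp add: chom_simps)
  have dres: "\<delta> (f - \<iota> (res f)) = \<delta> f" if "f \<in> A\<^sub>0" for f
    using d(2)[OF that, of "\<iota> (- res f) * 1"] d(3)[of 1 "- res f"] d1 s0(2) s0(5)[of "\<iota> (res f)"] by (simp add: chom_simps)
  have "\<exists>x\<in>a. \<delta> x \<noteq> 0"
  proof (rule ccontr)
    assume "\<not> ?thesis"
    then have "\<delta> f = 0" for f using dres[of f] res[of f] d(1)[of f] by metis
    then have "\<delta> = 0" by auto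
    then show False using B(2) \<delta> T.dependent_zero by auto
  qed
  then obtain x0 where x0: "x0 \<in> a" "\<delta> x0 \<noteq> 0" by auto
  define t where "t = \<iota> (inverse (\<delta> x0)) * x0"
  have t: "t \<in> a" unfolding t_def by (rule ai(4)) (use x0 in auto)
  have dt: "\<delta> t = 1" unfolding t_def using x0 ai(1) by (subst d(3)) auto
  have "x - \<iota> (\<delta> x) * t \<in> sq" if x: "x \<in> a" for x
  proof (rule ccontr)
    assume ns: "x - \<iota> (\<delta> x) * t \<notin> sq"
    define g where "g = x - \<iota> (\<delta> x) * t"
    have ga: "g \<in> a" unfolding g_def using x t by (intro ai(7) ai(4)) auto
    have "\<delta> g = \<delta> x + \<delta> (\<iota> (- \<delta> x) * t)"
      unfolding g_def using d(2)[of x "\<iota> (- \<delta> x) * t"] x t ai(1) s0(4) s0(5)[OF s0(4)[OF iota_A0 ai(1)[OF t]]]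
      by (simp add: chom_simps)
    also have "\<dots> = 0" using d(3)[of t "- \<delta> x"] t ai(1) dt by simp
    finally have dg: "\<delta> g = 0" .
    obtain C where C: "C \<subseteq> sq" "V.independent C" "sq \<subseteq> V.span C"
      by (rule V.basis_exists[of sq])
    have "V.span C \<subseteq> sq" by (rule V.span_minimal[OF C(1)]) (simp add: sq_def)
    then have gC: "g \<notin> V.span C" using ns by (auto simp: g_def)
    then have ind: "V.independent (insert g C)" using C(2) by (simp add: V.independent_insertI)
    interpret VC: vector_space "(*) :: complex \<Rightarrow> complex \<Rightarrow> complex"
      by unfold_locales (auto simp: algebra_simps)
    interpret P: vector_space_pair "cscale \<iota>" "(*) :: complex \<Rightarrow> complex \<Rightarrow> complex" ..
    obtain l where l: "Vector_Spaces.linear (cscale \<iota>) (*) l" "\<And>x. x \<in> insert g C \<Longrightarrow> l x = (if x = g then 1 else 0)"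
      using P.linear_independent_extend[OF ind, of "\<lambda>x. if x = g then 1 else 0"] by blast
    interpret l: Vector_Spaces.linear "cscale \<iota>" "(*)" l by (rule l(1))
    have "l x = 0" if "x \<in> C" for x using l(2)[of x] that gC V.span_base by auto
    then have lsq: "l x = 0" if "x \<in> sq" for x
      using l.eq_0_on_span that C(3) by (meson subsetD)
    define \<delta>' where "\<delta>' = (\<lambda>f. if f \<in> A\<^sub>0 then l (f - \<iota> (res f)) else 0)"
    have "\<delta>' \<in> tangent_space \<iota> A\<^sub>0 a" unfolding \<delta>'_def by (rule tangent_of_functional[OF l(1) lsq])
    then have "\<delta>' \<in> T.span {\<delta>}" using B \<delta> by auto
    then obtain k where "\<delta>' = fscale k \<delta>" by (auto simp: T.span_singleton)
    then have "\<delta>' g = 0" using dg by (simp add: fscale_def)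
    moreover have "res g = 0" using ga res_0_iff ai(1) by auto
    ultimately have "l g = 0" using ga ai(1) by (simp add: \<delta>'_def chom_simps)
    then show False using l(2)[of g] by simp
  qed
  then show thesis using that[OF t] by blast
qed

text \<open>Each generator of \<open>a\<close> is a multiple of \<open>t\<close> plus an element of
  \<open>sq\<close>, and the latter is a combination of the generators with coefficients in
  \<open>a\<close>. Elimination makes \<open>a\<close> principal after inverting a single
  \<open>s\<close>; that one \<open>s\<close> serves all \<open>x\<close> is what later controls the
  other zeros of \<open>t\<close>.\<close>

lemma nakayama:
  obtains t s where "t \<in> a" "s \<in> A\<^sub>0 - a" "\<And>x. x \<in> a \<Longrightarrow> \<exists>b\<in>A\<^sub>0. s * x = t * b"
proof -
  obtain t where t: "t \<in> a" "\<And>x. x \<in> a \<Longrightarrow> \<exists>c. x - \<iota> c * t \<in> sq" using cotangent_dim_1 by metis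
  obtain Y where Y: "finite Y" "Y \<subseteq> a"
      "\<And>f. f \<in> a \<Longrightarrow> \<exists>h. (\<forall>y\<in>Y. h y \<in> A\<^sub>0) \<and> f = (\<Sum>y\<in>Y. h y * y)"
    using maximal_ideal_fg by metis
  have sq: "\<exists>m. (\<forall>y\<in>Y. m y \<in> a) \<and> x = (\<Sum>y\<in>Y. m y * y)" if "x \<in> sq" for x
    using that unfolding sq_def
  proof (induction x rule: V.span_induct_alt)
    case base
    then show ?case using ai(2) by (intro exI[of _ "\<lambda>_. 0"]) auto
  next
    case (step c x y)
    obtain p q where pq: "x = p * q" "p \<in> a" "q \<in> a" using step by auto
    obtain h where h: "\<forall>y\<in>Y. h y \<in> A\<^sub>0" "q = (\<Sum>y\<in>Y. h y * y)" using Y(3)[OF pq(3)] by blast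
    obtain m where m: "\<forall>y\<in>Y. m y \<in> a" "y = (\<Sum>y\<in>Y. m y * y)" using step by blast
    have "cscale \<iota> c x + y = (\<Sum>y\<in>Y. (\<iota> c * p * h y + m y) * y)"
      unfolding cscale_def pq(1) h(2) m(2) by (simp add: sum.distrib sum_distrib_left algebra_simps)
    moreover have "\<forall>y\<in>Y. \<iota> c * p * h y + m y \<in> a"
    proof
      fix y assume "y \<in> Y"
      then show "\<iota> c * p * h y + m y \<in> a" using pq(2) h(1) m(1) by (intro ai(3) ai(5) ai(4)) auto
    qed
    ultimately show ?case by (intro exI[of _ "\<lambda>y. \<iota> c * p * h y + m y"]) simp
  qed
  have YA: "Y \<subseteq> A\<^sub>0" using Y(2) ai(1) by auto
  have "\<exists>s\<in>A\<^sub>0 - a. \<forall>y\<in>Y. \<exists>b\<in>A\<^sub>0. s * y = t * b"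
  proof (rule nakayama_elim[OF A0 aP _ Y(1) YA])
    show "t \<in> A\<^sub>0" using t ai(1) by auto
    fix y assume "y \<in> Y"
    then obtain c where "y - \<iota> c * t \<in> sq" using t(2) Y(2) by auto
    then obtain m where m: "\<forall>y\<in>Y. m y \<in> a" "y - \<iota> c * t = (\<Sum>y\<in>Y. m y * y)" using sq by blast
    have "1 * y = t * \<iota> c + (\<Sum>y\<in>Y. m y * y)" unfolding m(2)[symmetric] by simp
    then show "\<exists>r\<in>A\<^sub>0 - a. \<exists>b\<in>A\<^sub>0. \<exists>m. (\<forall>x\<in>Y. m x \<in> a) \<and> r * y = t * b + (\<Sum>x\<in>Y. m x * x)"
      using m(1) ap(5) iota_A0 by (intro bexI exI conjI)
  qed
  then obtain s where s: "s \<in> A\<^sub>0 - a" "\<And>y. y \<in> Y \<Longrightarrow> \<exists>b\<in>A\<^sub>0. s * y = t * b" by blast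
  then obtain b where b: "\<And>y. y \<in> Y \<Longrightarrow> b y \<in> A\<^sub>0" "\<And>y. y \<in> Y \<Longrightarrow> s * y = t * b y" by metis
  have "\<exists>b\<in>A\<^sub>0. s * x = t * b" if xa: "x \<in> a" for x
  proof -
    obtain h where h: "\<forall>y\<in>Y. h y \<in> A\<^sub>0" "x = (\<Sum>y\<in>Y. h y * y)" using Y(3)[OF xa] by blast
    have "s * x = (\<Sum>y\<in>Y. h y * (s * y))" unfolding h(2) by (simp add: sum_distrib_left algebra_simps)
    also have "\<dots> = (\<Sum>y\<in>Y. h y * (t * b y))" using b(2) by simp
    also have "\<dots> = t * (\<Sum>y\<in>Y. h y * b y)" by (simp add: sum_distrib_left algebra_simps)
    finally have "s * x = t * (\<Sum>y\<in>Y. h y * b y)" .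
    moreover have "(\<Sum>y\<in>Y. h y * b y) \<in> A\<^sub>0" using h(1) b(1) by (intro sring_sum[OF A0] s0(4)) auto
    ultimately show ?thesis by blast
  qed
  then show thesis using that[OF t(1) s(1)] by blast
qed

text \<open>
  The elements divisible by every power of \<open>t\<close> form a prime strictly between \<open>0\<close> and \<open>a\<close>
  unless they are all zero, so Krull dimension one replaces the intersection theorem.
\<close>

lemma uniformizer_exists:
  obtains t s where "unif A\<^sub>0 a t" "s \<in> A\<^sub>0 - a" "\<And>x. x \<in> a \<Longrightarrow> \<exists>b\<in>A\<^sub>0. s * x = t * b"
proof -
  obtain t s where ts: "t \<in> a" "s \<in> A\<^sub>0 - a" "\<And>x. x \<in> a \<Longrightarrow> \<exists>b\<in>A\<^sub>0. s * x = t * b"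
    using nakayama by blast
  have tA: "t \<in> A\<^sub>0" using ts ai(1) by auto
  have kd: "\<exists>p. prime_chain A\<^sub>0 1 p" "\<not> (\<exists>p. prime_chain A\<^sub>0 (Suc 1) p)"
    using curve by (auto simp: smooth_affine_curve_def has_krull_dim_def)
  \<comment> \<open>With \<open>a\<close> zero the ring would be a field, leaving no room for the
    strict chain of two primes that dimension one provides.\<close>
  have "a \<noteq> {0}"
  proof
    assume a0: "a = {0}"
    obtain p where "prime_chain A\<^sub>0 1 p" using kd(1) by blast
    then have p: "primeideal (p 0) (subr A\<^sub>0)" "primeideal (p 1) (subr A\<^sub>0)" "p 0 \<subset> p 1"
      unfolding prime_chain_def by simp_all
    note P1 = primeD[OF A0 p(2)]
    have "{0} \<subseteq> p 1" using idealD(2)[OF A0 P1(1)] by auto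
    then have "p 1 = {0}" using Spm_eqI[OF A0 a P1(1) _ P1(2)] a0 by auto
    then show False using p(3) idealD(2)[OF A0 primeD(1)[OF A0 p(1)]] by auto
  qed
  then obtain x0 where x0: "x0 \<in> a" "x0 \<noteq> 0" using ai(2) by auto
  have t0: "t \<noteq> 0"
  proof
    assume "t = 0"
    then have "s * x0 = 0" using ts(3)[OF x0(1)] by auto
    then show False using ts(2) x0(2) ai(2) by auto
  qed
  define Q where "Q = {g\<in>A\<^sub>0. \<forall>n. \<exists>r\<in>A\<^sub>0 - a. \<exists>b\<in>A\<^sub>0. r * g = b * t ^ n}"
  have tn: "t ^ n \<in> A\<^sub>0" for n using s0(7)[OF tA] .
  have notQ: "\<exists>n. \<exists>r\<in>A\<^sub>0 - a. \<exists>r'\<in>A\<^sub>0 - a. r * g = r' * t ^ n" if g: "g \<in> A\<^sub>0" "g \<notin> Q" for g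
  proof -
    let ?R = "\<lambda>n. \<exists>r\<in>A\<^sub>0 - a. \<exists>b\<in>A\<^sub>0. r * g = b * t ^ n"
    obtain m where m: "\<not> ?R m" using g by (auto simp: Q_def)
    have R0: "?R 0" using g(1) ap(5) by (intro bexI[of _ 1] bexI[of _ g]) auto
    \<comment> \<open>The last power of \<open>t\<close> that divides \<open>g\<close> locally. A
      cofactor \<open>b\<close> in \<open>a\<close> would release one more factor
      \<open>t\<close>.\<close>
    obtain n where n: "?R n" "\<not> ?R (Suc n)"
      using m R0 by (induction m) auto
    then obtain r b where r: "r \<in> A\<^sub>0 - a" "b \<in> A\<^sub>0" "r * g = b * t ^ n" by blast
    have "b \<notin> a"
    proof
      assume "b \<in> a"
      then obtain c where c: "c \<in> A\<^sub>0" "s * b = t * c" using ts(3) by blast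
      have "(s * r) * g = (s * b) * t ^ n" using r(3) by (simp add: mult.assoc)
      also have "\<dots> = c * t ^ Suc n" unfolding c(2) by (simp add: algebra_simps)
      finally have "?R (Suc n)" using c(1) ap(4)[OF ts(2) r(1)] by (intro bexI)
      then show False using n(2) by blast
    qed
    then show ?thesis using r by blast
  qed
  have cancel: "n < m \<Longrightarrow> r' * t ^ n = b * t ^ m \<Longrightarrow> b \<in> A\<^sub>0 \<Longrightarrow> r' \<in> a" for r' b n m
  proof -
    assume h: "n < m" "r' * t ^ n = b * t ^ m" "b \<in> A\<^sub>0"
    then obtain k where k: "m = n + Suc k" by (metis add_Suc_right less_imp_Suc_add)
    then have "r' * t ^ n = (b * t ^ k * t) * t ^ n" using h by (simp add: power_add algebra_simps)
    then have "r' = b * t ^ k * t" using t0 by simp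
    then show "r' \<in> a" using ai(4)[OF s0(4)[OF h(3) tn] ts(1)] by simp
  qed
  have Qprime: "primeideal Q (subr A\<^sub>0)"
    unfolding primeideal_subr_iff[OF A0] ideal_subr_iff[OF A0]
  proof (intro conjI ballI impI)
    show "Q \<subseteq> A\<^sub>0" by (auto simp: Q_def)
    show "0 \<in> Q" unfolding Q_def using s0(1) ap(5) by (auto intro!: bexI[of _ 1] bexI[of _ 0])
    show "1 \<notin> Q"
    proof
      assume "1 \<in> Q"
      then obtain r b where "r \<in> A\<^sub>0 - a" "b \<in> A\<^sub>0" "r * 1 = b * t ^ 1" unfolding Q_def by blast
      then show False using ai(4)[of b t] ts(1) by auto
    qed
  next
    fix x y assume xy: "x \<in> Q" "y \<in> Q"
    show "x + y \<in> Q" unfolding Q_def mem_Collect_eq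
    proof (intro conjI allI)
      show "x + y \<in> A\<^sub>0" using xy s0(6) by (auto simp: Q_def)
      fix n
      obtain r b where r: "r \<in> A\<^sub>0 - a" "b \<in> A\<^sub>0" "r * x = b * t ^ n" using xy unfolding Q_def by blast
      obtain q c where q: "q \<in> A\<^sub>0 - a" "c \<in> A\<^sub>0" "q * y = c * t ^ n" using xy unfolding Q_def by blast
      have "(r * q) * (x + y) = q * (r * x) + r * (q * y)" by (simp add: algebra_simps)
      also have "\<dots> = (q * b + r * c) * t ^ n" unfolding r(3) q(3) by (simp add: algebra_simps)
      finally have e: "(r * q) * (x + y) = (q * b + r * c) * t ^ n" .
      moreover have "q * b + r * c \<in> A\<^sub>0" using r(1,2) q(1,2) by (intro s0(6) s0(4)) auto
      ultimately show "\<exists>r\<in>A\<^sub>0 - a. \<exists>b\<in>A\<^sub>0. r * (x + y) = b * t ^ n"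
        using ap(4)[OF r(1) q(1)] by (intro bexI)
    qed
  next
    fix x y assume xy: "x \<in> A\<^sub>0" "y \<in> Q"
    show "x * y \<in> Q" unfolding Q_def mem_Collect_eq
    proof (intro conjI allI)
      show "x * y \<in> A\<^sub>0" using xy s0(4) by (auto simp: Q_def)
      fix n
      obtain r b where r: "r \<in> A\<^sub>0 - a" "b \<in> A\<^sub>0" "r * y = b * t ^ n" using xy unfolding Q_def by blast
      have "r * (x * y) = x * (r * y)" by (simp add: algebra_simps)
      also have "\<dots> = (x * b) * t ^ n" unfolding r(3) by (simp add: algebra_simps)
      finally show "\<exists>r\<in>A\<^sub>0 - a. \<exists>b\<in>A\<^sub>0. r * (x * y) = b * t ^ n"
        using r(1) s0(4)[OF xy(1) r(2)] by (intro bexI)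
    qed
  next
    fix x y assume xy: "x \<in> A\<^sub>0" "y \<in> A\<^sub>0" "x * y \<in> Q"
    show "x \<in> Q \<or> y \<in> Q"
    proof (rule ccontr)
      assume "\<not> (x \<in> Q \<or> y \<in> Q)"
      then obtain n r r' m q q' where r: "r \<in> A\<^sub>0 - a" "r' \<in> A\<^sub>0 - a" "r * x = r' * t ^ n"
          and q: "q \<in> A\<^sub>0 - a" "q' \<in> A\<^sub>0 - a" "q * y = q' * t ^ m"
        using notQ[OF xy(1)] notQ[OF xy(2)] by blast
      obtain p b where p: "p \<in> A\<^sub>0 - a" "b \<in> A\<^sub>0" "p * (x * y) = b * t ^ Suc (n + m)"
        using xy(3) unfolding Q_def by blast
      have "(p * (r' * q')) * t ^ (n + m) = p * (r * x) * (q * y)"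
        unfolding r(3) q(3) by (simp add: algebra_simps power_add)
      also have "\<dots> = (r * q) * (p * (x * y))" by (simp add: algebra_simps)
      also have "\<dots> = (r * q * b) * t ^ Suc (n + m)" unfolding p(3) by (simp add: algebra_simps)
      finally have "p * (r' * q') \<in> a"
        by (rule cancel[rotated]) (use r(1) q(1) p(2) s0(4) in auto)
      then show False using ap(4)[OF p(1) ap(4)[OF r(2) q(2)]] by auto
    qed
  qed
  have tQ: "t \<notin> Q"
  proof
    assume "t \<in> Q"
    then obtain r b where r: "r \<in> A\<^sub>0 - a" "b \<in> A\<^sub>0" "r * t = b * t ^ 2" unfolding Q_def by blast
    then have "r \<in> a" using cancel[of 1 2 r b] by auto
    then show False using r(1) by auto
  qed
  have Qa: "Q \<subseteq> a"
  proof
    fix g assume g: "g \<in> Q"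
    then obtain r b where r: "r \<in> A\<^sub>0 - a" "b \<in> A\<^sub>0" "r * g = b * t ^ 1" unfolding Q_def by blast
    have "r * g \<in> a" unfolding r(3) using ai(4)[OF r(2) ts(1)] by simp
    then show "g \<in> a" using ap(3)[of r g] r(1) g by (auto simp: Q_def)
  qed
  have Q0: "Q = {0}"
  proof (rule ccontr)
    assume ne: "Q \<noteq> {0}"
    have z: "primeideal {0} (subr A\<^sub>0)"
      unfolding primeideal_subr_iff[OF A0] ideal_subr_iff[OF A0] using s0(1) by auto
    have 0: "{0} \<subset> Q" using ne idealD(2)[OF A0 primeD(1)[OF A0 Qprime]] by auto
    have 1: "Q \<subset> a" using Qa tQ ts(1) by auto
    have "prime_chain A\<^sub>0 (Suc 1) (\<lambda>i. if i = 0 then {0} else if i = 1 then Q else a)"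
      unfolding prime_chain_def using z Qprime aP 0 1 by auto
    then show False using kd(2) by blast
  qed
  have "unif A\<^sub>0 a t" unfolding unif_def using A0 aP ts(1) t0 notQ Q0 by auto
  then show thesis using that ts(2,3) by blast
qed

end

end

section \<open>Orders and residues at the points of the curve\<close>

lemma le_prime_ord_iff:
  assumes U: "unif A P \<pi>" and g: "g \<in> A" "g \<noteq> 0"
  shows "n \<le> prime_ord A P g \<longleftrightarrow> (\<exists>s\<in>A - P. \<exists>b\<in>A. s * g = b * \<pi> ^ n)"
proof
  note u = unif_facts[OF U]
  obtain t t' where t: "t \<in> A - P" "t' \<in> A - P" "t * g = t' * \<pi> ^ prime_ord A P g"
    using fraction_order_prime_ord[OF U g] by (auto simp: fraction_order_def)
  {
    assume "n \<le> prime_ord A P g"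
    then obtain k where k: "prime_ord A P g = k + n" by (metis add.commute le_iff_add)
    have "t * g = (t' * \<pi> ^ k) * \<pi> ^ n" unfolding t(3) k by (simp add: power_add algebra_simps)
    moreover have "t' * \<pi> ^ k \<in> A" using t(2) sringD(4,7)[OF u(1)] u(6) by auto
    ultimately show "\<exists>s\<in>A - P. \<exists>b\<in>A. s * g = b * \<pi> ^ n" using t(1) by (intro bexI)
  }
  assume "\<exists>s\<in>A - P. \<exists>b\<in>A. s * g = b * \<pi> ^ n"
  then obtain s b where s: "s \<in> A - P" "b \<in> A" "s * g = b * \<pi> ^ n" by blast
  have "(s * t') * \<pi> ^ prime_ord A P g = s * (t * g)" unfolding t(3) by (simp add: algebra_simps)
  also have "\<dots> = t * (s * g)" by (simp add: algebra_simps)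
  also have "\<dots> = (t * b) * \<pi> ^ n" unfolding s(3) by (simp add: algebra_simps)
  finally have e: "(s * t') * \<pi> ^ prime_ord A P g = (t * b) * \<pi> ^ n" .
  show "n \<le> prime_ord A P g"
    by (rule unif_power_le[OF U primeD(4)[OF u(1,2) s(1) t(2)] _ e]) (use t(1) s(2) sringD(4)[OF u(1)] in auto)
qed

context curve begin

abbreviation ord :: "'k set \<Rightarrow> 'k \<Rightarrow> int" where "ord \<equiv> frac_ord A\<^sub>0"

text \<open>The value \<open>ord a 0\<close> is unspecified; the first disjunct gives zero infinite
  order.\<close>

definition vge :: "'k set \<Rightarrow> int \<Rightarrow> 'k \<Rightarrow> bool" where
  "vge a k x \<longleftrightarrow> x = 0 \<or> k \<le> ord a x"

context
  fixes a assumes a: "a \<in> Spm A\<^sub>0"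
begin

private lemma ex_unif: "\<exists>t. unif A\<^sub>0 a t" using uniformizer_exists[OF a] by metis

lemma ord_frac: "g \<in> A\<^sub>0 \<Longrightarrow> h \<in> A\<^sub>0 \<Longrightarrow> g \<noteq> 0 \<Longrightarrow> h \<noteq> 0 \<Longrightarrow>
    ord a (g / h) = int (prime_ord A\<^sub>0 a g) - int (prime_ord A\<^sub>0 a h)"
  using ex_unif frac_ord_eq[of A\<^sub>0 a _ g h "g / h"] by auto

lemma nonzero_frac: "x \<noteq> 0 \<Longrightarrow> \<exists>g\<in>A\<^sub>0. \<exists>h\<in>A\<^sub>0. g \<noteq> 0 \<and> h \<noteq> 0 \<and> x = g / h"
  using frac[of x] by fastforce

lemma ord_A0: "g \<in> A\<^sub>0 \<Longrightarrow> g \<noteq> 0 \<Longrightarrow> ord a g = int (prime_ord A\<^sub>0 a g)"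
proof -
  assume g: "g \<in> A\<^sub>0" "g \<noteq> 0"
  obtain t where t: "unif A\<^sub>0 a t" using ex_unif by blast
  have "prime_ord A\<^sub>0 a (1 * 1) = prime_ord A\<^sub>0 a 1 + prime_ord A\<^sub>0 a 1"
    by (rule prime_ord_mult[OF t]) (use s0(2) in auto)
  then have "prime_ord A\<^sub>0 a 1 = 0" by simp
  then show ?thesis using ord_frac[OF g(1) s0(2) g(2)] by simp
qed

lemma ord_mult: assumes "x \<noteq> 0" "y \<noteq> 0" shows "ord a (x * y) = ord a x + ord a y"
proof -
  obtain t where t: "unif A\<^sub>0 a t" using ex_unif by blast
  obtain g h where x: "g \<in> A\<^sub>0" "h \<in> A\<^sub>0" "g \<noteq> 0" "h \<noteq> 0" "x = g / h" using nonzero_frac[OF assms(1)] by blast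
  obtain g' h' where y: "g' \<in> A\<^sub>0" "h' \<in> A\<^sub>0" "g' \<noteq> 0" "h' \<noteq> 0" "y = g' / h'" using nonzero_frac[OF assms(2)] by blast
  have "x * y = (g * g') / (h * h')" using x y by simp
  moreover have "ord a ((g * g') / (h * h')) = int (prime_ord A\<^sub>0 a (g * g')) - int (prime_ord A\<^sub>0 a (h * h'))"
    by (rule ord_frac) (use x y s0(4) in auto)
  ultimately show ?thesis unfolding x(5) y(5)
    using ord_frac x(1-4) y(1-4) prime_ord_mult[OF t] by simp
qed

lemma ord_1 [simp]: "ord a 1 = 0" using ord_mult[of 1 1] by simp

lemma ord_inverse: "x \<noteq> 0 \<Longrightarrow> ord a (inverse x) = - ord a x"
  using ord_mult[of x "inverse x"] by simp

lemma ord_divide: "x \<noteq> 0 \<Longrightarrow> y \<noteq> 0 \<Longrightarrow> ord a (x / y) = ord a x - ord a y"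
  using ord_mult[of x "inverse y"] ord_inverse[of y] by (simp add: divide_inverse)

lemma ord_power: "x \<noteq> 0 \<Longrightarrow> ord a (x ^ n) = int n * ord a x"
  by (induction n) (auto simp: ord_mult algebra_simps)

lemma ord_powi: "x \<noteq> 0 \<Longrightarrow> ord a (x powi n) = n * ord a x"
  by (auto simp: power_int_def ord_power ord_inverse)

lemma ord_uminus: "ord a (- x) = ord a x"
proof (cases "x = 0")
  case False
  have "ord a ((-1) * (-1)) = ord a (-1) + ord a (-1)" by (rule ord_mult) auto
  then have "ord a (-1) = 0" by simp
  then show ?thesis using ord_mult[of "-1" x] False by simp
qed simp

lemma ord_nonneg: "g \<in> A\<^sub>0 \<Longrightarrow> g \<noteq> 0 \<Longrightarrow> 0 \<le> ord a g"
  by (simp add: ord_A0)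

lemma ord_pos_iff: "g \<in> A\<^sub>0 \<Longrightarrow> g \<noteq> 0 \<Longrightarrow> 0 < ord a g \<longleftrightarrow> g \<in> a"
  using ex_unif prime_ord_pos_iff[of A\<^sub>0 a _ g] ord_A0 by auto

lemma nonzero_if_notin: "g \<in> A\<^sub>0 - a \<Longrightarrow> g \<noteq> 0" using ai(2)[OF a] by auto

lemma ord_0_if_notin: "g \<in> A\<^sub>0 - a \<Longrightarrow> ord a g = 0"
  using ord_pos_iff[of g] ord_nonneg[of g] nonzero_if_notin by fastforce

text \<open>The ultrametric inequality. A common denominator \<open>H\<close> moves both summands
  into \<open>A\<^sub>0\<close>, where an order bound means divisibility by a power of
  \<open>t\<close> up to a factor outside \<open>a\<close>.\<close>

lemma vge_add: assumes "vge a k x" "vge a k y" shows "vge a k (x + y)"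
proof (cases "x = 0 \<or> y = 0 \<or> x + y = 0")
  case True
  then show ?thesis using assms by (auto simp: vge_def)
next
  case False
  then have nz: "x \<noteq> 0" "y \<noteq> 0" "x + y \<noteq> 0" by auto
  obtain t where t: "unif A\<^sub>0 a t" using ex_unif by blast
  obtain g h where x: "g \<in> A\<^sub>0" "h \<in> A\<^sub>0" "g \<noteq> 0" "h \<noteq> 0" "x = g / h" using nonzero_frac[OF nz(1)] by blast
  obtain g' h' where y: "g' \<in> A\<^sub>0" "h' \<in> A\<^sub>0" "g' \<noteq> 0" "h' \<noteq> 0" "y = g' / h'" using nonzero_frac[OF nz(2)] by blast
  define H where "H = h * h'"
  have H: "H \<in> A\<^sub>0" "H \<noteq> 0" using x y s0(4) by (auto simp: H_def)
  define p q where "p = x * H" and "q = y * H"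
  have pq: "p \<in> A\<^sub>0" "q \<in> A\<^sub>0" "p \<noteq> 0" "q \<noteq> 0" "p + q \<noteq> 0"
  proof -
    have "p = g * h'" "q = g' * h" using x y by (auto simp: p_def q_def H_def)
    then show "p \<in> A\<^sub>0" "q \<in> A\<^sub>0" using x y s0(4) by auto
    show "p \<noteq> 0" "q \<noteq> 0" using nz H by (auto simp: p_def q_def)
    have "p + q = (x + y) * H" by (simp add: p_def q_def distrib_right)
    then show "p + q \<noteq> 0" using nz H by simp
  qed
  \<comment> \<open>Truncation at 0 is harmless, since elements of \<open>A\<^sub>0\<close> have
    nonnegative order anyway.\<close>
  define n where "n = nat (k + ord a H)"
  have n: "n \<le> prime_ord A\<^sub>0 a p" "n \<le> prime_ord A\<^sub>0 a q"
    using assms nz ord_mult[OF nz(1) H(2)] ord_mult[OF nz(2) H(2)] ord_A0[OF pq(1,3)] ord_A0[OF pq(2,4)]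
    by (auto simp: vge_def n_def p_def q_def)
  obtain s b where s: "s \<in> A\<^sub>0 - a" "b \<in> A\<^sub>0" "s * p = b * t ^ n"
    using n(1) le_prime_ord_iff[OF t pq(1,3)] by blast
  obtain r c where r: "r \<in> A\<^sub>0 - a" "c \<in> A\<^sub>0" "r * q = c * t ^ n"
    using n(2) le_prime_ord_iff[OF t pq(2,4)] by blast
  have "(s * r) * (p + q) = r * (s * p) + s * (r * q)" by (simp add: algebra_simps)
  also have "\<dots> = (r * b + s * c) * t ^ n" unfolding s(3) r(3) by (simp add: algebra_simps)
  finally have "(s * r) * (p + q) = (r * b + s * c) * t ^ n" .
  moreover have "r * b + s * c \<in> A\<^sub>0" using s(1,2) r(1,2) by (intro s0(6) s0(4)) auto
  ultimately have "n \<le> prime_ord A\<^sub>0 a (p + q)"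
    unfolding le_prime_ord_iff[OF t s0(6)[OF pq(1,2)] pq(5)] using ap(4)[OF a s(1) r(1)] by (intro bexI)
  then have "k + ord a H \<le> ord a (p + q)" using ord_A0[OF s0(6)[OF pq(1,2)] pq(5)] by (simp add: n_def)
  also have "p + q = (x + y) * H" by (simp add: p_def q_def distrib_right)
  also have "ord a \<dots> = ord a (x + y) + ord a H" by (rule ord_mult[OF nz(3) H(2)])
  finally show ?thesis by (simp add: vge_def)
qed

lemma vge_0 [simp]: "vge a k 0" by (simp add: vge_def)

lemma vge_uminus: "vge a k x \<Longrightarrow> vge a k (- x)" by (auto simp: vge_def ord_uminus)

lemma vge_diff: "vge a k x \<Longrightarrow> vge a k y \<Longrightarrow> vge a k (x - y)"
  using vge_add[of k x "- y"] vge_uminus[of k y] by simp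

lemma vge_mult: "vge a k x \<Longrightarrow> vge a l y \<Longrightarrow> vge a (k + l) (x * y)"
  by (cases "x = 0"; cases "y = 0") (simp_all add: vge_def ord_mult)

lemma vge_mono: "vge a k x \<Longrightarrow> l \<le> k \<Longrightarrow> vge a l x" by (auto simp: vge_def)

lemma vge_A0: "x \<in> A\<^sub>0 \<Longrightarrow> vge a 0 x" using ord_nonneg by (auto simp: vge_def)

lemma vge_1_iff: "x \<in> A\<^sub>0 \<Longrightarrow> vge a 1 x \<longleftrightarrow> x \<in> a"
  using ord_pos_iff[of x] ai(2)[OF a] by (cases "x = 0") (auto simp: vge_def)

text \<open>The quotient \<open>x / y\<close> has order 0, so it is a unit of the local ring.
  Functions known only through their order become interchangeable up to factors that do not vanish
  at \<open>a\<close>.\<close>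

lemma same_ord:
  assumes "x \<noteq> 0" "y \<noteq> 0" "ord a x = ord a y"
  obtains s s' where "s \<in> A\<^sub>0 - a" "s' \<in> A\<^sub>0 - a" "s * x = s' * y"
proof -
  obtain t where t: "unif A\<^sub>0 a t" using ex_unif by blast
  obtain g h where gh: "g \<in> A\<^sub>0" "h \<in> A\<^sub>0" "g \<noteq> 0" "h \<noteq> 0" "x / y = g / h"
    using nonzero_frac[of "x / y"] assms by auto
  have "ord a (x / y) = 0" using ord_divide assms by simp
  then have e: "prime_ord A\<^sub>0 a g = prime_ord A\<^sub>0 a h" using ord_frac[OF gh(1-4)] gh(5) by simp
  obtain s s' where s: "s \<in> A\<^sub>0 - a" "s' \<in> A\<^sub>0 - a" "s * g = s' * t ^ prime_ord A\<^sub>0 a g"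
    using fraction_order_prime_ord[OF t gh(1,3)] by (auto simp: fraction_order_def)
  obtain r r' where r: "r \<in> A\<^sub>0 - a" "r' \<in> A\<^sub>0 - a" "r * h = r' * t ^ prime_ord A\<^sub>0 a g"
    using fraction_order_prime_ord[OF t gh(2,4)] by (auto simp: fraction_order_def e)
  have "(s * r') * g * t ^ prime_ord A\<^sub>0 a g = (s * g) * (r' * t ^ prime_ord A\<^sub>0 a g)" by (simp add: algebra_simps)
  also have "\<dots> = (s' * r) * h * t ^ prime_ord A\<^sub>0 a g" unfolding s(3) r(3)[symmetric] by (simp add: algebra_simps)
  finally have sg: "(s * r') * g = (s' * r) * h" using unif_facts(5)[OF t] by simp
  have hx: "h * x = g * y" using gh(4,5) assms by (simp add: field_simps)
  have "h * ((s * r') * x) = (s * r') * (h * x)" by (simp add: algebra_simps)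
  also have "\<dots> = ((s * r') * g) * y" unfolding hx by (simp add: algebra_simps)
  also have "\<dots> = h * ((s' * r) * y)" unfolding sg by (simp add: algebra_simps)
  finally have "h * ((s * r') * x) = h * ((s' * r) * y)" .
  then have "(s * r') * x = (s' * r) * y" using gh(4) by simp
  then show thesis using that ap(4)[OF a s(1) r(2)] ap(4)[OF a s(2) r(1)] by blast
qed

lemma local_fraction:
  assumes "vge a 0 x"
  obtains s b where "s \<in> A\<^sub>0 - a" "b \<in> A\<^sub>0" "s * x = b"
proof (cases "x = 0")
  case True
  then show ?thesis using that[of 1 0] ap(5)[OF a] s0(1) by auto
next
  case False
  obtain t where t: "unif A\<^sub>0 a t" using ex_unif by blast
  have tf: "t \<noteq> 0" "t \<in> A\<^sub>0" using unif_facts[OF t] by auto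
  have "prime_ord A\<^sub>0 a t = 1"
    by (rule prime_ord_eq[OF t tf(2)]) (use ap(5)[OF a] in \<open>auto simp: fraction_order_def intro!: bexI[of _ 1]\<close>)
  then have t1: "ord a t = 1" using ord_A0 tf by simp
  have "ord a x = ord a (t ^ nat (ord a x))" using assms False by (simp add: ord_power tf t1 vge_def)
  then obtain s s' where "s \<in> A\<^sub>0 - a" "s' \<in> A\<^sub>0 - a" "s * x = s' * t ^ nat (ord a x)"
    using same_ord[of x "t ^ nat (ord a x)"] False tf by auto
  then show ?thesis using that[of s "s' * t ^ nat (ord a x)"] s0(4,7) tf by auto
qed

text \<open>At another point \<open>b\<close> some \<open>x\<close> in \<open>a\<close> does not
  vanish, and the equation \<open>s * x = t * c\<close> then forces \<open>s\<close> to vanish at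
  \<open>b\<close> at least as much as \<open>t\<close>. So powers of \<open>s\<close> cancel the
  poles of negative powers of \<open>t\<close>, and \<open>t\<close> has no zero besides
  \<open>a\<close> where \<open>s\<close> is nonzero.\<close>

lemma uniformizer_with_bound:
  obtains t s where "t \<in> a" "t \<noteq> 0" "ord a t = 1" "s \<in> A\<^sub>0 - a"
    "\<And>b. b \<in> Spm A\<^sub>0 \<Longrightarrow> b \<noteq> a \<Longrightarrow> ord b t \<le> ord b s"
proof -
  obtain t s where t: "unif A\<^sub>0 a t" and s: "s \<in> A\<^sub>0 - a" "\<And>x. x \<in> a \<Longrightarrow> \<exists>b\<in>A\<^sub>0. s * x = t * b"
    using uniformizer_exists[OF a] by blast
  have tf: "t \<noteq> 0" "t \<in> A\<^sub>0" "t \<in> a" using unif_facts[OF t] by auto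
  have "prime_ord A\<^sub>0 a t = 1"
    by (rule prime_ord_eq[OF t tf(2)]) (use ap(5)[OF a] in \<open>auto simp: fraction_order_def intro!: bexI[of _ 1]\<close>)
  then have t1: "ord a t = 1" using ord_A0 tf by simp
  show thesis
  proof (rule that[OF tf(3,1) t1 s(1)])
    fix b assume b: "b \<in> Spm A\<^sub>0" "b \<noteq> a"
    then obtain x where x: "x \<in> a" "x \<notin> b" using Spm_diff[OF A0 b(1) a] by blast
    obtain c where c: "c \<in> A\<^sub>0" "s * x = t * c" using s(2)[OF x(1)] by blast
    have nz: "s \<noteq> 0" "x \<noteq> 0" using s(1) x ai(2)[OF a] ai(2)[OF b(1)] by auto
    then have nz2: "c \<noteq> 0" using c(2) by auto
    obtain t' where t': "unif A\<^sub>0 b t'" using uniformizer_exists[OF b(1)] by metis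
    have "prime_ord A\<^sub>0 b s + prime_ord A\<^sub>0 b x = prime_ord A\<^sub>0 b t + prime_ord A\<^sub>0 b c"
      using prime_ord_mult[OF t', of s x] prime_ord_mult[OF t', of t c] c nz nz2 tf s(1) x ai(1)[OF a] by auto
    moreover have "prime_ord A\<^sub>0 b x = 0" using prime_ord_pos_iff[OF t', of x] x nz ai(1)[OF a] by auto
    moreover have "ord b y = int (prime_ord A\<^sub>0 b y)" if "y \<in> A\<^sub>0" "y \<noteq> 0" for y
    proof -
      have "prime_ord A\<^sub>0 b (1 * 1) = prime_ord A\<^sub>0 b 1 + prime_ord A\<^sub>0 b 1"
        by (rule prime_ord_mult[OF t']) (use s0(2) in auto)
      then show ?thesis using frac_ord_eq[OF t' that(1) s0(2) that(2), of y] by simp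
    qed
    ultimately show "ord b t \<le> ord b s" using tf nz s(1) by simp
  qed
qed

text \<open>The residue map of the local ring. In contrast to \<open>res\<close> it also applies to
  quotients of nonnegative order, such as a function divided by a power of the local
  parameter.\<close>

definition R :: "'k \<Rightarrow> complex" where "R x = (THE c. vge a 1 (x - \<iota> c))"

lemma vge_iota: "vge a 1 (\<iota> c) \<longleftrightarrow> c = 0"
  using vge_1_iff[OF iota_A0[OF a], of c] res_0_iff[OF a iota_A0[OF a], of c] by (simp add: res_iota[OF a])

lemma R_eq: "vge a 1 (x - \<iota> c) \<Longrightarrow> R x = c"
  unfolding R_def
proof (rule the_equality)
  fix d assume h: "vge a 1 (x - \<iota> c)" "vge a 1 (x - \<iota> d)"
  have "vge a 1 ((x - \<iota> c) - (x - \<iota> d))" by (rule vge_diff[OF h])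
  then have "vge a 1 (\<iota> (d - c))" by (simp add: chom_simps)
  then show "d = c" unfolding vge_iota by simp
qed

lemma R: assumes "vge a 0 x" shows "vge a 1 (x - \<iota> (R x))"
proof -
  obtain s b where s: "s \<in> A\<^sub>0 - a" "b \<in> A\<^sub>0" "s * x = b" using local_fraction[OF assms] .
  \<comment> \<open>For \<open>x = b / s\<close> the value at \<open>a\<close> is the quotient of
    the values.\<close>
  define c where "c = res a b / res a s"
  have rs: "res a s \<noteq> 0" using res_0_iff[OF a] s(1) by auto
  have "b - \<iota> c * s \<in> A\<^sub>0" using s s0(3,4) iota_A0[OF a] by auto
  moreover have "res a (b - \<iota> c * s) = 0"
  proof -
    have "res a ((b - \<iota> c * s) + \<iota> c * s) = res a (b - \<iota> c * s) + c * res a s"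
      using calculation s iota_A0[OF a] s0(4) by (subst res_hom[OF a]) (auto simp: res_hom[OF a] res_iota[OF a])
    then show ?thesis using rs by (simp add: c_def)
  qed
  ultimately have "b - \<iota> c * s \<in> a" using res_0_iff[OF a] by blast
  then have v: "vge a 1 (b - \<iota> c * s)" using vge_1_iff ai(1)[OF a] by auto
  have nz: "s \<noteq> 0" using nonzero_if_notin[OF s(1)] .
  have "x - \<iota> c = (b - \<iota> c * s) * inverse s" using nz s(3) by (simp add: field_simps)
  moreover have "vge a (1 + 0) ((b - \<iota> c * s) * inverse s)"
    by (rule vge_mult[OF v]) (simp add: vge_def ord_inverse nz ord_0_if_notin[OF s(1)])
  ultimately have "vge a 1 (x - \<iota> c)" by simp
  then show ?thesis using R_eq by simp
qed

lemma R_iota [simp]: "R (\<iota> c) = c" by (rule R_eq) simp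
lemma R_0 [simp]: "R 0 = 0" using R_iota[of 0] by (simp add: chom_simps)

lemma vge_iota0: "vge a 0 (\<iota> c)" by (rule vge_A0[OF iota_A0[OF a]])

lemma R_add: assumes "vge a 0 x" "vge a 0 y" shows "R (x + y) = R x + R y"
proof (rule R_eq)
  have "x + y - \<iota> (R x + R y) = (x - \<iota> (R x)) + (y - \<iota> (R y))" unfolding chom_simps(1) by simp
  then show "vge a 1 (x + y - \<iota> (R x + R y))" using vge_add[OF R R] assms by metis
qed

lemma R_mult: assumes "vge a 0 x" "vge a 0 y" shows "R (x * y) = R x * R y"
proof (rule R_eq)
  have "x * y - \<iota> (R x * R y) = (x - \<iota> (R x)) * y + (y - \<iota> (R y)) * \<iota> (R x)"
    unfolding chom_simps(2) by (simp add: algebra_simps)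
  moreover have "vge a 1 ((x - \<iota> (R x)) * y)" "vge a 1 ((y - \<iota> (R y)) * \<iota> (R x))"
    using vge_mult[OF R[OF assms(1)] assms(2)] vge_mult[OF R[OF assms(2)] vge_iota0] by simp_all
  ultimately show "vge a 1 (x * y - \<iota> (R x * R y))" using vge_add by simp
qed

lemma R_0_iff: "vge a 0 x \<Longrightarrow> R x = 0 \<longleftrightarrow> vge a 1 x"
  using R[of x] R_eq[of x 0] by (auto simp: chom_simps)

lemma R_in_A0: "x \<in> A\<^sub>0 \<Longrightarrow> x - \<iota> (R x) \<in> a"
  using vge_1_iff[of "x - \<iota> (R x)"] R[OF vge_A0] s0(3) iota_A0[OF a] by auto

end

text \<open>The denominators of \<open>x\<close> form an ideal. If \<open>x\<close> is regular at
  every point, each maximal ideal misses some denominator, so the ideal contains 1.\<close>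

lemma A0_iff: "x \<in> A\<^sub>0 \<longleftrightarrow> (\<forall>a\<in>Spm A\<^sub>0. vge a 0 x)"
proof
  assume h: "\<forall>a\<in>Spm A\<^sub>0. vge a 0 x"
  define I where "I = {g\<in>A\<^sub>0. g * x \<in> A\<^sub>0}"
  have I: "ideal I (subr A\<^sub>0)"
    unfolding ideal_subr_iff[OF A0] I_def using s0(1,4,6) by (auto simp: distrib_right mult.assoc)
  have "1 \<in> I"
  proof (rule ccontr)
    assume "1 \<notin> I"
    then obtain a where a: "a \<in> Spm A\<^sub>0" "I \<subseteq> a" using exists_Spm[OF A0 I] by blast
    have "vge a 0 x" using h a by blast
    then obtain s b where "s \<in> A\<^sub>0 - a" "b \<in> A\<^sub>0" "s * x = b" using local_fraction[OF a(1)] by blast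
    then show False using a(2) by (auto simp: I_def)
  qed
  then show "x \<in> A\<^sub>0" by (simp add: I_def)
qed (use vge_A0 in blast)

text \<open>A product, over the other points of \<open>B\<close>, of \<open>N\<close>-th powers of
  functions vanishing there but not at \<open>a\<close>.\<close>

lemma approximation:
  assumes a: "a \<in> Spm A\<^sub>0" and B: "finite B" "B \<subseteq> Spm A\<^sub>0"
  obtains s where "s \<in> A\<^sub>0 - a" "\<And>b. b \<in> B \<Longrightarrow> b \<noteq> a \<Longrightarrow> int N \<le> ord b s"
proof -
  have "\<exists>x. x \<in> b \<and> x \<notin> a" if "b \<in> B - {a}" for b
    using Spm_diff[OF A0 a, of b] that B by auto
  then obtain x where x: "\<And>b. b \<in> B - {a} \<Longrightarrow> x b \<in> b \<and> x b \<notin> a" by metis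
  define s where "s = (\<Prod>b\<in>B - {a}. x b ^ N)"
  have xA: "x b \<in> A\<^sub>0 - a" if "b \<in> B - {a}" for b
    using x[OF that] ai(1)[of b] that B by auto
  have s: "s \<in> A\<^sub>0 - a" unfolding s_def
    by (rule prime_prod[OF A0 aP[OF a]]) (use xA ap(6)[OF a] in blast)
  show thesis
  proof (rule that[OF s])
    fix b assume b: "b \<in> B" "b \<noteq> a"
    then have bS: "b \<in> Spm A\<^sub>0" using B by auto
    define p where "p = (\<Prod>c\<in>B - {a} - {b}. x c ^ N)"
    have e: "s = x b ^ N * p" unfolding s_def p_def using B b by (subst prod.remove[of _ b]) auto
    have nz: "x c \<noteq> 0" if "c \<in> B - {a}" for c using nonzero_if_notin[OF a xA[OF that]] .
    have p: "p \<in> A\<^sub>0" "p \<noteq> 0" unfolding p_def using xA nz B(1) s0(7) by (auto intro!: sring_prod[OF A0])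
    have xb: "x b \<noteq> 0" "0 < ord b (x b)" using nz[of b] b ord_pos_iff[OF bS, of "x b"] xA[of b] x[of b] by auto
    have "ord b s = int N * ord b (x b) + ord b p"
      unfolding e using p xb by (simp add: ord_mult[OF bS] ord_power[OF bS])
    moreover have "int N * 1 \<le> int N * ord b (x b)" using xb by (intro mult_left_mono) auto
    ultimately show "int N \<le> ord b s" using ord_nonneg[OF bS p] by simp
  qed
qed

end

abbreviation lookup :: "(int \<Rightarrow>\<^sub>0 'a::zero) \<Rightarrow> int \<Rightarrow> 'a" where
  "lookup \<equiv> Poly_Mapping.lookup"

section \<open>Laurent polynomials\<close>

lemma sum_single_lookup:
  "(\<Sum>n\<in>Poly_Mapping.keys f. Poly_Mapping.single n (lookup f n)) = f"
proof (rule poly_mapping_eqI)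
  fix k
  have "lookup (\<Sum>n\<in>Poly_Mapping.keys f. Poly_Mapping.single n (lookup f n)) k =
      (\<Sum>n\<in>Poly_Mapping.keys f. if n = k then lookup f k else 0)"
    unfolding lookup_sum by (rule sum.cong) (auto simp: lookup_single when_def)
  then show "lookup (\<Sum>n\<in>Poly_Mapping.keys f. Poly_Mapping.single n (lookup f n)) k = lookup f k"
    by (auto simp: in_keys_iff)
qed

lemma lookup_single_times: "lookup (Poly_Mapping.single n c * g) k = c * lookup g (k - n)"
  for g :: "int \<Rightarrow>\<^sub>0 'a::comm_ring_1"
proof -
  have "Poly_Mapping.single n c * g =
      (\<Sum>m\<in>Poly_Mapping.keys g. Poly_Mapping.single (n + m) (c * lookup g m))"
    by (subst (1) sum_single_lookup[of g, symmetric]) (simp add: sum_distrib_left mult_single)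
  then have "lookup (Poly_Mapping.single n c * g) k =
      (\<Sum>m\<in>Poly_Mapping.keys g. lookup (Poly_Mapping.single (n + m) (c * lookup g m)) k)"
    by (simp only: lookup_sum)
  also have "\<dots> = (\<Sum>m\<in>Poly_Mapping.keys g. if m = k - n then c * lookup g (k - n) else 0)"
    by (rule sum.cong) (auto simp: lookup_single when_def)
  also have "\<dots> = c * lookup g (k - n)" by (auto simp: in_keys_iff)
  finally show ?thesis .
qed

lemma lookup_times_int: "lookup (f * g) k = (\<Sum>n\<in>Poly_Mapping.keys f. lookup f n * lookup g (k - n))"
  for f g :: "int \<Rightarrow>\<^sub>0 'a::comm_ring_1"
proof -
  have "f * g = (\<Sum>n\<in>Poly_Mapping.keys f. Poly_Mapping.single n (lookup f n) * g)"
    by (subst (1) sum_single_lookup[of f, symmetric]) (simp add: sum_distrib_right)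
  then show ?thesis by (simp add: lookup_sum lookup_single_times)
qed

lemma times_eq_sum_single: "f * g = (\<Sum>n\<in>Poly_Mapping.keys f. \<Sum>m\<in>Poly_Mapping.keys g.
    Poly_Mapping.single (n + m) (lookup f n * lookup g m))"
  for f g :: "int \<Rightarrow>\<^sub>0 'a::comm_ring_1"
proof -
  have "f * g = (\<Sum>n\<in>Poly_Mapping.keys f. Poly_Mapping.single n (lookup f n)) *
      (\<Sum>m\<in>Poly_Mapping.keys g. Poly_Mapping.single m (lookup g m))"
    by (simp only: sum_single_lookup)
  then show ?thesis by (simp add: sum_product mult_single)
qed

lemma single_power: "Poly_Mapping.single n c ^ k = Poly_Mapping.single (int k * n) (c ^ k)"
  for c :: "'a::comm_ring_1"
  by (induction k) (auto simp: mult_single algebra_simps single_one)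

text \<open>Serves both for \<open>A\<close> itself and for its valuation ideals.\<close>

definition gr :: "(int \<Rightarrow> 'k::field set) \<Rightarrow> (int \<Rightarrow>\<^sub>0 'k) set" where
  "gr G = {f. \<forall>n. lookup f n \<in> G n}"

lemma gr_single: "(\<And>m. 0 \<in> G m) \<Longrightarrow> Poly_Mapping.single n x \<in> gr G \<longleftrightarrow> x \<in> G n"
  by (auto simp: gr_def lookup_single when_def)

lemma gr_add: "(\<And>n x y. x \<in> G n \<Longrightarrow> y \<in> G n \<Longrightarrow> x + y \<in> G n) \<Longrightarrow> f \<in> gr G \<Longrightarrow> g \<in> gr G \<Longrightarrow> f + g \<in> gr G"
  by (auto simp: gr_def lookup_add)

lemma gr_mult:
  assumes "\<And>n. 0 \<in> K n" "\<And>n x y. x \<in> K n \<Longrightarrow> y \<in> K n \<Longrightarrow> x + y \<in> K n"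
    and m: "\<And>n m x y. x \<in> G n \<Longrightarrow> y \<in> H m \<Longrightarrow> x * y \<in> K (n + m)"
    and fg: "f \<in> gr G" "g \<in> gr H"
  shows "f * g \<in> gr K"
  unfolding gr_def mem_Collect_eq lookup_times_int
proof
  fix k
  have s: "(\<And>i. i \<in> I \<Longrightarrow> F i \<in> K k) \<Longrightarrow> sum F I \<in> K k" for F and I :: "int set"
    by (induction I rule: infinite_finite_induct) (auto intro: assms)
  show "(\<Sum>n\<in>Poly_Mapping.keys f. lookup f n * lookup g (k - n)) \<in> K k"
  proof (rule s)
    fix n show "lookup f n * lookup g (k - n) \<in> K k"
      using m[of "lookup f n" n "lookup g (k - n)" "k - n"] fg by (auto simp: gr_def)
  qed
qed

definition ext :: "(int \<Rightarrow> 'k::field \<Rightarrow> complex) \<Rightarrow> (int \<Rightarrow>\<^sub>0 'k) \<Rightarrow> complex" where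
  "ext \<phi> f = (\<Sum>n\<in>Poly_Mapping.keys f. \<phi> n (lookup f n))"

text \<open>Additivity is required only inside the graded pieces, because residues are additive only
  where the orders involved are nonnegative.\<close>

locale graded_functional =
  fixes G :: "int \<Rightarrow> 'k::field set" and \<phi> :: "int \<Rightarrow> 'k \<Rightarrow> complex"
  assumes G0: "\<And>n. 0 \<in> G n" and Gadd: "\<And>n x y. x \<in> G n \<Longrightarrow> y \<in> G n \<Longrightarrow> x + y \<in> G n"
    and add: "\<And>n x y. x \<in> G n \<Longrightarrow> y \<in> G n \<Longrightarrow> \<phi> n (x + y) = \<phi> n x + \<phi> n y"
begin

lemma zero: "\<phi> n 0 = 0" using add[OF G0 G0, of n] by simp

lemma ext_superset:
  assumes "finite K" "Poly_Mapping.keys f \<subseteq> K"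
  shows "ext \<phi> f = (\<Sum>n\<in>K. \<phi> n (lookup f n))"
  unfolding ext_def using assms by (intro sum.mono_neutral_left) (auto simp: in_keys_iff zero)

lemma ext_add: assumes "f \<in> gr G" "g \<in> gr G" shows "ext \<phi> (f + g) = ext \<phi> f + ext \<phi> g"
proof -
  let ?K = "Poly_Mapping.keys f \<union> Poly_Mapping.keys g"
  have "ext \<phi> (f + g) = (\<Sum>n\<in>?K. \<phi> n (lookup f n + lookup g n))"
    using ext_superset[of ?K "f + g"] Poly_Mapping.keys_add[of f g] by (simp add: lookup_add)
  also have "\<dots> = (\<Sum>n\<in>?K. \<phi> n (lookup f n)) + (\<Sum>n\<in>?K. \<phi> n (lookup g n))"
    using assms by (simp add: add gr_def sum.distrib)
  finally show ?thesis using ext_superset[of ?K f] ext_superset[of ?K g] by simp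
qed

lemma ext_single: "ext \<phi> (Poly_Mapping.single n x) = \<phi> n x"
  using ext_superset[of "{n}" "Poly_Mapping.single n x"] by (auto simp: ext_def zero)

lemma ext_sum: "(\<And>i. i \<in> I \<Longrightarrow> F i \<in> gr G) \<Longrightarrow> ext \<phi> (sum F I) = (\<Sum>i\<in>I. ext \<phi> (F i)) \<and> sum F I \<in> gr G"
proof (induction I rule: infinite_finite_induct)
  case (insert i I)
  then show ?case using ext_add[of "F i" "sum F I"] gr_add[of G "F i" "sum F I"] Gadd by auto
qed (auto simp: gr_def G0 ext_def)

text \<open>The product is expanded without assuming anything multiplicative about \<phi>, so that
  one expansion serves evaluations as well as derivations.\<close>

lemma ext_times:
  assumes m: "\<And>n m x y. x \<in> G n \<Longrightarrow> y \<in> G m \<Longrightarrow> x * y \<in> G (n + m)"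
    and fg: "f \<in> gr G" "g \<in> gr G"
  shows "ext \<phi> (f * g) = (\<Sum>n\<in>Poly_Mapping.keys f. \<Sum>m\<in>Poly_Mapping.keys g. \<phi> (n + m) (lookup f n * lookup g m))"
proof -
  have s: "Poly_Mapping.single (n + m) (lookup f n * lookup g m) \<in> gr G" for n m
    using fg m G0 by (simp add: gr_single) (simp add: gr_def)
  have "ext \<phi> (\<Sum>m\<in>M. Poly_Mapping.single (n + m) (lookup f n * lookup g m)) =
      (\<Sum>m\<in>M. \<phi> (n + m) (lookup f n * lookup g m)) \<and>
      (\<Sum>m\<in>M. Poly_Mapping.single (n + m) (lookup f n * lookup g m)) \<in> gr G" for n M
    using ext_sum[of M "\<lambda>m. Poly_Mapping.single (n + m) (lookup f n * lookup g m)"] s by (simp add: ext_single)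
  then show ?thesis unfolding times_eq_sum_single
    by (subst ext_sum[THEN conjunct1]) (simp_all only:)
qed

end

lemma lookup_act: "lookup (act \<iota> t f) n = \<iota> (t powi n) * lookup f n"
proof -
  have "lookup (act \<iota> t f) n = (\<Sum>i\<in>Poly_Mapping.keys f. if i = n then \<iota> (t powi n) * lookup f n else 0)"
    unfolding act_def lookup_sum by (rule sum.cong) (auto simp: lookup_single when_def)
  also have "\<dots> = \<iota> (t powi n) * lookup f n" by (auto simp: in_keys_iff)
  finally show ?thesis .
qed

lemma Cstar_carrier: "carrier Cstar = {t. t \<noteq> 0}"
proof -
  have "carrier Cstar = {x. \<exists>y. x * y = (1::complex) \<and> y * x = 1}"
    by (auto simp: units_of_def Units_def)
  also have "\<dots> = {t. t \<noteq> 0}"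
  proof (intro equalityI subsetI)
    fix t :: complex assume "t \<in> {t. t \<noteq> 0}"
    then have "t * inverse t = 1 \<and> inverse t * t = 1" by simp
    then show "t \<in> {x. \<exists>y. x * y = 1 \<and> y * x = 1}" by blast
  qed auto
  finally show ?thesis .
qed

lemma const_simps: "const (x + y) = const x + const y" "const (x * y) = const x * const y"
  "const 1 = 1" "const 0 = 0"
  by (auto simp: const_def single_add mult_single single_one)

section \<open>Graded pieces\<close>

locale dpd = curve \<iota> A\<^sub>0 for \<iota> :: "complex \<Rightarrow> 'k::field" and A\<^sub>0 +
  fixes Dp Dm :: "'k set \<Rightarrow> rat"
  assumes Dp: "Q_divisor A\<^sub>0 Dp" and Dm: "Q_divisor A\<^sub>0 Dm"
    and neg: "\<And>a. a \<in> Spm A\<^sub>0 \<Longrightarrow> Dp a + Dm a \<le> 0"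
begin

definition A :: "(int \<Rightarrow>\<^sub>0 'k) set" where "A = dpd_algebra A\<^sub>0 Dp Dm"

text \<open>One description for degrees of either sign: both inequalities are imposed always, and
  the one that does not belong to the sign of \<open>n\<close> follows from the other because
  \<open>Dp b + Dm b \<le> 0\<close>. This exhibits the exponents as a cone.\<close>

definition C :: "int \<Rightarrow> 'k set" where
  "C n = {x. x = 0 \<or> (\<forall>b\<in>Spm A\<^sub>0. - (of_int n * Dp b) \<le> of_int (ord b x) \<and> of_int n * Dm b \<le> of_int (ord b x))}"

lemma mem_C_nonneg:
  assumes "0 \<le> n"
  shows "x \<in> C n \<longleftrightarrow> x \<in> H0 A\<^sub>0 (\<lambda>a. \<lfloor>of_int n * Dp a\<rfloor>)"
proof -
  have "(- (of_int n * Dp b) \<le> of_int (ord b x) \<and> of_int n * Dm b \<le> of_int (ord b x)) \<longleftrightarrow>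
      0 \<le> ord b x + \<lfloor>of_int n * Dp b\<rfloor>" if b: "b \<in> Spm A\<^sub>0" for b
  proof -
    have "of_int n * (Dp b + Dm b) \<le> 0"
      using neg[OF b] assms by (intro mult_nonneg_nonpos) auto
    then have "of_int n * Dm b \<le> - (of_int n * Dp b)" by (simp add: algebra_simps)
    moreover have "0 \<le> ord b x + \<lfloor>of_int n * Dp b\<rfloor> \<longleftrightarrow> - ord b x \<le> \<lfloor>of_int n * Dp b\<rfloor>" by linarith
    moreover have "\<dots> \<longleftrightarrow> - (of_int n * Dp b) \<le> of_int (ord b x)" unfolding le_floor_iff by auto
    ultimately show ?thesis by linarith
  qed
  then show ?thesis unfolding C_def H0_def by auto
qed

lemma mem_C_nonpos:
  assumes "n \<le> 0"
  shows "x \<in> C n \<longleftrightarrow> x \<in> H0 A\<^sub>0 (\<lambda>a. \<lfloor>- of_int n * Dm a\<rfloor>)"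
proof -
  have "(- (of_int n * Dp b) \<le> of_int (ord b x) \<and> of_int n * Dm b \<le> of_int (ord b x)) \<longleftrightarrow>
      0 \<le> ord b x + \<lfloor>- of_int n * Dm b\<rfloor>" if b: "b \<in> Spm A\<^sub>0" for b
  proof -
    have "- of_int n * (Dp b + Dm b) \<le> 0"
      using neg[OF b] assms by (intro mult_nonneg_nonpos) auto
    then have "- (of_int n * Dp b) \<le> of_int n * Dm b" by (simp add: algebra_simps)
    moreover have "0 \<le> ord b x + \<lfloor>- of_int n * Dm b\<rfloor> \<longleftrightarrow> - ord b x \<le> \<lfloor>- of_int n * Dm b\<rfloor>" by linarith
    moreover have "\<dots> \<longleftrightarrow> of_int n * Dm b \<le> of_int (ord b x)" unfolding le_floor_iff by auto
    ultimately show ?thesis by linarith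
  qed
  then show ?thesis unfolding C_def H0_def by auto
qed

lemma A_eq: "A = gr C"
proof (intro equalityI subsetI)
  fix f assume f: "f \<in> A"
  show "f \<in> gr C" unfolding gr_def mem_Collect_eq
  proof
    fix n
    show "lookup f n \<in> C n"
    proof (cases "0 \<le> n")
      case True
      then show ?thesis using f unfolding mem_C_nonneg[OF True]
        by (auto simp: A_def dpd_algebra_def dest!: spec[of _ "nat n"])
    next
      case False
      then have n: "n \<le> 0" by simp
      have "lookup f (- int (nat (- n))) \<in> H0 A\<^sub>0 (\<lambda>a. \<lfloor>of_nat (nat (- n)) * Dm a\<rfloor>)"
        using f unfolding A_def dpd_algebra_def by blast
      then show ?thesis unfolding mem_C_nonpos[OF n] using n by (simp add: of_nat_nat)
    qed
  qed
next
  fix f assume f: "f \<in> gr C"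
  show "f \<in> A" unfolding A_def dpd_algebra_def mem_Collect_eq
  proof (intro allI conjI)
    fix n
    have "lookup f (int n) \<in> C (int n)" "lookup f (- int n) \<in> C (- int n)" using f by (auto simp: gr_def)
    then show "lookup f (int n) \<in> H0 A\<^sub>0 (\<lambda>a. \<lfloor>of_nat n * Dp a\<rfloor>)"
        "lookup f (- int n) \<in> H0 A\<^sub>0 (\<lambda>a. \<lfloor>of_nat n * Dm a\<rfloor>)"
      using mem_C_nonneg[of "int n"] mem_C_nonpos[of "- int n"] by simp_all
  qed
qed

lemma C_0 [simp]: "0 \<in> C n" by (simp add: C_def)

lemma C_add: assumes "x \<in> C n" "y \<in> C n" shows "x + y \<in> C n"
proof (cases "x = 0 \<or> y = 0 \<or> x + y = 0")
  case False
  then have xy: "x \<noteq> 0" "y \<noteq> 0" "x + y \<noteq> 0" by auto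
  have "- (of_int n * Dp b) \<le> of_int (ord b (x + y)) \<and> of_int n * Dm b \<le> of_int (ord b (x + y))"
    if b: "b \<in> Spm A\<^sub>0" for b
  proof -
    have "min (ord b x) (ord b y) \<le> ord b (x + y)"
      using vge_add[OF b, of "min (ord b x) (ord b y)" x y] xy by (simp add: vge_def)
    then have "rat_of_int (ord b x) \<le> of_int (ord b (x + y)) \<or> rat_of_int (ord b y) \<le> of_int (ord b (x + y))"
      unfolding of_int_le_iff by linarith
    moreover have "- (of_int n * Dp b) \<le> of_int (ord b x)" "of_int n * Dm b \<le> of_int (ord b x)"
        "- (of_int n * Dp b) \<le> of_int (ord b y)" "of_int n * Dm b \<le> of_int (ord b y)"
      using assms xy b unfolding C_def by blast+
    ultimately show ?thesis by linarith
  qed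
  then show ?thesis unfolding C_def by blast
qed (use assms in auto)

lemma C_mult: assumes "x \<in> C n" "y \<in> C m" shows "x * y \<in> C (n + m)"
proof (cases "x = 0 \<or> y = 0")
  case False
  have "- (of_int (n + m) * Dp b) \<le> of_int (ord b (x * y)) \<and> of_int (n + m) * Dm b \<le> of_int (ord b (x * y))"
    if b: "b \<in> Spm A\<^sub>0" for b
  proof -
    have "- (of_int n * Dp b) \<le> of_int (ord b x)" "of_int n * Dm b \<le> of_int (ord b x)"
        "- (of_int m * Dp b) \<le> of_int (ord b y)" "of_int m * Dm b \<le> of_int (ord b y)"
      using assms False b unfolding C_def by blast+
    then show ?thesis using False by (simp add: ord_mult[OF b] distrib_right)
  qed
  then show ?thesis unfolding C_def by blast
qed (auto simp: C_def)

lemma C0_eq: "C 0 = A\<^sub>0" by (auto simp: C_def A0_iff vge_def)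

lemma C_minus: "x \<in> C n \<Longrightarrow> - x \<in> C n" by (auto simp: C_def ord_uminus)

lemma C_scale: "x \<in> A\<^sub>0 \<Longrightarrow> y \<in> C n \<Longrightarrow> x * y \<in> C n"
  using C_mult[of x 0 y n] by (simp add: C0_eq)

lemma C_power: "x \<in> C n \<Longrightarrow> x ^ k \<in> C (int k * n)"
proof (induction k)
  case 0 then show ?case using s0(2) by (simp add: C0_eq)
next
  case (Suc k) then show ?case using C_mult[of x n "x ^ k" "int k * n"] by (simp add: algebra_simps)
qed

lemma A_single: "Poly_Mapping.single n x \<in> A \<longleftrightarrow> x \<in> C n"
  unfolding A_eq by (rule gr_single) simp

lemma A_const: "const x \<in> A \<longleftrightarrow> x \<in> A\<^sub>0"
  by (simp add: const_def A_single C0_eq)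

lemma A_lookup: "f \<in> A \<Longrightarrow> lookup f n \<in> C n" by (simp add: A_eq gr_def)

lemma A_ring: "sring A"
  unfolding sring_def
proof (intro conjI ballI)
  show "1 \<in> A" using A_const[of 1] s0(2) by (simp add: const_simps)
  fix f g assume fg: "f \<in> A" "g \<in> A"
  show "f * g \<in> A" using fg unfolding A_eq by (intro gr_mult[of C C C]) (auto intro: C_add C_mult)
  have "- g \<in> A" using fg(2) C_minus by (auto simp: A_eq gr_def)
  then have "f + - g \<in> A" using fg(1) unfolding A_eq by (intro gr_add) (auto intro: C_add)
  then show "f - g \<in> A" by simp
qed

lemmas sA = sringD[OF A_ring]

definition j :: "complex \<Rightarrow> (int \<Rightarrow>\<^sub>0 'k)" where "j = const \<circ> \<iota>"

lemma j_hom: "chom j" by (auto simp: chom_def j_def const_simps chom_simps)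

lemma j_A: "range j \<subseteq> A" using A0_iota by (auto simp: j_def A_const)

lemma j_mem: "j c \<in> A" using j_A by auto

lemma finite_support: "finite (supp Dp \<union> supp Dm)" "supp Dp \<union> supp Dm \<subseteq> Spm A\<^sub>0"
  using Dp Dm by (auto simp: Q_divisor_def)

text \<open>The witness is \<open>t powi k * s ^ nat \<bar>k\<bar> * p\<close>. At \<open>a\<close>
  the factors \<open>s\<close> and \<open>p\<close> are units, so the order is \<open>k\<close>.
  Elsewhere the power of \<open>s\<close> makes up for poles of the power of \<open>t\<close>, and
  \<open>p\<close> vanishes to high order at the remaining points of the supports.\<close>

lemma piece_exists:
  assumes a: "a \<in> Spm A\<^sub>0" and k: "- (of_int n * Dp a) \<le> of_int k" "of_int n * Dm a \<le> of_int k"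
  shows "\<exists>x. x \<noteq> 0 \<and> ord a x = k \<and> x \<in> C n"
proof -
  obtain t s where t: "t \<in> a" "t \<noteq> 0" "ord a t = 1" and s: "s \<in> A\<^sub>0 - a"
      "\<And>b. b \<in> Spm A\<^sub>0 \<Longrightarrow> b \<noteq> a \<Longrightarrow> ord b t \<le> ord b s"
    using uniformizer_with_bound[OF a] by metis
  define F where "F = supp Dp \<union> supp Dm"
  have F: "finite F" "F \<subseteq> Spm A\<^sub>0" using finite_support by (auto simp: F_def)
  \<comment> \<open>A sum instead of a maximum: it dominates each of the bounds imposed at the
    finitely many points of \<open>F\<close>.\<close>
  define N where "N = (\<Sum>b\<in>F. nat \<lceil>\<bar>of_int n * Dp b\<bar>\<rceil> + nat \<lceil>\<bar>of_int n * Dm b\<bar>\<rceil>)"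
  obtain p where p: "p \<in> A\<^sub>0 - a" "\<And>b. b \<in> F \<Longrightarrow> b \<noteq> a \<Longrightarrow> int N \<le> ord b p"
    using approximation[OF a F] by metis
  define x where "x = t powi k * s ^ nat \<bar>k\<bar> * p"
  have nz: "t \<noteq> 0" "s \<noteq> 0" "p \<noteq> 0" using t s p nonzero_if_notin[OF a] by auto
  have tA: "t \<in> A\<^sub>0" using t ai(1)[OF a] by auto
  have ordx: "ord b x = k * ord b t + int (nat \<bar>k\<bar>) * ord b s + ord b p" if "b \<in> Spm A\<^sub>0" for b
    unfolding x_def using nz by (simp add: ord_mult[OF that] ord_powi[OF that] ord_power[OF that])
  have oa: "ord a x = k" using ordx[OF a] t(3) ord_0_if_notin[OF a] s(1) p(1) by simp
  have "- (of_int n * Dp b) \<le> of_int (ord b x) \<and> of_int n * Dm b \<le> of_int (ord b x)" if b: "b \<in> Spm A\<^sub>0" for b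
  proof (cases "b = a")
    case True
    then show ?thesis using k oa by simp
  next
    case False
    have 1: "0 \<le> ord b t" "0 \<le> ord b s" "0 \<le> ord b p"
      using ord_nonneg[OF b] tA nz s(1) p(1) by auto
    have "0 \<le> k * ord b t + \<bar>k\<bar> * ord b s"
    proof (cases "0 \<le> k")
      case False
      have "- k * ord b t \<le> - k * ord b s" using False s(2)[OF b \<open>b \<noteq> a\<close>] by (intro mult_left_mono) auto
      then show ?thesis using False by simp
    qed (use 1 in auto)
    then have 2: "ord b p \<le> ord b x" using ordx[OF b] by simp
    show ?thesis
    proof (cases "b \<in> F")
      case True
      have "nat \<lceil>\<bar>of_int n * Dp b\<bar>\<rceil> + nat \<lceil>\<bar>of_int n * Dm b\<bar>\<rceil> \<le> N"
        unfolding N_def using True F(1) by (intro member_le_sum) auto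
      then have "\<lceil>\<bar>of_int n * Dp b\<bar>\<rceil> \<le> ord b x" "\<lceil>\<bar>of_int n * Dm b\<bar>\<rceil> \<le> ord b x"
        using p(2)[OF True False] 2 by linarith+
      then show ?thesis unfolding ceiling_le_iff by linarith
    next
      case False
      then have "Dp b = 0" "Dm b = 0" by (auto simp: F_def supp_def)
      then show ?thesis using 1 2 by simp
    qed
  qed
  then have "x \<in> C n" by (auto simp: C_def)
  moreover have "x \<noteq> 0" using nz by (simp add: x_def)
  ultimately show ?thesis using oa by blast
qed

text \<open>The poles allowed in degree \<open>n\<close> sit at finitely many points and have
  bounded order there, so a single function clears them for the whole piece.\<close>

lemma C_denominator: "\<exists>g\<in>A\<^sub>0. g \<noteq> 0 \<and> (\<forall>x\<in>C n. g * x \<in> A\<^sub>0)"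
proof -
  define F where "F = supp Dp \<union> supp Dm"
  have F: "finite F" "F \<subseteq> Spm A\<^sub>0" using finite_support by (auto simp: F_def)
  define N where "N = (\<Sum>b\<in>F. nat \<lceil>\<bar>of_int n * Dp b\<bar>\<rceil>)"
  have "\<exists>x. x \<in> b \<and> x \<noteq> 0" if b: "b \<in> F" for b
  proof -
    obtain t where "t \<in> b" "t \<noteq> 0" using uniformizer_with_bound[of b] F b by blast
    then show ?thesis by blast
  qed
  then obtain t where t: "\<And>b. b \<in> F \<Longrightarrow> t b \<in> b \<and> t b \<noteq> 0" by metis
  have tA: "t b \<in> A\<^sub>0" if "b \<in> F" for b using t[OF that] ai(1)[of b] F that by auto
  define g where "g = (\<Prod>b\<in>F. t b ^ N)"
  have g: "g \<in> A\<^sub>0" "g \<noteq> 0" unfolding g_def using t tA F(1) s0(7) by (auto intro!: sring_prod[OF A0])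
  have "g * x \<in> A\<^sub>0" if x: "x \<in> C n" for x
    unfolding A0_iff
  proof
    fix b assume b: "b \<in> Spm A\<^sub>0"
    show "vge b 0 (g * x)"
    proof (cases "x = 0")
      case False
      have xb: "- (of_int n * Dp b) \<le> of_int (ord b x)" using x False b by (auto simp: C_def)
      have "0 \<le> ord b g + ord b x"
      proof (cases "b \<in> F")
        case True
        define p where "p = (\<Prod>c\<in>F - {b}. t c ^ N)"
        have e: "g = t b ^ N * p" unfolding g_def p_def using F(1) True by (rule prod.remove)
        have p: "p \<in> A\<^sub>0" "p \<noteq> 0" unfolding p_def using t tA F(1) s0(7) by (auto intro!: sring_prod[OF A0])
        have t1: "1 \<le> ord b (t b)" using ord_pos_iff[OF b tA[OF True]] t[OF True] by auto
        have "ord b g = int N * ord b (t b) + ord b p"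
          unfolding e using p t[OF True] by (simp add: ord_mult[OF b] ord_power[OF b])
        moreover have "int N * 1 \<le> int N * ord b (t b)" using t1 by (intro mult_left_mono) auto
        moreover have "0 \<le> ord b p" using ord_nonneg[OF b p] .
        moreover have "nat \<lceil>\<bar>of_int n * Dp b\<bar>\<rceil> \<le> N"
          unfolding N_def using True F(1) by (intro member_le_sum) auto
        ultimately have "\<lceil>\<bar>of_int n * Dp b\<bar>\<rceil> \<le> ord b g" by linarith
        then have "\<bar>of_int n * Dp b\<bar> \<le> of_int (ord b g)" unfolding ceiling_le_iff .
        then have "0 \<le> rat_of_int (ord b g + ord b x)" using xb unfolding of_int_add by linarith
        then show ?thesis by linarith
      next
        case False
        then have "Dp b = 0" by (auto simp: F_def supp_def)
        then have "0 \<le> ord b x" using xb by simp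
        then show ?thesis using ord_nonneg[OF b g] by simp
      qed
      then show ?thesis using ord_mult[OF b g(2) False] by (simp add: vge_def)
    qed (simp add: vge_def)
  qed
  then show ?thesis using g by blast
qed

text \<open>Multiplication by the denominator \<open>g n\<close> embeds each graded piece into
  \<open>A\<^sub>0\<close>; a countable spanning set of \<open>A\<^sub>0\<close>, divided by all the
  \<open>g n\<close>, therefore spans \<open>A\<close>.\<close>

lemma A_countable_dim: "\<exists>T. countable T \<and> A \<subseteq> module.span (cscale j) T"
proof -
  interpret W: vector_space "cscale j" by (rule vector_space_cscale[OF j_hom])
  obtain T where T: "countable T" "A\<^sub>0 \<subseteq> V.span T" using A0_countable_dim by blast
  obtain g where g: "\<And>n. g n \<in> A\<^sub>0" "\<And>n. g n \<noteq> 0" "\<And>n x. x \<in> C n \<Longrightarrow> g n * x \<in> A\<^sub>0"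
    using C_denominator by metis
  define T' where "T' = (\<lambda>(n, x). Poly_Mapping.single n (x / g n)) ` (UNIV \<times> T)"
  have c: "countable T'" unfolding T'_def using T(1) by simp
  have 1: "Poly_Mapping.single n (x / g n) \<in> W.span T'" if "x \<in> V.span T" for n x
    using that
  proof (induction x rule: V.span_induct_alt)
    case base
    then show ?case by (simp add: W.span_zero)
  next
    case (step c x y)
    have "Poly_Mapping.single n (x / g n) \<in> T'" using step(1) by (force simp: T'_def)
    then have "cscale j c (Poly_Mapping.single n (x / g n)) + Poly_Mapping.single n (y / g n) \<in> W.span T'"
      using step by (intro W.span_add W.span_scale) (auto intro: W.span_base)
    moreover have "cscale j c (Poly_Mapping.single n (x / g n)) + Poly_Mapping.single n (y / g n) =
        Poly_Mapping.single n ((cscale \<iota> c x + y) / g n)"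
      by (simp add: cscale_def j_def const_def mult_single add_divide_distrib flip: single_add)
    ultimately show ?case by simp
  qed
  have "f \<in> W.span T'" if f: "f \<in> A" for f
  proof -
    have "Poly_Mapping.single n (lookup f n) \<in> W.span T'" for n
    proof -
      have "g n * lookup f n \<in> V.span T" using g(3)[OF A_lookup[OF f]] T(2) by auto
      from 1[OF this, of n] show ?thesis using g(2)[of n] by simp
    qed
    then have "(\<Sum>n\<in>Poly_Mapping.keys f. Poly_Mapping.single n (lookup f n)) \<in> W.span T'"
      by (intro W.span_sum)
    then show ?thesis by (simp add: sum_single_lookup)
  qed
  then show ?thesis using c by blast
qed

lemma A_residue: "z \<in> Spm A \<Longrightarrow> f \<in> A \<Longrightarrow> \<exists>c. f - j c \<in> z"
  using A_countable_dim residue_field_complex[OF j_hom A_ring j_A] by blast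

end

section \<open>The cone of exponents at a point, seen from one boundary ray\<close>

lemma single_eq_0_iff: "Poly_Mapping.single n x = 0 \<longleftrightarrow> x = 0"
  by (metis lookup_single_eq lookup_zero single_zero)

text \<open>
  One boundary ray \<open>\<sigma>(M, E)\<close> of the cone of all \<open>(n, k)\<close> such that a function of order \<open>k\<close> at \<open>a\<close>
  may occur in degree \<open>n\<close>.  The cone is the intersection of the half planes \<open>k M - n E \<ge> 0\<close> and
  \<open>k M' - n E' \<ge> 0\<close>.  The sign \<open>\<sigma> = 1\<close> gives \<open>O\<^sup>+\<close>, the sign \<open>\<sigma> = - 1\<close> with the half planes
  exchanged gives \<open>O\<^sup>-\<close>.
\<close>

locale face = dpd \<iota> A\<^sub>0 Dp Dm for \<iota> :: "complex \<Rightarrow> 'k::field" and A\<^sub>0 Dp Dm +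
  fixes a :: "'k set" and M E M' E' \<sigma> q :: int
  assumes a: "a \<in> Spm A\<^sub>0"
    and cone: "\<And>n k. - (of_int n * Dp a) \<le> of_int k \<and> of_int n * Dm a \<le> of_int k \<longleftrightarrow>
       0 \<le> k * M - n * E \<and> 0 \<le> k * M' - n * E'"
    and M: "0 < M" and M': "0 < M'" and coprime: "coprime E M"
    and \<sigma>: "\<sigma> = 1 \<or> \<sigma> = - 1"
    and d: "0 \<le> \<sigma> * (E * M' - M * E')"
    and d0: "E * M' = M * E' \<Longrightarrow> M' = M \<and> E' = E"
    and q: "0 \<le> q" "q < M" "M dvd q * E + 1"
begin

lemma \<sigma>\<sigma>: "\<sigma> * \<sigma> = 1" using \<sigma> by auto

abbreviation oa :: "'k \<Rightarrow> int" where "oa \<equiv> frac_ord A\<^sub>0 a"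
abbreviation S :: "int \<Rightarrow> 'k \<Rightarrow> (int \<Rightarrow>\<^sub>0 'k)" where "S \<equiv> Poly_Mapping.single"

definition v :: "int \<Rightarrow> int \<Rightarrow> int" where "v n k = k * M - n * E"
definition v' :: "int \<Rightarrow> int \<Rightarrow> int" where "v' n k = k * M' - n * E'"

lemma v_add: "v (n + m) (k + l) = v n k + v m l" "v' (n + m) (k + l) = v' n k + v' m l"
  and v_diff: "v (n - m) (k - l) = v n k - v m l" "v' (n - m) (k - l) = v' n k - v' m l"
  and v_mult: "v (c * n) (c * k) = c * v n k" "v' (c * n) (c * k) = c * v' n k"
  and v_0: "v 0 k = k * M" "v' 0 k = k * M'"
  by (simp_all add: v_def v'_def algebra_simps)

lemma v_ray: "v (\<sigma> * M) (\<sigma> * E) = 0" "v' (\<sigma> * M) (\<sigma> * E) = \<sigma> * (E * M' - M * E')"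
  "v M E = 0" "v' M E = E * M' - M * E'"
  by (simp_all add: v_def v'_def algebra_simps)

lemma C_v: "x \<in> C n \<Longrightarrow> x \<noteq> 0 \<Longrightarrow> 0 \<le> v n (oa x)"
  and C_v': "x \<in> C n \<Longrightarrow> x \<noteq> 0 \<Longrightarrow> 0 \<le> v' n (oa x)"
  using cone[of n "oa x"] a by (auto simp: C_def v_def v'_def)

lemma C_ex: "0 \<le> v n k \<Longrightarrow> 0 \<le> v' n k \<Longrightarrow> \<exists>x. x \<noteq> 0 \<and> oa x = k \<and> x \<in> C n"
  using piece_exists[OF a, of n k] cone[of n k] by (auto simp: v_def v'_def)

text \<open>A step along the ray keeps \<open>v\<close> and raises \<open>v'\<close> by
  \<open>D = \<sigma> * (E * M' - M * E')\<close>. If \<open>D\<close> is positive, enough steps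
  make \<open>v'\<close> nonnegative; if \<open>D\<close> is 0 the two half planes coincide and
  \<open>v'\<close> equals \<open>v\<close>.\<close>

lemma shift:
  assumes "0 \<le> v n k"
  shows "\<exists>L::nat. \<forall>L'\<ge>L. 0 \<le> v' (n + int L' * (\<sigma> * M)) (k + int L' * (\<sigma> * E))"
proof -
  define D where "D = \<sigma> * (E * M' - M * E')"
  have e: "v' (n + int L' * (\<sigma> * M)) (k + int L' * (\<sigma> * E)) = v' n k + int L' * D" for L'
    unfolding v_add v_mult v_ray D_def ..
  show ?thesis
  proof (cases "D = 0")
    case True
    then have "E * M' = M * E'" using \<sigma> by (auto simp: D_def)
    then have eq: "M' = M" "E' = E" using d0 by auto
    have "v' n k = v n k" unfolding v_def v'_def by (simp only: eq)
    then show ?thesis using e True assms by auto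
  next
    case False
    moreover have "0 \<le> D" unfolding D_def by (rule d)
    ultimately have D: "1 \<le> D" by linarith
    have "0 \<le> v' n k + int L' * D" if "nat \<bar>v' n k\<bar> \<le> L'" for L'
    proof -
      have "int L' * 1 \<le> int L' * D" using D by (intro mult_left_mono) auto
      then show ?thesis using that by linarith
    qed
    then show ?thesis using e by auto
  qed
qed

text \<open>The boundary line of the half plane is spanned by \<open>(M, E)\<close>, and the sign
  \<sigma> selects the half of it that lies in the other half plane. Only degree and order of
  \<open>r0\<close> matter, not the choice.\<close>

definition r0 :: 'k where "r0 = (SOME x. x \<noteq> 0 \<and> oa x = \<sigma> * E \<and> x \<in> C (\<sigma> * M))"

lemma r0: "r0 \<noteq> 0" "oa r0 = \<sigma> * E" "r0 \<in> C (\<sigma> * M)"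
  unfolding r0_def using someI_ex[OF C_ex[of "\<sigma> * M" "\<sigma> * E"]] v_ray d by auto

definition ray :: "int \<Rightarrow>\<^sub>0 'k" where "ray = S (\<sigma> * M) r0"

lemma ray: "ray \<in> A" by (simp add: ray_def A_single r0)

definition t :: 'k where "t = (SOME x. x \<in> a \<and> x \<noteq> 0 \<and> oa x = 1)"

lemma t: "t \<in> a" "t \<noteq> 0" "oa t = 1" "t \<in> A\<^sub>0"
proof -
  have "\<exists>x. x \<in> a \<and> x \<noteq> 0 \<and> oa x = 1" using uniformizer_with_bound[OF a] by metis
  from someI_ex[OF this] show "t \<in> a" "t \<noteq> 0" "oa t = 1" by (auto simp: t_def)
  then show "t \<in> A\<^sub>0" using ai(1)[OF a] by auto
qed

text \<open>With \<open>q * E + 1 = M * k\<close> the point \<open>(q, k)\<close> has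
  \<open>v = 1\<close>. It may lie outside the other half plane; \<open>shift\<close> moves it into
  the cone while its degree changes by a multiple of \<open>M\<close>.\<close>

lemma transversal_ex: "\<exists>p. snd p \<noteq> 0 \<and> snd p \<in> C (fst p) \<and> v (fst p) (oa (snd p)) = 1"
proof -
  obtain k where k: "q * E + 1 = M * k" using q(3) by (auto elim: dvdE)
  have v1: "v q k = 1" using k by (simp add: v_def algebra_simps)
  obtain L :: nat where L: "0 \<le> v' (q + int L * (\<sigma> * M)) (k + int L * (\<sigma> * E))"
    using shift[of q k] v1 by auto
  have "v (q + int L * (\<sigma> * M)) (k + int L * (\<sigma> * E)) = 1" unfolding v_add v_mult v_ray v1 by simp
  then obtain x where "x \<noteq> 0" "oa x = k + int L * (\<sigma> * E)" "x \<in> C (q + int L * (\<sigma> * M))"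
      "v (q + int L * (\<sigma> * M)) (oa x) = 1"
    using C_ex[of "q + int L * (\<sigma> * M)" "k + int L * (\<sigma> * E)"] L by auto
  then show ?thesis by (intro exI[of _ "(q + int L * (\<sigma> * M), x)"]) simp
qed

definition n1 :: int where "n1 = fst (SOME p. snd p \<noteq> 0 \<and> snd p \<in> C (fst p) \<and> v (fst p) (oa (snd p)) = 1)"
definition y0 :: 'k where "y0 = snd (SOME p. snd p \<noteq> 0 \<and> snd p \<in> C (fst p) \<and> v (fst p) (oa (snd p)) = 1)"
definition Y :: "int \<Rightarrow>\<^sub>0 'k" where "Y = S n1 y0"

lemma y0: "y0 \<noteq> 0" "y0 \<in> C n1" "v n1 (oa y0) = 1"
  using someI_ex[OF transversal_ex] by (simp_all add: n1_def y0_def)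

lemma Y: "Y \<in> A" "Y \<noteq> 0" using y0 by (auto simp: Y_def A_single single_eq_0_iff)

text \<open>Divisibility of homogeneous elements is decided by exponents: if their difference lies
  in the cone, a quotient with that exponent exists, and \<open>same_ord\<close> corrects it by
  factors that do not vanish at \<open>a\<close>.\<close>

lemma local_division:
  assumes "x \<in> C n" "y \<in> C m" "x \<noteq> 0" "y \<noteq> 0"
    and "0 \<le> v (n - m) (oa x - oa y)" "0 \<le> v' (n - m) (oa x - oa y)"
  obtains s g where "s \<in> A\<^sub>0 - a" "g \<in> C (n - m)" "s * x = y * g"
proof -
  obtain g where g: "g \<noteq> 0" "oa g = oa x - oa y" "g \<in> C (n - m)" using C_ex[OF assms(5,6)] by blast
  have "oa x = oa (y * g)" using ord_mult[OF a assms(4) g(1)] g(2) by simp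
  then obtain s s' where s: "s \<in> A\<^sub>0 - a" "s' \<in> A\<^sub>0 - a" "s * x = s' * (y * g)"
    using same_ord[OF a assms(3), of "y * g"] assms(4) g(1) by auto
  show thesis
    by (rule that[OF s(1) C_scale[OF _ g(3), of s']]) (use s in \<open>auto simp: algebra_simps\<close>)
qed

section \<open>The prime of a boundary ray\<close>

definition CN :: "int \<Rightarrow> int \<Rightarrow> 'k set" where
  "CN N n = {x \<in> C n. x = 0 \<or> N \<le> v n (oa x)}"

text \<open>The elements of valuation at least \<open>N\<close>; \<open>N = 0\<close> gives all of
  \<open>A\<close> and \<open>N = 1\<close> the prime of the ray.\<close>

definition PP :: "int \<Rightarrow> (int \<Rightarrow>\<^sub>0 'k) set" where "PP N = gr (CN N)"

definition P :: "(int \<Rightarrow>\<^sub>0 'k) set" where "P = PP 1"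

lemma v_ge_add:
  assumes "x = 0 \<or> N \<le> v n (oa x)" "y = 0 \<or> N \<le> v n (oa y)"
  shows "x + y = 0 \<or> N \<le> v n (oa (x + y))"
proof (cases "x = 0 \<or> y = 0 \<or> x + y = 0")
  case False
  then have "min (oa x) (oa y) \<le> oa (x + y)"
    using vge_add[OF a, of "min (oa x) (oa y)" x y] by (simp add: vge_def)
  then have "oa x * M \<le> oa (x + y) * M \<or> oa y * M \<le> oa (x + y) * M"
    using M by (auto simp: min_def split: if_splits)
  then show ?thesis using assms False by (auto simp: v_def)
qed (use assms in auto)

lemma CN_add: "x \<in> CN N n \<Longrightarrow> y \<in> CN N n \<Longrightarrow> x + y \<in> CN N n"
  using C_add[of x n y] v_ge_add[of x N n y] by (simp add: CN_def)

lemma CN_0 [simp]: "0 \<in> CN N n" by (simp add: CN_def)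

lemma CN_mult: "x \<in> CN N n \<Longrightarrow> y \<in> CN K m \<Longrightarrow> x * y \<in> CN (N + K) (n + m)"
  using C_mult[of x n y m]
  by (cases "x = 0"; cases "y = 0") (auto simp: CN_def ord_mult[OF a] v_add)

lemma PP_0: "PP 0 = A"
  unfolding PP_def A_eq gr_def CN_def using C_v by auto

lemma PP_single: "S n x \<in> PP N \<longleftrightarrow> x \<in> CN N n"
  unfolding PP_def by (rule gr_single) simp

lemma PP_add: "f \<in> PP N \<Longrightarrow> g \<in> PP N \<Longrightarrow> f + g \<in> PP N"
  unfolding PP_def by (rule gr_add) (auto intro: CN_add)

lemma PP_mult: "f \<in> PP N \<Longrightarrow> g \<in> PP K \<Longrightarrow> f * g \<in> PP (N + K)"
  unfolding PP_def by (rule gr_mult[where G = "CN N" and H = "CN K"]) (auto intro: CN_add CN_mult)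

lemma PP_A: "f \<in> PP N \<Longrightarrow> f \<in> A"
  by (auto simp: PP_def A_eq gr_def CN_def)

text \<open>Looking at the lowest degrees in which \<open>v\<close> is minimal shows that \<open>v\<close> is additive.\<close>

lemma PP_mult_exact:
  assumes f: "f \<in> PP i" "f \<notin> PP (i + 1)" and g: "g \<in> PP k" "g \<notin> PP (k + 1)"
  shows "f * g \<notin> PP (i + k + 1)"
proof
  assume fg: "f * g \<in> PP (i + k + 1)"
  have low: "\<exists>n. lookup f n \<noteq> 0 \<and> v n (oa (lookup f n)) = i \<and> (\<forall>m<n. lookup f m \<in> CN (i + 1) m)"
    if f: "f \<in> PP i" "f \<notin> PP (i + 1)" for f i
  proof -
    \<comment> \<open>For \<open>f\<close> in \<open>PP i\<close> these are the degrees where the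
      valuation is exactly \<open>i\<close>.\<close>
    let ?B = "{n. lookup f n \<notin> CN (i + 1) n}"
    have B: "?B \<noteq> {}" "?B \<subseteq> Poly_Mapping.keys f" using f(2) by (auto simp: PP_def gr_def in_keys_iff)
    then have fin: "finite ?B" using finite_keys finite_subset by blast
    define n where "n = Min ?B"
    have n: "lookup f n \<notin> CN (i + 1) n" using Min_in[OF fin B(1)] by (simp add: n_def)
    have less: "lookup f m \<in> CN (i + 1) m" if "m < n" for m
      using Min_le[OF fin, of m] that by (force simp: n_def)
    have "lookup f n \<in> CN i n" using f(1) by (simp add: PP_def gr_def)
    then have "lookup f n \<noteq> 0 \<and> v n (oa (lookup f n)) = i" using n by (auto simp: CN_def)
    then show ?thesis using less by blast
  qed
  obtain n where n: "lookup f n \<noteq> 0" "v n (oa (lookup f n)) = i" "\<And>l. l < n \<Longrightarrow> lookup f l \<in> CN (i + 1) l"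
    using low[OF f] by blast
  obtain m where m: "lookup g m \<noteq> 0" "v m (oa (lookup g m)) = k" "\<And>l. l < m \<Longrightarrow> lookup g l \<in> CN (k + 1) l"
    using low[OF g] by blast
  let ?K = "Poly_Mapping.keys f - {n}"
  have "n \<in> Poly_Mapping.keys f" using n(1) by (simp add: in_keys_iff)
  \<comment> \<open>In every other term of this coefficient one factor has degree below its minimum,
    hence excess valuation, so these terms cannot cancel the leading product.\<close>
  then have e: "lookup (f * g) (n + m) = lookup f n * lookup g m + (\<Sum>l\<in>?K. lookup f l * lookup g (n + m - l))"
    unfolding lookup_times_int by (subst sum.remove[of _ n]) auto
  have s: "(\<And>l. l \<in> I \<Longrightarrow> F l \<in> CN (i + k + 1) (n + m)) \<Longrightarrow> sum F I \<in> CN (i + k + 1) (n + m)" for F and I :: "int set"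
    by (induction I rule: infinite_finite_induct) (auto intro: CN_add)
  have rest: "(\<Sum>l\<in>?K. lookup f l * lookup g (n + m - l)) \<in> CN (i + k + 1) (n + m)"
  proof (rule s)
    fix l assume l: "l \<in> ?K"
    have fl: "lookup f l \<in> CN i l" and gl: "lookup g (n + m - l) \<in> CN k (n + m - l)"
      using f(1) g(1) by (auto simp: PP_def gr_def)
    show "lookup f l * lookup g (n + m - l) \<in> CN (i + k + 1) (n + m)"
    proof (cases "l < n")
      case True
      from CN_mult[OF n(3)[OF this] gl] show ?thesis by (simp add: algebra_simps)
    next
      case False
      then have "n + m - l < m" using l by auto
      from CN_mult[OF fl m(3)[OF this]] show ?thesis by (simp add: algebra_simps)
    qed
  qed
  have neg: "- x \<in> CN N l" if "x \<in> CN N l" for x N l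
    using that C_minus by (auto simp: CN_def ord_uminus[OF a])
  have "lookup (f * g) (n + m) \<in> CN (i + k + 1) (n + m)" using fg by (simp add: PP_def gr_def)
  from CN_add[OF this neg[OF rest]] have "lookup f n * lookup g m \<in> CN (i + k + 1) (n + m)"
    unfolding e by simp
  then show False using n(1,2) m(1,2) by (simp add: CN_def ord_mult[OF a] v_add)
qed

lemma P_ideal: "ideal P (subr A)"
  unfolding ideal_subr_iff[OF A_ring]
proof (intro conjI ballI)
  show "P \<subseteq> A" using PP_A by (auto simp: P_def)
  show "0 \<in> P" by (auto simp: P_def PP_def gr_def)
  show "f + g \<in> P" if "f \<in> P" "g \<in> P" for f g using that PP_add by (simp add: P_def)
  show "f * g \<in> P" if "f \<in> A" "g \<in> P" for f g using that PP_mult[of f 0 g 1] by (simp add: P_def PP_0)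
qed

lemmas Pi = idealD[OF A_ring P_ideal]

lemma single_P: "S n x \<in> P \<longleftrightarrow> x \<in> C n \<and> (x = 0 \<or> 1 \<le> v n (oa x))"
  by (auto simp: P_def PP_single CN_def)

lemma const_P: "x \<in> A\<^sub>0 \<Longrightarrow> const x \<in> P \<longleftrightarrow> x \<in> a"
proof -
  assume x: "x \<in> A\<^sub>0"
  have "1 \<le> oa x * M \<longleftrightarrow> 0 < oa x"
    using M zero_less_mult_iff[of "oa x" M] by linarith
  then show ?thesis
    using x ord_pos_iff[OF a x] ai(2)[OF a] by (auto simp: const_def single_P C0_eq v_0)
qed

lemma P_prime: "primeideal P (subr A)"
  unfolding primeideal_subr_iff[OF A_ring]
proof (intro conjI ballI impI P_ideal)
  show "1 \<notin> P" using const_P[of 1] s0(2) ap(2)[OF a] by (simp add: const_simps)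
  fix f g assume fg: "f \<in> A" "g \<in> A" "f * g \<in> P"
  then show "f \<in> P \<or> g \<in> P" using PP_mult_exact[of f 0 g 0] by (auto simp: P_def PP_0)
qed

lemmas Pp = primeD[OF A_ring P_prime]

lemma ray_P: "ray \<notin> P" using r0 by (simp add: ray_def single_P v_ray)

lemma Y_P: "Y \<in> P" using y0 by (simp add: Y_def single_P)

lemma scaled_ray: "s \<in> A\<^sub>0 - a \<Longrightarrow> const s * ray ^ L \<in> A - P"
  using Pp(4)[of "const s" "ray ^ L"] Pp(6)[of ray L] const_P[of s] A_const[of s] ray ray_P by auto

text \<open>The valuation of \<open>Y ^ N\<close> is \<open>N\<close>, so subtracting its exponent
  keeps \<open>v\<close> nonnegative; the power of \<open>ray\<close> restores
  \<open>v'\<close>.\<close>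

lemma homogeneous_division:
  assumes x: "x \<in> CN (int N) n" and nz: "x \<noteq> 0"
  shows "\<exists>s\<in>A\<^sub>0 - a. \<exists>L. \<exists>g\<in>A. (const s * ray ^ L) * S n x = g * Y ^ N"
proof -
  have xC: "x \<in> C n" "int N \<le> v n (oa x)" using x nz by (auto simp: CN_def)
  define m where "m = int N * n1"
  have yN: "y0 ^ N \<in> C m" "y0 ^ N \<noteq> 0" "oa (y0 ^ N) = int N * oa y0"
    using C_power[OF y0(2)] y0(1) ord_power[OF a y0(1)] by (auto simp: m_def)
  have vy: "v m (oa (y0 ^ N)) = int N" unfolding yN(3) m_def v_mult y0(3) by simp
  obtain L :: nat where L: "0 \<le> v' ((n - m) + int L * (\<sigma> * M)) ((oa x - oa (y0 ^ N)) + int L * (\<sigma> * E))"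
    using shift[of "n - m" "oa x - oa (y0 ^ N)"] xC(2) unfolding v_diff vy by auto
  define x' where "x' = r0 ^ L * x"
  have x': "x' \<in> C (n + int L * (\<sigma> * M))" "x' \<noteq> 0" "oa x' = oa x + int L * (\<sigma> * E)"
    using C_mult[OF C_power[OF r0(3), of L] xC(1)] nz r0(1) ord_mult[OF a, of "r0 ^ L" x] ord_power[OF a r0(1), of L] r0(2)
    by (auto simp: x'_def algebra_simps)
  have e1: "n + int L * (\<sigma> * M) - m = (n - m) + int L * (\<sigma> * M)"
    and e2: "oa x' - oa (y0 ^ N) = (oa x - oa (y0 ^ N)) + int L * (\<sigma> * E)" unfolding x'(3) by simp_all
  obtain s g where s: "s \<in> A\<^sub>0 - a" "g \<in> C (n + int L * (\<sigma> * M) - m)" "s * x' = y0 ^ N * g"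
  proof (rule local_division[OF x'(1) yN(1) x'(2) yN(2)])
    show "0 \<le> v (n + int L * (\<sigma> * M) - m) (oa x' - oa (y0 ^ N))"
      unfolding e1 e2 v_add v_mult v_ray v_diff vy using xC(2) by simp
    show "0 \<le> v' (n + int L * (\<sigma> * M) - m) (oa x' - oa (y0 ^ N))"
      unfolding e1 e2 by (rule L)
  qed
  have "(const s * ray ^ L) * S n x = S (int L * (\<sigma> * M) + n) (s * x')"
    by (simp add: const_def ray_def single_power mult_single x'_def algebra_simps)
  also have "\<dots> = S (n + int L * (\<sigma> * M) - m) g * Y ^ N"
    unfolding s(3) by (simp add: Y_def single_power mult_single m_def algebra_simps)
  finally have "(const s * ray ^ L) * S n x = S (n + int L * (\<sigma> * M) - m) g * Y ^ N" .
  moreover have "S (n + int L * (\<sigma> * M) - m) g \<in> A" using s(2) by (simp add: A_single)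
  ultimately show ?thesis using s(1) by blast
qed

lemma divide_by_transversal:
  assumes g: "g \<in> PP (int N)"
  shows "\<exists>s\<in>A - P. \<exists>b\<in>A. s * g = b * Y ^ N"
proof -
  let ?J = "\<lambda>g. \<exists>s\<in>A - P. \<exists>b\<in>A. s * g = b * Y ^ N"
  have add: "?J (f + g)" if fg: "?J f" "?J g" for f g
  proof -
    obtain s b where s: "s \<in> A - P" "b \<in> A" "s * f = b * Y ^ N" using fg by blast
    obtain r c where r: "r \<in> A - P" "c \<in> A" "r * g = c * Y ^ N" using fg by blast
    have "(s * r) * (f + g) = r * (s * f) + s * (r * g)" by (simp add: algebra_simps)
    also have "\<dots> = (r * b + s * c) * Y ^ N" unfolding s(3) r(3) by (simp add: algebra_simps)
    finally have e: "(s * r) * (f + g) = (r * b + s * c) * Y ^ N" .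
    have "r * b + s * c \<in> A" using s(1,2) r(1,2) by (intro sA(6) sA(4)) auto
    then show ?thesis using e Pp(4)[OF s(1) r(1)] by (intro bexI)
  qed
  have zero: "?J 0" using sA(1) Pp(5) by (intro bexI[of _ 1] bexI[of _ 0]) auto
  have hom: "?J (S n x)" if x: "x \<in> CN (int N) n" for n x
  proof (cases "x = 0")
    case True
    then show ?thesis using zero by simp
  next
    case False
    then show ?thesis using homogeneous_division[OF x] scaled_ray by blast
  qed
  have "?J (\<Sum>n\<in>I. S n (lookup g n))" for I
  proof (induction I rule: infinite_finite_induct)
    case (insert n I)
    have "?J (S n (lookup g n))" by (rule hom) (use g in \<open>simp add: PP_def gr_def\<close>)
    then show ?case using insert add by simp
  qed (use zero in auto)
  then show ?thesis using sum_single_lookup[of g] by metis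
qed

lemma Y_power: "Y ^ N \<in> PP (int N)"
proof -
  have "y0 ^ N \<in> C (int N * n1)" by (rule C_power[OF y0(2)])
  moreover have "v (int N * n1) (oa (y0 ^ N)) = int N"
    unfolding ord_power[OF a y0(1)] v_mult y0(3) by simp
  ultimately show ?thesis by (simp add: Y_def single_power PP_single CN_def)
qed

text \<open>If the cofactor \<open>b\<close> lay in \<open>P\<close>, the product
  \<open>b * Y ^ N\<close> would have valuation above \<open>N\<close>, while multiplying
  \<open>g\<close> by an element outside \<open>P\<close> leaves its valuation exactly
  \<open>N\<close>.\<close>

lemma exact_order:
  assumes g: "g \<in> PP (int N)" "g \<notin> PP (int N + 1)"
  shows "fraction_order A P Y g N"
proof -
  obtain s b where s: "s \<in> A - P" "b \<in> A" "s * g = b * Y ^ N" using divide_by_transversal[OF g(1)] by blast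
  have "b \<notin> P"
  proof
    assume "b \<in> P"
    then have "b * Y ^ N \<in> PP (1 + int N)" unfolding P_def by (rule PP_mult[OF _ Y_power])
    moreover have "s * g \<notin> PP (0 + int N + 1)"
      by (rule PP_mult_exact[OF _ _ g]) (use s(1) in \<open>auto simp: PP_0 P_def\<close>)
    ultimately show False using s(3) by (simp add: add.commute)
  qed
  then show ?thesis unfolding fraction_order_def using s by blast
qed

text \<open>The exponent belonging to \<open>g\<close> is the least valuation among its homogeneous
  components.\<close>

lemma unif_P: "unif A P Y"
  unfolding unif_def
proof (intro conjI ballI impI A_ring P_prime Y_P Y(2))
  fix g assume g: "g \<in> A" "g \<noteq> 0"
  have keys: "Poly_Mapping.keys g \<noteq> {}" using g(2) by simp
  define V where "V = (\<lambda>n. v n (oa (lookup g n))) ` Poly_Mapping.keys g"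
  have V: "finite V" "V \<noteq> {}" using keys by (auto simp: V_def)
  define N where "N = nat (Min V)"
  have "0 \<le> x" if "x \<in> V" for x
    using that C_v[OF A_lookup[OF g(1)]] by (auto simp: V_def in_keys_iff)
  then have N: "int N = Min V" using Min_in[OF V] by (simp add: N_def)
  have "g \<in> PP (int N)"
    unfolding PP_def gr_def CN_def mem_Collect_eq
  proof (intro allI conjI A_lookup[OF g(1)])
    fix n show "lookup g n = 0 \<or> int N \<le> v n (oa (lookup g n))"
    proof (cases "lookup g n = 0")
      case False
      then have "v n (oa (lookup g n)) \<in> V" by (auto simp: V_def in_keys_iff)
      then show ?thesis using Min_le[OF V(1)] N by simp
    qed simp
  qed
  moreover have "g \<notin> PP (int N + 1)"
  proof
    assume h: "g \<in> PP (int N + 1)"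
    obtain n where n: "n \<in> Poly_Mapping.keys g" "Min V = v n (oa (lookup g n))"
      using Min_in[OF V] by (auto simp: V_def)
    have "lookup g n \<in> CN (int N + 1) n" using h by (simp add: PP_def gr_def)
    then show False using n N by (auto simp: CN_def in_keys_iff)
  qed
  ultimately show "\<exists>n. \<exists>s\<in>A - P. \<exists>s'\<in>A - P. s * g = s' * Y ^ n"
    using exact_order unfolding fraction_order_def by blast
qed

lemma prime_ord_single:
  assumes "x \<in> C n" "x \<noteq> 0"
  shows "int (prime_ord A P (S n x)) = v n (oa x)"
proof -
  define N where "N = nat (v n (oa x))"
  have N: "int N = v n (oa x)" using C_v[OF assms] by (simp add: N_def)
  have "prime_ord A P (S n x) = N"
  proof (rule prime_ord_eq[OF unif_P])
    show "S n x \<in> A" using assms by (simp add: A_single)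
    show "fraction_order A P Y (S n x) N"
      by (rule exact_order) (use assms N in \<open>auto simp: PP_single CN_def\<close>)
  qed
  then show ?thesis using N by simp
qed

text \<open>In degree 0 the valuation is \<open>k * M\<close>, which is the source of the
  multiplicity of the fibre.\<close>

lemma frac_ord_const: assumes "x \<noteq> 0" shows "frac_ord A P (const x) = M * oa x"
proof -
  obtain g h where x: "g \<in> A\<^sub>0" "h \<in> A\<^sub>0" "g \<noteq> 0" "h \<noteq> 0" "x = g / h" using nonzero_frac[OF a assms] by blast
  have "const x * const h = const g" using x by (simp flip: const_simps)
  then have "frac_ord A P (const x) = int (prime_ord A P (const g)) - int (prime_ord A P (const h))"
    by (intro frac_ord_eq[OF unif_P]) (use x in \<open>auto simp: A_const\<close>, auto simp: const_def single_eq_0_iff)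
  also have "\<dots> = M * (oa g - oa h)"
    using prime_ord_single[of g 0] prime_ord_single[of h 0] x
    by (simp add: const_def C0_eq v_0 algebra_simps)
  finally show ?thesis using x ord_divide[OF a x(3,4)] by simp
qed

lemma frac_ord_u: "frac_ord A P u = - E"
proof -
  \<comment> \<open>An order large enough for functions of this order to occur in degrees 0 and
    1.\<close>
  define k where "k = \<bar>E\<bar> + \<bar>E'\<bar>"
  have kE: "E \<le> k" "E' \<le> k" "0 \<le> k" by (simp_all add: k_def)
  have kM: "k * 1 \<le> k * M" "k * 1 \<le> k * M'" using M M' mult_left_mono[of 1 M k] mult_left_mono[of 1 M' k] by (auto simp: k_def)
  have "0 \<le> v 1 k" "0 \<le> v' 1 k" "0 \<le> v 0 k" "0 \<le> v' 0 k"
    using kM kE unfolding v_def v'_def by simp_all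
  then obtain x x' where x: "x \<noteq> 0" "oa x = k" "x \<in> C 0" and x': "x' \<noteq> 0" "oa x' = k" "x' \<in> C 1"
    using C_ex by metis
  \<comment> \<open>The functions for the two degrees were chosen independently. Making them equal
    up to units yields one \<open>w\<close> for both degrees, so that \<open>u\<close> is the
    quotient of \<open>S 1 w\<close> by \<open>S 0 w\<close>.\<close>
  obtain s s' where s: "s \<in> A\<^sub>0 - a" "s' \<in> A\<^sub>0 - a" "s * x = s' * x'" using same_ord[OF a x(1) x'(1)] x x' by auto
  define w where "w = s * x"
  have w: "w \<in> C 0" "w \<in> C 1" "w \<noteq> 0" "oa w = k"
    using s x x' C_scale[of s x 0] C_scale[of s' x' 1] nonzero_if_notin[OF a s(1)] ord_mult[OF a _ x(1), of s] ord_0_if_notin[OF a s(1)]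
    by (auto simp: w_def)
  have "u * S 0 w = S 1 w" by (simp add: u_def mult_single)
  then have "frac_ord A P u = int (prime_ord A P (S 1 w)) - int (prime_ord A P (S 0 w))"
    by (intro frac_ord_eq[OF unif_P]) (use w in \<open>auto simp: A_single single_eq_0_iff\<close>)
  also have "\<dots> = - E" using w by (simp add: prime_ord_single) (simp add: v_def)
  finally show ?thesis .
qed

section \<open>Points of the fibre\<close>

text \<open>Stated for primes, not just maximal ideals, because it is also applied to vanishing
  ideals of prime divisors contained in the fibre.\<close>

definition above :: "(int \<Rightarrow>\<^sub>0 'k) set \<Rightarrow> bool" where
  "above Q \<longleftrightarrow> primeideal Q (subr A) \<and> proj A\<^sub>0 Q = a"

lemma above_const: "above Q \<Longrightarrow> x \<in> A\<^sub>0 \<Longrightarrow> const x \<in> Q \<longleftrightarrow> x \<in> a"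
  by (auto simp: above_def proj_def)

lemma above_not_const: "above Q \<Longrightarrow> s \<in> A\<^sub>0 - a \<Longrightarrow> const s \<in> A - Q"
  using above_const[of Q s] by (auto simp: A_const)

lemma above_sum:
  assumes "above Q" "f \<in> A" "\<And>n. lookup f n \<noteq> 0 \<Longrightarrow> S n (lookup f n) \<in> Q"
  shows "f \<in> Q"
proof -
  have "ideal Q (subr A)" using assms(1) primeD(1)[OF A_ring] by (auto simp: above_def)
  then have "(\<Sum>n\<in>Poly_Mapping.keys f. S n (lookup f n)) \<in> Q"
    by (rule ideal_sum[OF A_ring]) (use assms in \<open>auto simp: in_keys_iff\<close>)
  then show ?thesis by (simp add: sum_single_lookup)
qed

text \<open>The \<open>M\<close>-th power has valuation at least \<open>M\<close>, and
  \<open>M\<close> is the valuation of \<open>t\<close>; the power of \<open>ray\<close> takes care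
  of the other half plane.\<close>

lemma power_divisible_by_t:
  assumes "x \<in> C n" "x \<noteq> 0" "1 \<le> v n (oa x)"
  shows "\<exists>L s. s \<in> A\<^sub>0 - a \<and> (\<exists>g\<in>A. const s * (S n x ^ nat M * ray ^ L) = const t * g)"
proof -
  define K where "K = nat M"
  have K: "int K = M" using M by (simp add: K_def)
  have xK: "x ^ K \<in> C (M * n)" "x ^ K \<noteq> 0" "oa (x ^ K) = M * oa x"
    using C_power[OF assms(1), of K] assms(2) ord_power[OF a assms(2), of K] K by auto
  have "M * 1 \<le> M * v n (oa x)" using M assms(3) by (intro mult_left_mono) auto
  then have v0: "0 \<le> v (M * n) (M * oa x - 1)"
    using v_diff(1)[of "M * n" 0 "M * oa x" 1] by (simp add: v_mult v_0)
  obtain L :: nat where L: "0 \<le> v' (M * n + int L * (\<sigma> * M)) (M * oa x - 1 + int L * (\<sigma> * E))"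
    using shift[OF v0] by auto
  define x' where "x' = x ^ K * r0 ^ L"
  have x': "x' \<in> C (M * n + int L * (\<sigma> * M))" "x' \<noteq> 0" "oa x' = M * oa x + int L * (\<sigma> * E)"
    using C_mult[OF xK(1) C_power[OF r0(3), of L]] xK(2,3) r0(1,2) ord_mult[OF a xK(2), of "r0 ^ L"] ord_power[OF a r0(1), of L]
    by (auto simp: x'_def)
  have e: "oa x' - oa t = M * oa x - 1 + int L * (\<sigma> * E)" unfolding x'(3) t(3) by simp
  obtain s g where s: "s \<in> A\<^sub>0 - a" "g \<in> C (M * n + int L * (\<sigma> * M) - 0)" "s * x' = t * g"
  proof (rule local_division[OF x'(1) _ x'(2) t(2)])
    show "t \<in> C 0" by (simp add: C0_eq t(4))
    show "0 \<le> v (M * n + int L * (\<sigma> * M) - 0) (oa x' - oa t)"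
      unfolding e diff_0_right v_add v_mult v_ray using v0 by simp
    show "0 \<le> v' (M * n + int L * (\<sigma> * M) - 0) (oa x' - oa t)"
      unfolding e diff_0_right by (rule L)
  qed
  have "const s * (S n x ^ K * ray ^ L) = S (M * n + int L * (\<sigma> * M)) (s * x')"
    by (simp add: const_def ray_def single_power mult_single x'_def K algebra_simps)
  also have "\<dots> = const t * S (M * n + int L * (\<sigma> * M)) g" unfolding s(3) by (simp add: const_def mult_single)
  finally show ?thesis using s(1,2) unfolding K_def by (intro exI conjI bexI[of _ "S (M * n + int L * (\<sigma> * M)) g"]) (auto simp: A_single)
qed

text \<open>\<open>Q\<close> contains \<open>t\<close>, hence for each homogeneous component of
  positive valuation a product of one of its powers with factors outside \<open>Q\<close>.\<close>

lemma P_subset_above: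
  assumes Q: "above Q" "ray \<notin> Q"
  shows "P \<subseteq> Q"
proof
  note Qp = primeD[OF A_ring] and QP = Q(1)[unfolded above_def, THEN conjunct1]
  fix f assume f: "f \<in> P"
  show "f \<in> Q"
  proof (rule above_sum[OF Q(1) Pi(1)[OF f]])
    fix n assume nz: "lookup f n \<noteq> 0"
    have x: "lookup f n \<in> C n" "1 \<le> v n (oa (lookup f n))"
      using f nz by (auto simp: P_def PP_def gr_def CN_def dest: spec[of _ n])
    obtain L s g where s: "s \<in> A\<^sub>0 - a" "g \<in> A" "const s * (S n (lookup f n) ^ nat M * ray ^ L) = const t * g"
      using power_divisible_by_t[OF x(1) nz x(2)] by blast
    have "const t * g \<in> Q"
      using idealD(5)[OF A_ring Qp(1)[OF QP] s(2)] above_const[OF Q(1) t(4)] t(1) by blast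
    then have m: "const s * (S n (lookup f n) ^ nat M * ray ^ L) \<in> Q" using s(3) by simp
    show "S n (lookup f n) \<in> Q"
    proof (rule ccontr)
      assume "S n (lookup f n) \<notin> Q"
      then have "S n (lookup f n) \<in> A - Q" using x(1) by (simp add: A_single)
      then have "S n (lookup f n) ^ nat M * ray ^ L \<in> A - Q"
        using Qp(4)[OF QP Qp(6)[OF QP] Qp(6)[OF QP]] ray Q(2) by blast
      then show False using m Qp(4)[OF QP above_not_const[OF Q(1) s(1)]] by blast
    qed
  qed
qed

text \<open>Put \<open>l = \<sigma> * n\<close>. Dividing \<open>x ^ M\<close> by
  \<open>r0 ^ l\<close> gives degree 0 and order \<open>v n (oa x)\<close>, which is nonnegative; so
  a power of \<open>S n x\<close> is a multiple of \<open>ray\<close> up to a factor outside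
  \<open>Q\<close>.\<close>

lemma degree_sign_above:
  assumes Q: "above Q" "ray \<in> Q" and x: "x \<in> C n" and n: "0 < \<sigma> * n"
  shows "S n x \<in> Q"
proof (cases "x = 0")
  case True
  then show ?thesis using Q(1) idealD(2)[OF A_ring] primeD(1)[OF A_ring] by (auto simp: above_def)
next
  case False
  note Qp = primeD[OF A_ring] and QP = Q(1)[unfolded above_def, THEN conjunct1]
  define K where "K = nat M"
  define l where "l = nat (\<sigma> * n)"
  have K: "int K = M" and l: "int l = \<sigma> * n" "l \<noteq> 0" using M n by (auto simp: K_def l_def)
  have l\<sigma>: "int l * (\<sigma> * c) = n * c" for c unfolding l using \<sigma>\<sigma> by (simp add: algebra_simps)
  have xK: "x ^ K \<in> C (M * n)" "x ^ K \<noteq> 0" "oa (x ^ K) = M * oa x"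
    using C_power[OF x, of K] False ord_power[OF a False, of K] K by auto
  have rl: "r0 ^ l \<in> C (n * M)" "r0 ^ l \<noteq> 0" "oa (r0 ^ l) = n * E"
    using C_power[OF r0(3), of l] r0(1,2) ord_power[OF a r0(1), of l] l\<sigma> by auto
  have e: "oa (x ^ K) - oa (r0 ^ l) = v n (oa x)" unfolding xK(3) rl(3) by (simp add: v_def algebra_simps)
  have e0: "M * n - n * M = 0" by simp
  obtain s g where s: "s \<in> A\<^sub>0 - a" "g \<in> C (M * n - n * M)" "s * x ^ K = r0 ^ l * g"
  proof (rule local_division[OF xK(1) rl(1) xK(2) rl(2)])
    show "0 \<le> v (M * n - n * M) (oa (x ^ K) - oa (r0 ^ l))" "0 \<le> v' (M * n - n * M) (oa (x ^ K) - oa (r0 ^ l))"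
      unfolding e e0 v_0 using C_v[OF x False] M M' by auto
  qed
  have rl0: "ray ^ l = S (n * M) (r0 ^ l)" by (simp add: ray_def single_power l\<sigma>)
  have "const s * S n x ^ K = S (M * n) (s * x ^ K)"
    by (simp add: const_def single_power mult_single K)
  also have "\<dots> = ray ^ l * const g" unfolding s(3) rl0 by (simp add: const_def mult_single mult.commute[of n])
  also have "\<dots> = ray * (ray ^ (l - 1) * const g)" using l(2) by (cases l) (auto simp: algebra_simps)
  also have "\<dots> \<in> Q"
    by (rule idealD(5)[OF A_ring Qp(1)[OF QP] _ Q(2)])
      (use s(2) ray in \<open>auto intro!: sA(4) sA(7) simp: A_const C0_eq\<close>)
  finally have m: "const s * S n x ^ K \<in> Q" .
  show ?thesis
  proof (rule ccontr)
    assume "S n x \<notin> Q"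
    then have "S n x ^ K \<in> A - Q" using Qp(6)[OF QP, of "S n x" K] x by (simp add: A_single)
    then show False using m Qp(4)[OF QP above_not_const[OF Q(1) s(1)]] by blast
  qed
qed

text \<open>When the half planes coincide, the cone contains the opposite ray as well. A function
  with that exponent inverts \<open>ray\<close> up to a function that does not vanish at
  \<open>a\<close>.\<close>

lemma ray_unit_above:
  assumes Q: "above Q" and eq: "E * M' = M * E'"
  shows "ray \<notin> Q"
proof
  assume r: "ray \<in> Q"
  note Qp = primeD[OF A_ring] and QP = Q(1)[unfolded above_def, THEN conjunct1]
  have "v (- (\<sigma> * M)) (- (\<sigma> * E)) = 0" "v' (- (\<sigma> * M)) (- (\<sigma> * E)) = 0"
    using eq by (auto simp: v_def v'_def algebra_simps)
  then obtain x where x: "x \<noteq> 0" "oa x = - (\<sigma> * E)" "x \<in> C (- (\<sigma> * M))"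
    using C_ex[of "- (\<sigma> * M)" "- (\<sigma> * E)"] by auto
  have "r0 * x \<in> A\<^sub>0" using C_mult[OF r0(3) x(3)] by (simp add: C0_eq)
  moreover have "oa (r0 * x) = 0" using ord_mult[OF a r0(1) x(1)] r0(2) x(2) by simp
  ultimately have "r0 * x \<in> A\<^sub>0 - a" using ord_pos_iff[OF a, of "r0 * x"] r0(1) x(1) by auto
  moreover have "ray * S (- (\<sigma> * M)) x = const (r0 * x)" by (simp add: ray_def const_def mult_single)
  moreover have "ray * S (- (\<sigma> * M)) x \<in> Q"
    by (rule idealD(5)[OF A_ring Qp(1)[OF QP] _ r]) (simp add: A_single x)
  ultimately show False using above_not_const[OF Q] by auto
qed

end

text \<open>Multiplied by a power \<open>x ^ B\<close> that clears the negative exponents, the sum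
  becomes a polynomial with infinitely many zeros.\<close>

lemma laurent_coeffs_zero:
  fixes c :: "int \<Rightarrow> complex"
  assumes K: "finite K" and z: "\<And>x. x \<noteq> 0 \<Longrightarrow> (\<Sum>n\<in>K. c n * x powi n) = 0" and n: "n \<in> K"
  shows "c n = 0"
proof -
  obtain B :: nat where B: "\<And>m. m \<in> K \<Longrightarrow> 0 \<le> m + int B"
  proof -
    have "\<forall>m\<in>K. 0 \<le> m + int (\<Sum>m\<in>K. nat \<bar>m\<bar>)"
    proof
      fix m assume "m \<in> K"
      then have "nat \<bar>m\<bar> \<le> (\<Sum>m\<in>K. nat \<bar>m\<bar>)" using K by (intro member_le_sum) auto
      then show "0 \<le> m + int (\<Sum>m\<in>K. nat \<bar>m\<bar>)" by linarith
    qed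
    then show ?thesis using that by blast
  qed
  define p where "p = (\<Sum>m\<in>K. monom (c m) (nat (m + int B)))"
  have "poly p x = 0" if x: "x \<noteq> 0" for x
  proof -
    have "poly p x = (\<Sum>m\<in>K. c m * x powi m * x ^ B)"
      unfolding p_def poly_sum poly_monom
    proof (rule sum.cong[OF refl])
      fix m assume "m \<in> K"
      then have "x ^ nat (m + int B) = x powi (m + int B)" using B by (simp add: power_int_def)
      also have "\<dots> = x powi m * x ^ B" using x by (simp add: power_int_add)
      finally show "c m * x ^ nat (m + int B) = c m * x powi m * x ^ B" by simp
    qed
    also have "\<dots> = 0" using z[OF x] by (simp flip: sum_distrib_right)
    finally show ?thesis .
  qed
  then have "- {0} \<subseteq> {x. poly p x = 0}" by auto
  moreover have "infinite (- {0 :: complex})" by (simp add: infinite_UNIV_char_0 Compl_eq_Diff_UNIV)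
  ultimately have "p = 0" using poly_roots_finite[of p] finite_subset by blast
  then have "coeff p (nat (n + int B)) = 0" by simp
  also have "coeff p (nat (n + int B)) = (\<Sum>m\<in>K. if m = n then c n else 0)"
    unfolding p_def coeff_sum by (rule sum.cong) (use B n in \<open>force simp: nat_eq_iff\<close>)+
  finally show ?thesis using K n by simp
qed

section \<open>Evaluation at the points of the orbit\<close>

context face begin

text \<open>
  Expanding at \<open>a\<close> in powers of \<open>t\<close> and substituting \<open>t = y\<^sup>M\<close>, \<open>u = \<kappa> y\<^sup>-\<^sup>E\<close> maps \<open>A\<close> to
  power series in \<open>y\<close>.  The functions \<open>h\<close> here and \<open>psi\<close> below are the contributions of a
  homogeneous element to the coefficients of \<open>y\<^sup>0\<close> and \<open>y\<^sup>1\<close>.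
\<close>

definition h :: "int \<Rightarrow> 'k \<Rightarrow> complex" where
  "h n x = (if M dvd n then R a (x * t powi (- (n * E div M))) else 0)"

lemma v_zero: "v n k = 0 \<Longrightarrow> M dvd n"
  using coprime by (metis v_def coprime_commute coprime_dvd_mult_left_iff dvd_triv_right eq_iff_diff_eq_0)

lemma ord_shift: "x \<noteq> 0 \<Longrightarrow> oa (x * t powi k) = oa x + k"
  using t by (simp add: ord_mult[OF a] ord_powi[OF a])

lemma h_vge:
  assumes "x \<in> C n" "M dvd n"
  shows "vge a 0 (x * t powi (- (n * E div M)))"
proof (cases "x = 0")
  case False
  obtain j where j: "n = M * j" using assms(2) by blast
  have "0 \<le> v n (oa x)" by (rule C_v[OF assms(1) False])
  then have "0 \<le> (oa x - j * E) * M" unfolding v_def j by (simp add: algebra_simps)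
  then have "0 \<le> oa x - j * E" using M by (simp add: zero_le_mult_iff)
  moreover have "n * E div M = j * E" using M unfolding j by (simp add: mult.assoc)
  ultimately show ?thesis using ord_shift[OF False] by (simp add: vge_def)
qed (simp add: vge_def)

text \<open>A coefficient of \<open>y\<close> to the power 0 requires \<open>v = 0\<close>, and
  coprimality of \<open>E\<close> and \<open>M\<close> allows this only in degrees divisible by
  \<open>M\<close>.\<close>

lemma h_zero_iff:
  assumes "x \<in> C n"
  shows "h n x = 0 \<longleftrightarrow> x = 0 \<or> 1 \<le> v n (oa x)"
proof (cases "x = 0")
  case True
  then show ?thesis by (simp add: h_def R_0[OF a])
next
  case False
  have v: "0 \<le> v n (oa x)" by (rule C_v[OF assms False])
  show ?thesis
  proof (cases "M dvd n")
    case True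
    then obtain j where j: "n = M * j" by blast
    have e: "n * E div M = j * E" using M unfolding j by (simp add: mult.assoc)
    have "h n x = 0 \<longleftrightarrow> vge a 1 (x * t powi (- (n * E div M)))"
      unfolding h_def using True R_0_iff[OF a h_vge[OF assms True]] by simp
    also have "\<dots> \<longleftrightarrow> 0 < oa x - j * E" using False t unfolding vge_def ord_shift[OF False] e by auto
    also have "\<dots> \<longleftrightarrow> 0 < (oa x - j * E) * M" using M by (simp add: zero_less_mult_iff)
    also have "\<dots> \<longleftrightarrow> 1 \<le> v n (oa x)" unfolding v_def j by (simp add: algebra_simps) linarith
    finally show ?thesis using False by simp
  next
    case nd: False
    then have "v n (oa x) \<noteq> 0" using v_zero by blast
    then show ?thesis using v nd by (auto simp: h_def)
  qed
qed

lemma h_add: "x \<in> C n \<Longrightarrow> y \<in> C n \<Longrightarrow> h n (x + y) = h n x + h n y"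
  unfolding h_def using R_add[OF a h_vge h_vge] by (auto simp: distrib_right)

lemma h_mult:
  assumes "x \<in> C n" "y \<in> C m"
  shows "h (n + m) (x * y) = h n x * h m y"
proof (cases "M dvd n \<and> M dvd m")
  case True
  then obtain i j where ij: "n = M * i" "m = M * j" by blast
  have e: "n * E div M = i * E" "m * E div M = j * E" "(n + m) * E div M = i * E + j * E"
    using M unfolding ij by (simp_all add: mult.assoc flip: distrib_left distrib_right)
  have "x * y * t powi (- (i * E + j * E)) = (x * t powi (- (i * E))) * (y * t powi (- (j * E)))"
    using t(2) power_int_add[of t "- (i * E)" "- (j * E)"] by simp
  then have "R a (x * y * t powi (- (i * E + j * E))) = R a (x * t powi (- (i * E))) * R a (y * t powi (- (j * E)))"
    using R_mult[OF a h_vge[OF assms(1)] h_vge[OF assms(2)]] True e by (simp only:)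
  then show ?thesis unfolding h_def using True e by (simp only: dvd_add if_True)
next
  case False
  then have "h n x * h m y = 0" by (auto simp: h_def)
  moreover have "h (n + m) (x * y) = 0"
  proof (cases "x = 0 \<or> y = 0")
    case True
    then show ?thesis by (auto simp: h_def R_0[OF a])
  next
    case nz: False
    \<comment> \<open>If \<open>M\<close> fails to divide one of the degrees, that factor has
      positive valuation, so the product has no constant coefficient even when \<open>M\<close>
      divides the sum of the degrees.\<close>
    have "0 \<le> v n (oa x)" "0 \<le> v m (oa y)" using C_v assms nz by auto
    moreover have "v n (oa x) \<noteq> 0 \<or> v m (oa y) \<noteq> 0" using v_zero False by blast
    moreover have "v (n + m) (oa (x * y)) = v n (oa x) + v m (oa y)"
      using nz by (simp add: ord_mult[OF a] v_add)
    ultimately have "1 \<le> v (n + m) (oa (x * y))" by linarith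
    then show ?thesis using h_zero_iff[OF C_mult[OF assms]] by simp
  qed
  ultimately show ?thesis by simp
qed

lemma h_0: "x \<in> A\<^sub>0 \<Longrightarrow> h 0 x = R a x" by (simp add: h_def)

lemma h_scale: "x \<in> C n \<Longrightarrow> h n (\<iota> c * x) = c * h n x"
  using h_mult[of "\<iota> c" 0 x n] iota_A0[OF a] by (simp add: C0_eq h_0 R_iota[OF a])

definition ev :: "complex \<Rightarrow> (int \<Rightarrow>\<^sub>0 'k) \<Rightarrow> complex" where
  "ev \<kappa> = ext (\<lambda>n x. h n x * \<kappa> powi n)"

lemma ev_functional: "graded_functional C (\<lambda>n x. h n x * \<kappa> powi n)"
  by unfold_locales (auto simp: h_add distrib_right intro: C_add)

lemma ev_add: "f \<in> A \<Longrightarrow> g \<in> A \<Longrightarrow> ev \<kappa> (f + g) = ev \<kappa> f + ev \<kappa> g"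
  unfolding ev_def A_eq by (rule graded_functional.ext_add[OF ev_functional])

lemma ev_single: "ev \<kappa> (S n x) = h n x * \<kappa> powi n"
  unfolding ev_def by (rule graded_functional.ext_single[OF ev_functional])

lemma ev_mult: assumes "\<kappa> \<noteq> 0" "f \<in> A" "g \<in> A" shows "ev \<kappa> (f * g) = ev \<kappa> f * ev \<kappa> g"
proof -
  have "ev \<kappa> (f * g) = (\<Sum>n\<in>Poly_Mapping.keys f. \<Sum>m\<in>Poly_Mapping.keys g.
      h (n + m) (lookup f n * lookup g m) * \<kappa> powi (n + m))"
    unfolding ev_def by (rule graded_functional.ext_times[OF ev_functional C_mult]) (use assms in \<open>auto simp: A_eq\<close>)
  also have "\<dots> = (\<Sum>n\<in>Poly_Mapping.keys f. \<Sum>m\<in>Poly_Mapping.keys g.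
      (h n (lookup f n) * \<kappa> powi n) * (h m (lookup g m) * \<kappa> powi m))"
    using assms(1) h_mult[OF A_lookup[OF assms(2)] A_lookup[OF assms(3)]]
    by (intro sum.cong refl) (simp add: power_int_add)
  also have "\<dots> = ev \<kappa> f * ev \<kappa> g" by (simp add: ev_def ext_def sum_product)
  finally show ?thesis .
qed

lemma ev_const: "x \<in> A\<^sub>0 \<Longrightarrow> ev \<kappa> (const x) = R a x"
  by (simp add: const_def ev_single h_0)

lemma ev_j: "ev \<kappa> (j c) = c"
  by (simp add: j_def ev_const iota_A0[OF a] R_iota[OF a])

lemma ev_power: "\<kappa> \<noteq> 0 \<Longrightarrow> f \<in> A \<Longrightarrow> ev \<kappa> (f ^ n) = ev \<kappa> f ^ n"
proof (induction n)
  case 0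
  then show ?case using ev_j[of \<kappa> 1] chomD(3)[OF j_hom] by simp
next
  case (Suc n)
  then show ?case using ev_mult[of \<kappa> f "f ^ n"] sA(7)[of f n] by simp
qed

definition zpt :: "complex \<Rightarrow> (int \<Rightarrow>\<^sub>0 'k) set" where "zpt \<kappa> = {f \<in> A. ev \<kappa> f = 0}"

lemma ev_minus: "f \<in> A \<Longrightarrow> g \<in> A \<Longrightarrow> ev \<kappa> (f - g) = ev \<kappa> f - ev \<kappa> g"
  using ev_add[of "f - g" g \<kappa>] sA(3)[of f g] by simp

lemma zpt_Spm: assumes l: "\<kappa> \<noteq> 0" shows "zpt \<kappa> \<in> Spm A"
  unfolding Spm_iff[OF A_ring] ideal_subr_iff[OF A_ring]
proof (intro conjI ballI)
  show "zpt \<kappa> \<subseteq> A" by (auto simp: zpt_def)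
  show "0 \<in> zpt \<kappa>" using ev_j[of \<kappa> 0] sA(1) chomD(4)[OF j_hom] by (simp add: zpt_def)
  show "1 \<notin> zpt \<kappa>" using ev_j[of \<kappa> 1] chomD(3)[OF j_hom] by (simp add: zpt_def)
  show "f + g \<in> zpt \<kappa>" if "f \<in> zpt \<kappa>" "g \<in> zpt \<kappa>" for f g
    using that sA(6) ev_add by (simp add: zpt_def)
  show "f * g \<in> zpt \<kappa>" if "f \<in> A" "g \<in> zpt \<kappa>" for f g
    using that sA(4) ev_mult[OF l] by (simp add: zpt_def)
  fix f assume f: "f \<in> A - zpt \<kappa>"
  then have nz: "ev \<kappa> f \<noteq> 0" by (auto simp: zpt_def)
  define c where "c = j (inverse (ev \<kappa> f))"
  have "c \<in> A" by (simp add: c_def j_mem)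
  moreover have "ev \<kappa> (1 - f * c) = 0"
    using ev_minus[of 1 "f * c" \<kappa>] ev_mult[OF l, of f c] f \<open>c \<in> A\<close> sA(2,4) nz ev_j[of \<kappa> 1] chomD(3)[OF j_hom]
    by (simp add: c_def ev_j)
  ultimately show "\<exists>y\<in>A. 1 - f * y \<in> zpt \<kappa>"
    using f sA(2,3,4) by (intro bexI[of _ c]) (auto simp: zpt_def)
qed

lemma value_at_zpt: assumes "\<kappa> \<noteq> 0" "f \<in> A" shows "value_at (const \<circ> \<iota>) (zpt \<kappa>) f = ev \<kappa> f"
  unfolding value_at_def j_def[symmetric]
  by (rule the_equality) (use assms j_mem in \<open>auto simp: zpt_def ev_minus ev_j intro: sA(3)\<close>)

lemma zpt_proj: "\<kappa> \<noteq> 0 \<Longrightarrow> proj A\<^sub>0 (zpt \<kappa>) = a"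
  using R_0_iff[OF a vge_A0[OF a]] vge_1_iff[OF a] ai(1)[OF a]
  by (auto simp: proj_def zpt_def A_const ev_const)

lemma zpt_above: "\<kappa> \<noteq> 0 \<Longrightarrow> above (zpt \<kappa>)"
  using Spm_prime[OF A_ring zpt_Spm] zpt_proj by (simp add: above_def)

lemma h_r0: "h (\<sigma> * M) r0 \<noteq> 0"
  using h_zero_iff[OF r0(3)] r0(1,2) v_ray by simp

lemma ev_ray: "ev \<kappa> ray = h (\<sigma> * M) r0 * \<kappa> powi (\<sigma> * M)"
  by (simp add: ray_def ev_single)

lemma ray_zpt: "\<kappa> \<noteq> 0 \<Longrightarrow> ray \<notin> zpt \<kappa>"
  using h_r0 by (simp add: zpt_def ev_ray)

lemma ev_P: "f \<in> P \<Longrightarrow> ev \<kappa> f = 0"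
  unfolding ev_def ext_def
proof (rule sum.neutral, rule ballI)
  fix n assume f: "f \<in> P"
  then have "lookup f n \<in> C n" "lookup f n = 0 \<or> 1 \<le> v n (oa (lookup f n))"
    by (auto simp: P_def PP_def gr_def CN_def)
  then show "h n (lookup f n) * \<kappa> powi n = 0" using h_zero_iff by simp
qed

text \<open>Only degrees divisible by \<open>M\<close> contribute, so the evaluation depends on
  \<kappa> through its \<open>M\<close>-th power alone.\<close>

lemma ev_cong:
  assumes "\<kappa> ^ nat M = \<mu> ^ nat M"
  shows "ev \<kappa> f = ev \<mu> f"
  unfolding ev_def ext_def
proof (rule sum.cong[OF refl])
  fix n
  show "h n (lookup f n) * \<kappa> powi n = h n (lookup f n) * \<mu> powi n"
  proof (cases "M dvd n")
    case True
    then obtain i where i: "n = M * i" by blast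
    have "x powi n = (x ^ nat M) powi i" for x :: complex
      unfolding i power_int_mult using M by (simp add: power_int_def)
    then show ?thesis using assms by simp
  qed (simp add: h_def)
qed

text \<open>The value of \<open>ray\<close> determines \<open>\<kappa> powi (\<sigma> * M)\<close>,
  and raising to the power \<sigma> removes the sign. This makes the stabilizer the group of
  \<open>M\<close>-th roots of unity.\<close>

lemma zpt_eq_iff:
  assumes "\<kappa> \<noteq> 0" "\<mu> \<noteq> 0"
  shows "zpt \<kappa> = zpt \<mu> \<longleftrightarrow> \<kappa> ^ nat M = \<mu> ^ nat M"
proof
  assume "\<kappa> ^ nat M = \<mu> ^ nat M"
  then have "ev \<kappa> f = ev \<mu> f" for f by (rule ev_cong)
  then show "zpt \<kappa> = zpt \<mu>" by (simp only: zpt_def)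
next
  assume e: "zpt \<kappa> = zpt \<mu>"
  have "ray - j (ev \<kappa> ray) \<in> zpt \<kappa>" using ray j_mem by (auto simp: zpt_def ev_minus ev_j intro: sA(3))
  then have "ev \<mu> (ray - j (ev \<kappa> ray)) = 0" unfolding e by (simp add: zpt_def)
  then have "ev \<mu> ray = ev \<kappa> ray" using ray j_mem by (simp add: ev_minus ev_j)
  then have r: "\<mu> powi (\<sigma> * M) = \<kappa> powi (\<sigma> * M)" using h_r0 by (simp add: ev_ray)
  have "(x powi (\<sigma> * M)) powi \<sigma> = x ^ nat M" for x :: complex
  proof -
    have "(x powi (\<sigma> * M)) powi \<sigma> = x powi (\<sigma> * \<sigma> * M)" by (simp add: power_int_mult[symmetric] algebra_simps)
    also have "\<dots> = x ^ nat M" unfolding \<sigma>\<sigma> using M by (simp add: power_int_def)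
    finally show ?thesis .
  qed
  then show "\<kappa> ^ nat M = \<mu> ^ nat M" using r by metis
qed

section \<open>The torus action on these points, and the points of the fibre off the ray\<close>

lemma act_A: "f \<in> A \<Longrightarrow> act \<iota> \<zeta> f \<in> A"
  unfolding A_eq gr_def mem_Collect_eq lookup_act using C_scale iota_A0[OF a] by blast

lemma ev_act:
  assumes "\<zeta> \<noteq> 0" "\<kappa> \<noteq> 0" "f \<in> A"
  shows "ev \<kappa> (act \<iota> \<zeta> f) = ev (\<kappa> * \<zeta>) f"
proof -
  interpret graded_functional C "\<lambda>n x. h n x * \<kappa> powi n" by (rule ev_functional)
  have "Poly_Mapping.keys (act \<iota> \<zeta> f) \<subseteq> Poly_Mapping.keys f" by (auto simp: in_keys_iff lookup_act)
  then have "ev \<kappa> (act \<iota> \<zeta> f) = (\<Sum>n\<in>Poly_Mapping.keys f. h n (\<iota> (\<zeta> powi n) * lookup f n) * \<kappa> powi n)"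
    unfolding ev_def using ext_superset[of "Poly_Mapping.keys f" "act \<iota> \<zeta> f"] by (simp add: lookup_act)
  also have "\<dots> = (\<Sum>n\<in>Poly_Mapping.keys f. h n (lookup f n) * (\<kappa> * \<zeta>) powi n)"
    by (rule sum.cong) (simp_all add: h_scale[OF A_lookup[OF assms(3)]] power_int_mult_distrib)
  finally show ?thesis by (simp add: ev_def ext_def)
qed

lemma act_pt_zpt: "\<zeta> \<noteq> 0 \<Longrightarrow> \<kappa> \<noteq> 0 \<Longrightarrow> act_pt \<iota> A \<zeta> (zpt \<kappa>) = zpt (\<kappa> * \<zeta>)"
  unfolding act_pt_def using ev_act act_A by (auto simp: zpt_def)

definition Orb :: "(int \<Rightarrow>\<^sub>0 'k) set set" where "Orb = zpt ` (- {0})"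

lemma Orb_orbit: "\<kappa> \<noteq> 0 \<Longrightarrow> orbit Cstar (act_pt \<iota> A) (zpt \<kappa>) = Orb"
proof -
  assume l: "\<kappa> \<noteq> 0"
  have "orbit Cstar (act_pt \<iota> A) (zpt \<kappa>) = (\<lambda>\<zeta>. zpt (\<kappa> * \<zeta>)) ` (- {0})"
    unfolding orbit_def Cstar_carrier using act_pt_zpt l by auto
  also have "\<dots> = zpt ` ((\<lambda>\<zeta>. \<kappa> * \<zeta>) ` (- {0}))" by (simp add: image_image)
  also have "(\<lambda>\<zeta>. \<kappa> * \<zeta>) ` (- {0}) = - {0}"
  proof (intro equalityI subsetI)
    fix x :: complex assume "x \<in> - {0}"
    then show "x \<in> (\<lambda>\<zeta>. \<kappa> * \<zeta>) ` (- {0})" using l by (intro image_eqI[of _ _ "x / \<kappa>"]) auto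
  qed (use l in auto)
  finally show ?thesis by (simp add: Orb_def)
qed

lemma Orb_nonfixed: "Orb \<inter> fixed_points \<iota> A = {}"
proof -
  have "zpt \<kappa> \<notin> fixed_points \<iota> A" if "\<kappa> \<noteq> 0" for \<kappa>
  proof
    assume "zpt \<kappa> \<in> fixed_points \<iota> A"
    \<comment> \<open>The number 2 is not a root of unity, so it moves every point of the
      orbit.\<close>
    then have "zpt (\<kappa> * 2) = zpt \<kappa>"
      using act_pt_zpt[of 2 \<kappa>] that unfolding fixed_points_def Cstar_carrier by auto
    then have "(\<kappa> * 2) ^ nat M = \<kappa> ^ nat M" using that zpt_eq_iff by auto
    then have "(2 :: complex) ^ nat M = 1" using that by (simp add: power_mult_distrib)
    then have "norm ((2 :: complex) ^ nat M) = 1" by simp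
    then have "(2 :: real) ^ nat M = 1" by (simp add: norm_power)
    then show False using M one_less_power[of "2::real" "nat M"] by simp
  qed
  then show ?thesis by (auto simp: Orb_def)
qed

lemma Orb_Spm: "Orb \<subseteq> Spm A" using zpt_Spm by (auto simp: Orb_def)

lemma Orb_nonfixed_orbit: "Orb \<in> nonfixed_orbits \<iota> A"
proof -
  have "zpt 1 \<in> Orb" by (auto simp: Orb_def)
  then have "zpt 1 \<in> Spm A - fixed_points \<iota> A" using Orb_nonfixed Orb_Spm by auto
  then show ?thesis unfolding nonfixed_orbits_def orbits_def using Orb_orbit[of 1] by auto
qed

lemma Stab_zpt: "\<kappa> \<noteq> 0 \<Longrightarrow> Stab \<iota> A (zpt \<kappa>) = {\<zeta>. \<zeta> ^ nat M = 1}"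
proof -
  assume l: "\<kappa> \<noteq> 0"
  have "\<zeta> \<noteq> 0 \<and> act_pt \<iota> A \<zeta> (zpt \<kappa>) = zpt \<kappa> \<longleftrightarrow> \<zeta> ^ nat M = 1" for \<zeta>
  proof (cases "\<zeta> = 0")
    case True
    then show ?thesis using M by (simp add: zero_power)
  next
    case False
    have "zpt (\<kappa> * \<zeta>) = zpt \<kappa> \<longleftrightarrow> (\<kappa> * \<zeta>) ^ nat M = \<kappa> ^ nat M"
      by (rule zpt_eq_iff) (use l False in auto)
    then show ?thesis using act_pt_zpt[OF False l] l False by (simp add: power_mult_distrib)
  qed
  then show ?thesis unfolding stabilizer_def Cstar_carrier by auto
qed

lemma card_Stab: "\<kappa> \<noteq> 0 \<Longrightarrow> finite (Stab \<iota> A (zpt \<kappa>)) \<and> int (card (Stab \<iota> A (zpt \<kappa>))) = M"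
  using Stab_zpt[of \<kappa>] M card_roots_unity_eq[of "nat M"] finite_roots_unity[of "nat M", where 'a = complex]
  by (simp add: Suc_le_eq)

text \<open>On the boundary line the exponent is \<open>i * (M, E)\<close>, that of a power of
  \<open>ray\<close> or of its inverse; the two alternatives avoid negative powers.\<close>

lemma ray_relation:
  assumes x: "x \<in> C n" and nz: "x \<noteq> 0" "v n (oa x) = 0"
  shows "\<exists>s\<in>A\<^sub>0 - a. \<exists>s'\<in>A\<^sub>0 - a. \<exists>l.
    const s * S n x = const s' * ray ^ l \<or> const s * (S n x * ray ^ l) = const s'"
proof -
  obtain i where i: "n = M * i" using v_zero[OF nz(2)] by blast
  have "oa x * M = i * E * M" using nz(2) by (simp add: v_def i algebra_simps)
  then have ox: "oa x = i * E" using M by simp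
  define l where "l = nat \<bar>i\<bar>"
  have rl: "ray ^ l = S (int l * (\<sigma> * M)) (r0 ^ l)" "oa (r0 ^ l) = int l * (\<sigma> * E)" "r0 ^ l \<noteq> 0"
    using r0(1,2) ord_power[OF a r0(1), of l] by (auto simp: ray_def single_power)
  show ?thesis
  proof (cases "0 \<le> \<sigma> * i")
    case True
    then have li: "int l = \<sigma> * i" using \<sigma> by (auto simp: l_def)
    then have l\<sigma>: "int l * (\<sigma> * c) = i * c" for c using \<sigma>\<sigma> by (simp add: algebra_simps)
    obtain s s' where s: "s \<in> A\<^sub>0 - a" "s' \<in> A\<^sub>0 - a" "s * x = s' * r0 ^ l"
      using same_ord[OF a nz(1) rl(3)] ox rl(2) l\<sigma> by metis
    have "const s * S n x = const s' * ray ^ l"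
      unfolding rl(1) l\<sigma> const_def by (simp add: mult_single s(3) i mult.commute)
    then show ?thesis using s(1,2) by blast
  next
    case False
    then have li: "int l = - (\<sigma> * i)" using \<sigma> by (auto simp: l_def)
    then have l\<sigma>: "int l * (\<sigma> * c) = - (i * c)" for c using \<sigma>\<sigma> by (simp add: algebra_simps)
    have "oa (x * r0 ^ l) = oa 1"
      using ord_mult[OF a nz(1) rl(3)] ox rl(2) l\<sigma>[of E] ord_1[OF a] by simp
    then obtain s s' where s: "s \<in> A\<^sub>0 - a" "s' \<in> A\<^sub>0 - a" "s * (x * r0 ^ l) = s' * 1"
      using same_ord[OF a, of "x * r0 ^ l" 1] nz(1) rl(3) by auto
    have "const s * (S n x * ray ^ l) = const s'"
      unfolding rl(1) l\<sigma> const_def using s(3) by (simp add: mult_single i mult.commute)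
    then show ?thesis using s(1,2) by blast
  qed
qed

text \<open>The value map of \<open>z\<close> is the residue map on degree 0, vanishes on
  \<open>P\<close>, and elsewhere is governed by the value of \<open>ray\<close> through
  \<open>ray_relation\<close>. A parameter \<kappa> that matches the value of \<open>ray\<close>
  therefore gives the same point.\<close>

lemma above_eq_zpt:
  assumes z: "z \<in> Spm A" "proj A\<^sub>0 z = a" "ray \<notin> z"
  shows "z \<in> Orb"
proof -
  have ab: "above z" using z Spm_prime[OF A_ring] by (simp add: above_def)
  note Pz = P_subset_above[OF ab z(3)] and zI = Spm_ideal[OF A_ring z(1)]
  note zi = idealD[OF A_ring zI]
  have z1: "1 \<notin> z" using primeD(2)[OF A_ring Spm_prime[OF A_ring z(1)]] .
  have uniq: "c = c'" if "f - j c \<in> z" "f - j c' \<in> z" for f c c'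
    by (rule residue_unique[OF j_hom A_ring j_A zI z1 that])
  obtain val where val: "\<And>f. f \<in> A \<Longrightarrow> f - j (val f) \<in> z" using A_residue[OF z(1)] by metis
  have valI: "val f = c" if "f \<in> A" "f - j c \<in> z" for f c using uniq[OF val[OF that(1)] that(2)] .
  have val_add: "val (f + g) = val f + val g" if fg: "f \<in> A" "g \<in> A" for f g
  proof (rule valI[OF sA(6)[OF fg]])
    have "(f - j (val f)) + (g - j (val g)) \<in> z" by (rule zi(3)[OF val[OF fg(1)] val[OF fg(2)]])
    moreover have "f + g - j (val f + val g) = (f - j (val f)) + (g - j (val g))"
      unfolding chomD[OF j_hom] by simp
    ultimately show "f + g - j (val f + val g) \<in> z" by (simp only:)
  qed
  have val_mult: "val (f * g) = val f * val g" if fg: "f \<in> A" "g \<in> A" for f g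
  proof (rule valI[OF sA(4)[OF fg]])
    have "f * (g - j (val g)) + j (val g) * (f - j (val f)) \<in> z"
      by (rule zi(3)[OF zi(4)[OF fg(1) val[OF fg(2)]] zi(4)[OF j_mem val[OF fg(1)]]])
    moreover have "f * g - j (val f * val g) = f * (g - j (val g)) + j (val g) * (f - j (val f))"
      unfolding chomD[OF j_hom] by (simp add: algebra_simps)
    ultimately show "f * g - j (val f * val g) \<in> z" by (simp only:)
  qed
  have val_0: "val f = 0 \<longleftrightarrow> f \<in> z" if "f \<in> A" for f
    using val[OF that] valI[OF that, of 0] chomD(4)[OF j_hom] by auto
  have val_power: "val (f ^ n) = val f ^ n" if "f \<in> A" for f n
  proof (induction n)
    case 0
    show ?case by (rule valI) (use sA(2) zi(2) chomD(3)[OF j_hom] in auto)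
  next
    case (Suc n)
    then show ?case using val_mult[OF that sA(7)[OF that, of n]] by simp
  qed
  have val_const: "val (const s) = R a s" if s: "s \<in> A\<^sub>0" for s
  proof (rule valI)
    show "const s \<in> A" using s by (simp add: A_const)
    have "s - \<iota> (R a s) \<in> a" by (rule R_in_A0[OF a s])
    then have "const (s - \<iota> (R a s)) \<in> z" using above_const[OF ab] ai(1)[OF a] by blast
    moreover have "const (s - \<iota> (R a s)) = const s - j (R a s)"
      by (simp add: const_def j_def single_diff)
    ultimately show "const s - j (R a s) \<in> z" by simp
  qed
  define c where "c = val ray"
  have c: "c \<noteq> 0" unfolding c_def using val_0[OF ray] z(3) by simp
  \<comment> \<open>The root comes from the polar form; \<open>\<mu> powi \<sigma>\<close> is then
    the required parameter.\<close>
  obtain \<mu> where \<mu>: "\<mu> ^ nat M = c / h (\<sigma> * M) r0"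
  proof -
    define w where "w = c / h (\<sigma> * M) r0"
    have "rcis (root (nat M) (cmod w)) (Arg w / real (nat M)) ^ nat M = rcis (cmod w) (Arg w)"
      using M by (simp add: DeMoivre2)
    also have "\<dots> = w" by (rule rcis_cmod_Arg)
    finally show ?thesis using that by (simp add: w_def)
  qed
  have \<mu>0: "\<mu> \<noteq> 0" using \<mu> c h_r0 M by (auto simp: zero_power)
  define \<kappa> where "\<kappa> = \<mu> powi \<sigma>"
  have l: "\<kappa> \<noteq> 0" using \<mu>0 by (simp add: \<kappa>_def)
  have "\<kappa> powi (\<sigma> * M) = \<mu> powi (\<sigma> * \<sigma> * M)" by (simp add: \<kappa>_def power_int_mult[symmetric] mult.assoc)
  also have "\<dots> = \<mu> ^ nat M" unfolding \<sigma>\<sigma> using M by (simp add: power_int_def)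
  finally have chr: "ev \<kappa> ray = c" unfolding ev_ray \<mu> using h_r0 by simp
  have hom: "val (S n x) = ev \<kappa> (S n x)" if x: "x \<in> C n" for n x
  proof (cases "x = 0 \<or> 1 \<le> v n (oa x)")
    case True
    then have "S n x \<in> P" using x by (simp add: single_P)
    then show ?thesis using ev_P Pz val_0[of "S n x"] x by (auto simp: A_single)
  next
    case False
    then have nz: "x \<noteq> 0" "v n (oa x) = 0" using C_v[OF x] by auto
    have xA: "S n x \<in> A" using x by (simp add: A_single)
    have R0: "R a s \<noteq> 0" if "s \<in> A\<^sub>0 - a" for s
      using that R_0_iff[OF a vge_A0[OF a]] vge_1_iff[OF a] by blast
    have cA: "const s \<in> A" if "s \<in> A\<^sub>0 - a" for s using that by (simp add: A_const)
    obtain s s' l where s: "s \<in> A\<^sub>0 - a" "s' \<in> A\<^sub>0 - a"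
        and alt: "const s * S n x = const s' * ray ^ l \<or> const s * (S n x * ray ^ l) = const s'"
      using ray_relation[OF x nz] by blast
    have rA: "ray ^ l \<in> A" using sA(7)[OF ray] .
    from alt show ?thesis
    proof
      assume e: "const s * S n x = const s' * ray ^ l"
      have "R a s * val (S n x) = R a s' * c ^ l"
        using arg_cong[OF e, of val] val_mult[OF cA[OF s(1)] xA] val_mult[OF cA[OF s(2)] rA]
          val_const s(1,2) val_power[OF ray] by (simp add: c_def)
      moreover have "R a s * ev \<kappa> (S n x) = R a s' * c ^ l"
        using arg_cong[OF e, of "ev \<kappa>"] ev_mult[OF l cA[OF s(1)] xA] ev_mult[OF l cA[OF s(2)] rA]
          ev_const s(1,2) ev_power[OF l ray] chr by simp
      ultimately have "R a s * val (S n x) = R a s * ev \<kappa> (S n x)" by simp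
      then show ?thesis using R0[OF s(1)] by simp
    next
      assume e: "const s * (S n x * ray ^ l) = const s'"
      have xr: "S n x * ray ^ l \<in> A" by (rule sA(4)[OF xA rA])
      have "R a s * (val (S n x) * c ^ l) = R a s'"
        using arg_cong[OF e, of val] val_mult[OF cA[OF s(1)] xr] val_mult[OF xA rA]
          val_const s(1,2) val_power[OF ray] by (simp add: c_def)
      moreover have "R a s * (ev \<kappa> (S n x) * c ^ l) = R a s'"
        using arg_cong[OF e, of "ev \<kappa>"] ev_mult[OF l cA[OF s(1)] xr] ev_mult[OF l xA rA]
          ev_const s(1,2) ev_power[OF l ray] chr by simp
      ultimately have "R a s * (val (S n x) * c ^ l) = R a s * (ev \<kappa> (S n x) * c ^ l)" by simp
      then show ?thesis using R0[OF s(1)] c by simp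
    qed
  qed
  have "val f = ev \<kappa> f" if f: "f \<in> A" for f
  proof -
    have sA': "S n (lookup f n) \<in> A" for n using A_lookup[OF f] by (simp add: A_single)
    have "val (\<Sum>n\<in>I. S n (lookup f n)) = ev \<kappa> (\<Sum>n\<in>I. S n (lookup f n))" for I
    proof (induction I rule: infinite_finite_induct)
      case (insert n I)
      then show ?case using hom[OF A_lookup[OF f], of n] sring_sum[OF A_ring, of I "\<lambda>n. S n (lookup f n)"] sA'
        by (simp add: val_add ev_add)
    qed (use val_0[of 0] sA(1) zi(2) ev_j[of \<kappa> 0] chomD(4)[OF j_hom] in auto)
    then show ?thesis using sum_single_lookup[of f] by metis
  qed
  then have "z = zpt \<kappa>" using val_0 zi(1) by (auto simp: zpt_def)
  then show ?thesis using l by (simp add: Orb_def)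
qed

lemma Orb_eq: "Orb = {z \<in> Spm A. proj A\<^sub>0 z = a \<and> ray \<notin> z}"
  using above_eq_zpt zpt_Spm zpt_proj ray_zpt by (auto simp: Orb_def)

text \<open>The value of \<open>f\<close> along the orbit is a Laurent polynomial in \<kappa> with
  coefficients \<open>h n (lookup f n)\<close>. If it vanishes identically, every component has
  positive valuation.\<close>

lemma vanishing_Orb: "vanishing_ideal A Orb = P"
proof (intro equalityI subsetI)
  fix f assume "f \<in> P"
  then show "f \<in> vanishing_ideal A Orb"
    using Pi(1) ev_P by (auto simp: vanishing_ideal_def Orb_def zpt_def)
next
  fix f assume "f \<in> vanishing_ideal A Orb"
  then have f: "f \<in> A" "\<And>\<kappa>. \<kappa> \<noteq> 0 \<Longrightarrow> ev \<kappa> f = 0"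
    by (auto simp: vanishing_ideal_def Orb_def zpt_def)
  have h0: "h n (lookup f n) = 0" if "n \<in> Poly_Mapping.keys f" for n
    using laurent_coeffs_zero[of "Poly_Mapping.keys f" "\<lambda>n. h n (lookup f n)" n] f(2) that
    by (simp add: ev_def ext_def)
  have "lookup f n = 0 \<or> 1 \<le> v n (oa (lookup f n))" for n
    using h0[of n] h_zero_iff[OF A_lookup[OF f(1)], of n] by (auto simp: in_keys_iff)
  then show "f \<in> P" using A_lookup[OF f(1)] by (auto simp: P_def PP_def gr_def CN_def)
qed

end

section \<open>The tangent space at a point of the orbit\<close>

context curve begin

context
  fixes a t assumes a: "a \<in> Spm A\<^sub>0" and t: "t \<noteq> 0" "ord a t = 1"
begin

text \<open>The linear coefficient of \<open>x\<close> in its expansion in powers of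
  \<open>t\<close>.\<close>

definition c1 :: "'k \<Rightarrow> complex" where "c1 x = R a ((x - \<iota> (R a x)) / t)"

lemma c1_vge: "vge a 0 x \<Longrightarrow> vge a 0 ((x - \<iota> (R a x)) / t)"
  using R[OF a, of x] ord_divide[OF a, of "x - \<iota> (R a x)" t] t
  by (cases "x - \<iota> (R a x) = 0") (simp_all add: vge_def)

lemma c1_add: assumes "vge a 0 x" "vge a 0 y" shows "c1 (x + y) = c1 x + c1 y"
proof -
  have "(x + y - \<iota> (R a (x + y))) / t = (x - \<iota> (R a x)) / t + (y - \<iota> (R a y)) / t"
    unfolding R_add[OF a assms] chom_simps(1) by (simp add: diff_divide_distrib add_divide_distrib)
  then show ?thesis unfolding c1_def using R_add[OF a c1_vge[OF assms(1)] c1_vge[OF assms(2)]] by simp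
qed

lemma R_t: "vge a 0 x \<Longrightarrow> R a (t * x) = 0"
proof -
  assume x: "vge a 0 x"
  have "vge a (1 + 0) (t * x)" by (rule vge_mult[OF a _ x]) (simp add: vge_def t)
  then have "vge a 1 (t * x)" by simp
  then show ?thesis using R_0_iff[OF a] vge_mono[OF a, of 1 "t * x" 0] by simp
qed

lemma c1_mult:
  assumes "vge a 0 x" "vge a 0 y"
  shows "c1 (x * y) = R a x * c1 y + R a y * c1 x"
proof -
  define x' where "x' = (x - \<iota> (R a x)) / t"
  define y' where "y' = (y - \<iota> (R a y)) / t"
  have x: "vge a 0 x'" "x = \<iota> (R a x) + t * x'" using c1_vge[OF assms(1)] t by (auto simp: x'_def)
  have y: "vge a 0 y'" "y = \<iota> (R a y) + t * y'" using c1_vge[OF assms(2)] t by (auto simp: y'_def)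
  define p where "p = \<iota> (R a x)"
  define r where "r = \<iota> (R a y)"
  have pr: "vge a 0 p" "vge a 0 r" "R a p = R a x" "R a r = R a y"
    using vge_iota0[OF a] R_iota[OF a] by (auto simp: p_def r_def)
  have "x * y - p * r = t * (p * y' + r * x' + t * (x' * y'))"
    unfolding x(2)[folded p_def] y(2)[folded r_def] by (simp add: algebra_simps)
  then have e: "(x * y - \<iota> (R a (x * y))) / t = p * y' + r * x' + t * (x' * y')"
    unfolding R_mult[OF a assms] chom_simps(2) p_def r_def using t(1) by simp
  have v: "vge a 0 (p * y')" "vge a 0 (r * x')" "vge a 0 (x' * y')" "vge a 0 (t * (x' * y'))"
  proof -
    show "vge a 0 (p * y')" "vge a 0 (r * x')" and xy: "vge a 0 (x' * y')"
      using vge_mult[OF a pr(1) y(1)] vge_mult[OF a pr(2) x(1)] vge_mult[OF a x(1) y(1)] by auto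
    have "vge a (1 + 0) (t * (x' * y'))" by (rule vge_mult[OF a _ xy]) (simp add: vge_def t)
    then show "vge a 0 (t * (x' * y'))" by (rule vge_mono[OF a]) simp
  qed
  have "c1 (x * y) = R a (p * y') + R a (r * x') + R a (t * (x' * y'))"
    unfolding c1_def e using v R_add[OF a] vge_add[OF a] by simp
  also have "\<dots> = R a x * c1 y + R a y * c1 x"
    using R_mult[OF a pr(1) y(1)] R_mult[OF a pr(2) x(1)] R_t[OF v(3)] pr(3,4)
    by (simp add: c1_def x'_def y'_def)
  finally show ?thesis .
qed

lemma c1_iota: "c1 (\<iota> c) = 0"
  by (simp add: c1_def R_iota[OF a] R_0[OF a])

end

end

context face begin

text \<open>A term \<open>t\<^sup>k u\<^sup>n\<close> becomes a multiple of \<open>y\<close> to the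
  power \<open>k M - n E\<close>, so the first power occurs only if \<open>M\<close> divides
  \<open>n E + 1\<close>. For \<open>M > 1\<close> such degrees carry no constant term and a residue
  suffices; for \<open>M = 1\<close> constant and linear term occur together, and \<open>c1\<close>
  extracts the latter.\<close>

definition psi :: "int \<Rightarrow> 'k \<Rightarrow> complex" where
  "psi n x = (if M = 1 then c1 a t (x * t powi (- (n * E)))
     else if M dvd n * E + 1 then R a (x * t powi (- ((n * E + 1) div M))) else 0)"

lemma psi_vge:
  assumes "x \<in> C n" "M dvd n * E + 1" "M \<noteq> 1"
  shows "vge a 0 (x * t powi (- ((n * E + 1) div M)))"
proof (cases "x = 0")
  case False
  obtain k where k: "n * E + 1 = M * k" using assms(2) by blast
  have e: "(n * E + 1) div M = k" using k M by simp
  have "0 \<le> v n (oa x)" by (rule C_v[OF assms(1) False])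
  then have "- 1 \<le> (oa x - k) * M" unfolding v_def using k by (simp add: algebra_simps)
  moreover have "(oa x - k) * M \<le> - 1 * M" if "oa x - k \<le> - 1" using that M by (intro mult_right_mono) auto
  ultimately have "0 \<le> oa x - k" using M assms(3) by linarith
  then show ?thesis unfolding e using ord_shift[OF False] by (simp add: vge_def)
qed (simp add: vge_def)

lemma psi_2:
  assumes "x \<in> C n" "x = 0 \<or> 2 \<le> v n (oa x)" "M \<noteq> 1"
  shows "psi n x = 0"
proof (cases "x = 0 \<or> \<not> M dvd n * E + 1")
  case True
  then show ?thesis using assms(3) by (auto simp: psi_def R_0[OF a])
next
  case False
  then obtain k where k: "n * E + 1 = M * k" by blast
  have e: "(n * E + 1) div M = k" using k M by simp
  have "2 \<le> v n (oa x)" using assms(2) False by simp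
  then have "0 < (oa x - k) * M" unfolding v_def using k by (simp add: algebra_simps)
  then have "0 < oa x - k" using M by (simp add: zero_less_mult_iff)
  then have "vge a 1 (x * t powi (- ((n * E + 1) div M)))"
    unfolding e using False ord_shift[of x "- k"] by (simp add: vge_def)
  then show ?thesis
    using psi_vge[OF assms(1) _ assms(3)] False R_0_iff[OF a] assms(3) by (simp add: psi_def)
qed

lemma h_vge_1: "M = 1 \<Longrightarrow> x \<in> C n \<Longrightarrow> vge a 0 (x * t powi (- (n * E)))"
  using h_vge[of x n] by simp

lemma psi_add: "x \<in> C n \<Longrightarrow> y \<in> C n \<Longrightarrow> psi n (x + y) = psi n x + psi n y"
  unfolding psi_def distrib_right using c1_add[OF a t(2,3) h_vge_1 h_vge_1] R_add[OF a psi_vge psi_vge] by auto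

text \<open>The Leibniz rule for the coefficient of \<open>y\<close>. For \<open>M > 1\<close>,
  constant terms need \<open>M dvd n\<close>, which excludes a linear term in the same degree; if
  \<open>M\<close> divides neither degree, both factors have positive valuation and the product
  starts at the second power of \<open>y\<close>.\<close>

lemma psi_mult:
  assumes x: "x \<in> C n" and y: "y \<in> C m"
  shows "psi (n + m) (x * y) = h n x * psi m y + h m y * psi n x"
proof (cases "M = 1")
  case True
  have "x * y * t powi (- ((n + m) * E)) = (x * t powi (- (n * E))) * (y * t powi (- (m * E)))"
    using t(2) power_int_add[of t "- (n * E)" "- (m * E)"] by (simp add: algebra_simps)
  moreover have "psi i z = c1 a t (z * t powi (- (i * E)))" "h i z = R a (z * t powi (- (i * E)))" for i z
    unfolding psi_def h_def using True by simp_all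
  ultimately show ?thesis
    using c1_mult[OF a t(2,3) h_vge_1[OF True x] h_vge_1[OF True y]] by (simp only:)
next
  case M1: False
  have excl: "\<not> M dvd i \<or> \<not> M dvd i * E + 1" for i
  proof -
    have False if "M dvd i" "M dvd i * E + 1"
    proof -
      have "M dvd (i * E + 1) - i * E" using that by (intro dvd_diff) auto
      then show False using M M1 by simp
    qed
    then show ?thesis by blast
  qed
  have half: "psi (n + m) (x * y) = h n x * psi m y"
    if x: "x \<in> C n" and y: "y \<in> C m" and n: "M dvd n" for x y n m
  proof -
    obtain i where i: "n = M * i" using n by blast
    have e0: "n * E div M = i * E" using M i by (simp add: mult.assoc)
    have eq: "(n + m) * E + 1 = M * (i * E) + (m * E + 1)" by (simp add: i algebra_simps)
    have dv: "M dvd (n + m) * E + 1 \<longleftrightarrow> M dvd m * E + 1" unfolding eq by (metis dvd_add_right_iff dvd_triv_left)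
    have ev: "((n + m) * E + 1) div M = i * E + (m * E + 1) div M" unfolding eq using M by simp
    show ?thesis
    proof (cases "M dvd m * E + 1")
      case True
      have "x * y * t powi (- (i * E + (m * E + 1) div M)) = (x * t powi (- (i * E))) * (y * t powi (- ((m * E + 1) div M)))"
        using t(2) power_int_add[of t "- (i * E)" "- ((m * E + 1) div M)"] by simp
      then have "R a (x * y * t powi (- (i * E + (m * E + 1) div M))) = R a (x * t powi (- (i * E))) * R a (y * t powi (- ((m * E + 1) div M)))"
        using R_mult[OF a h_vge[OF x n] psi_vge[OF y True M1]] e0 by (simp only:)
      then show ?thesis
        unfolding psi_def h_def using True n dv ev e0 M1 by (simp only: if_False if_True)
    next
      case False
      then show ?thesis using dv M1 by (simp add: psi_def)
    qed
  qed
  have h0: "h i z = 0" if "\<not> M dvd i" for i z using that by (simp add: h_def)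
  have p0: "psi i z = 0" if "M dvd i" for i z using that excl[of i] M1 by (simp add: psi_def)
  consider "M dvd n" "M dvd m" | "M dvd n" "\<not> M dvd m" | "\<not> M dvd n" "M dvd m" | "\<not> M dvd n" "\<not> M dvd m" by blast
  then show ?thesis
  proof cases
    case 1
    then show ?thesis using p0 by simp
  next
    case 2
    then show ?thesis using half[OF x y] h0 by simp
  next
    case 3
    then show ?thesis using half[OF y x] h0 by (simp add: add.commute mult.commute)
  next
    case 4
    have "x * y = 0 \<or> 2 \<le> v (n + m) (oa (x * y))"
    proof (cases "x = 0 \<or> y = 0")
      case False
      have "0 \<le> v n (oa x)" "0 \<le> v m (oa y)" using C_v x y False by auto
      moreover have "v n (oa x) \<noteq> 0" "v m (oa y) \<noteq> 0" using v_zero 4 by blast+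
      moreover have "v (n + m) (oa (x * y)) = v n (oa x) + v m (oa y)"
        using False by (simp add: ord_mult[OF a] v_add)
      ultimately show ?thesis by linarith
    qed auto
    then show ?thesis using psi_2[OF C_mult[OF x y] _ M1] h0 4 by simp
  qed
qed

lemma psi_iota: "psi 0 (\<iota> c) = 0"
  using M by (auto simp: psi_def c1_iota[OF a t(2,3)])

text \<open>Turns degreewise data obeying the Leibniz rule over \<open>h\<close> into a tangent
  vector at \<open>zpt \<kappa>\<close>. It is used for the direction along the orbit and for the
  transversal one.\<close>

definition tang :: "complex \<Rightarrow> (int \<Rightarrow> 'k \<Rightarrow> complex) \<Rightarrow> (int \<Rightarrow>\<^sub>0 'k) \<Rightarrow> complex" where
  "tang \<kappa> \<phi> = (\<lambda>f. if f \<in> A then ext (\<lambda>n x. \<phi> n x * \<kappa> powi n) f else 0)"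

context
  fixes \<kappa> :: complex and \<phi> :: "int \<Rightarrow> 'k \<Rightarrow> complex"
  assumes l: "\<kappa> \<noteq> 0"
    and padd: "\<And>n x y. x \<in> C n \<Longrightarrow> y \<in> C n \<Longrightarrow> \<phi> n (x + y) = \<phi> n x + \<phi> n y"
    and pmult: "\<And>n m x y. x \<in> C n \<Longrightarrow> y \<in> C m \<Longrightarrow> \<phi> (n + m) (x * y) = h n x * \<phi> m y + h m y * \<phi> n x"
    and piota: "\<And>c. \<phi> 0 (\<iota> c) = 0"
begin

lemma phi_scale: "x \<in> C n \<Longrightarrow> \<phi> n (\<iota> c * x) = c * \<phi> n x"
  using pmult[of "\<iota> c" 0 x n] piota[of c] iota_A0[OF a] by (simp add: C0_eq h_0 R_iota[OF a])

lemma phi_functional: "graded_functional C (\<lambda>n x. \<phi> n x * \<kappa> powi n)"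
  by unfold_locales (auto simp: padd distrib_right intro: C_add)

lemma tang_single: "x \<in> C n \<Longrightarrow> tang \<kappa> \<phi> (S n x) = \<phi> n x * \<kappa> powi n"
  unfolding tang_def using graded_functional.ext_single[OF phi_functional] by (simp add: A_single)

lemma tang_mult:
  assumes f: "f \<in> A" and g: "g \<in> A"
  shows "tang \<kappa> \<phi> (f * g) = ev \<kappa> f * tang \<kappa> \<phi> g + ev \<kappa> g * tang \<kappa> \<phi> f"
proof -
  have "tang \<kappa> \<phi> (f * g) = (\<Sum>n\<in>Poly_Mapping.keys f. \<Sum>m\<in>Poly_Mapping.keys g.
      \<phi> (n + m) (lookup f n * lookup g m) * \<kappa> powi (n + m))"
    unfolding tang_def if_P[OF sA(4)[OF f g]]
    by (rule graded_functional.ext_times[OF phi_functional C_mult f[unfolded A_eq] g[unfolded A_eq]])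
  also have "\<dots> = (\<Sum>n\<in>Poly_Mapping.keys f. \<Sum>m\<in>Poly_Mapping.keys g.
      (h n (lookup f n) * \<kappa> powi n) * (\<phi> m (lookup g m) * \<kappa> powi m) +
      (\<phi> n (lookup f n) * \<kappa> powi n) * (h m (lookup g m) * \<kappa> powi m))"
  proof (intro sum.cong refl)
    fix n m
    have p: "\<kappa> powi (n + m) = \<kappa> powi n * \<kappa> powi m" using l by (simp add: power_int_add)
    show "\<phi> (n + m) (lookup f n * lookup g m) * \<kappa> powi (n + m) =
      (h n (lookup f n) * \<kappa> powi n) * (\<phi> m (lookup g m) * \<kappa> powi m) +
      (\<phi> n (lookup f n) * \<kappa> powi n) * (h m (lookup g m) * \<kappa> powi m)"
      unfolding pmult[OF A_lookup[OF f] A_lookup[OF g]] p by (simp add: algebra_simps)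
  qed
  also have "\<dots> = ev \<kappa> f * tang \<kappa> \<phi> g + tang \<kappa> \<phi> f * ev \<kappa> g"
    using f g by (simp add: ev_def tang_def ext_def sum.distrib sum_product)
  finally show ?thesis by simp
qed

lemma tang_in: "tang \<kappa> \<phi> \<in> tangent_space (const \<circ> \<iota>) A (zpt \<kappa>)"
  unfolding tangent_space_def mem_Collect_eq
proof (intro conjI allI ballI impI)
  show "tang \<kappa> \<phi> f = 0" if "f \<notin> A" for f using that by (simp add: tang_def)
  show "tang \<kappa> \<phi> (f + g) = tang \<kappa> \<phi> f + tang \<kappa> \<phi> g" if "f \<in> A" "g \<in> A" for f g
    using that sA(6) graded_functional.ext_add[OF phi_functional, of f g] by (simp add: tang_def A_eq)
  show "tang \<kappa> \<phi> (f * g) = value_at (const \<circ> \<iota>) (zpt \<kappa>) f * tang \<kappa> \<phi> g + value_at (const \<circ> \<iota>) (zpt \<kappa>) g * tang \<kappa> \<phi> f"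
    if "f \<in> A" "g \<in> A" for f g
    using tang_mult[OF that] value_at_zpt[OF l] that by simp
  show "tang \<kappa> \<phi> ((const \<circ> \<iota>) c * f) = c * tang \<kappa> \<phi> f" if f: "f \<in> A" for c f
  proof -
    have "tang \<kappa> \<phi> (j c) = 0"
      unfolding j_def comp_def const_def using tang_single[of "\<iota> c" 0] iota_A0[OF a] piota by (simp add: C0_eq)
    then show ?thesis using tang_mult[OF j_mem f, of c] ev_j by (simp add: j_def)
  qed
qed

lemma tang_act:
  assumes z: "\<zeta> \<noteq> 0" and w: "\<And>n x. x \<in> C n \<Longrightarrow> \<zeta> powi n * \<phi> n x = b * \<phi> n x"
  shows "tang \<kappa> \<phi> \<circ> act \<iota> \<zeta> = fscale b (tang \<kappa> \<phi>)"
proof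
  fix f
  show "(tang \<kappa> \<phi> \<circ> act \<iota> \<zeta>) f = fscale b (tang \<kappa> \<phi>) f"
  proof (cases "f \<in> A")
    case True
    interpret graded_functional C "\<lambda>n x. \<phi> n x * \<kappa> powi n" by (rule phi_functional)
    have "Poly_Mapping.keys (act \<iota> \<zeta> f) \<subseteq> Poly_Mapping.keys f" by (auto simp: in_keys_iff lookup_act)
    then have "tang \<kappa> \<phi> (act \<iota> \<zeta> f) = (\<Sum>n\<in>Poly_Mapping.keys f. \<phi> n (\<iota> (\<zeta> powi n) * lookup f n) * \<kappa> powi n)"
      unfolding tang_def using ext_superset[of "Poly_Mapping.keys f" "act \<iota> \<zeta> f"] act_A[OF True] by (simp add: lookup_act)
    also have "\<dots> = (\<Sum>n\<in>Poly_Mapping.keys f. b * (\<phi> n (lookup f n) * \<kappa> powi n))"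
      by (rule sum.cong) (simp_all add: phi_scale[OF A_lookup[OF True]] w[OF A_lookup[OF True]])
    finally show ?thesis using True by (simp add: fscale_def tang_def ext_def sum_distrib_left)
  next
    case False
    \<comment> \<open>Tangent vectors are zero outside \<open>A\<close> by convention. Since the
      inverse of \<zeta> also preserves \<open>A\<close>, the image of \<open>f\<close> stays
      outside and both sides vanish.\<close>
    have "act \<iota> (inverse \<zeta>) (act \<iota> \<zeta> f) = f"
    proof (rule poly_mapping_eqI)
      fix n
      have "\<iota> (inverse \<zeta> powi n) * \<iota> (\<zeta> powi n) = 1"
        using z by (simp add: chom_simps(3) power_int_inverse flip: chom_simps(2))
      then show "lookup (act \<iota> (inverse \<zeta>) (act \<iota> \<zeta> f)) n = lookup f n"
        unfolding lookup_act by (simp flip: mult.assoc)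
    qed
    then have "act \<iota> \<zeta> f \<notin> A" using False act_A by metis
    then show ?thesis using False by (simp add: tang_def fscale_def)
  qed
qed

end

lemma euler_add: "x \<in> C n \<Longrightarrow> y \<in> C n \<Longrightarrow> of_int n * h n (x + y) = of_int n * h n x + of_int n * h n y"
  by (simp add: h_add distrib_left)

lemma euler_mult:
  assumes "x \<in> C n" "y \<in> C m"
  shows "of_int (n + m) * h (n + m) (x * y) = h n x * (of_int m * h m y) + h m y * (of_int n * h n x)"
  unfolding h_mult[OF assms] of_int_add by (simp add: algebra_simps)

lemma euler_iota: "of_int 0 * h 0 (\<iota> c) = 0" by simp

text \<open>The derivative \<open>\<kappa> d/d\<kappa>\<close> of the evaluation, that is, the Euler
  vector field, tangent to the orbit. Its companion \<open>tw\<close> is the coefficient of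
  \<open>y\<close> and points across the orbit.\<close>

definition tv :: "complex \<Rightarrow> (int \<Rightarrow>\<^sub>0 'k) \<Rightarrow> complex" where "tv \<kappa> = tang \<kappa> (\<lambda>n x. of_int n * h n x)"
definition tw :: "complex \<Rightarrow> (int \<Rightarrow>\<^sub>0 'k) \<Rightarrow> complex" where "tw \<kappa> = tang \<kappa> psi"

lemma tv_in: "\<kappa> \<noteq> 0 \<Longrightarrow> tv \<kappa> \<in> tangent_space (const \<circ> \<iota>) A (zpt \<kappa>)"
  unfolding tv_def by (rule tang_in[OF _ euler_add euler_mult euler_iota])

lemma tw_in: "\<kappa> \<noteq> 0 \<Longrightarrow> tw \<kappa> \<in> tangent_space (const \<circ> \<iota>) A (zpt \<kappa>)"
  unfolding tw_def by (rule tang_in[OF _ psi_add psi_mult psi_iota])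

lemma tv_single: "\<kappa> \<noteq> 0 \<Longrightarrow> x \<in> C n \<Longrightarrow> tv \<kappa> (S n x) = of_int n * h n x * \<kappa> powi n"
  unfolding tv_def by (rule tang_single[OF _ euler_add euler_mult euler_iota])

lemma tw_single: "\<kappa> \<noteq> 0 \<Longrightarrow> x \<in> C n \<Longrightarrow> tw \<kappa> (S n x) = psi n x * \<kappa> powi n"
  unfolding tw_def by (rule tang_single[OF _ psi_add psi_mult psi_iota])

lemma tv_ray: assumes "\<kappa> \<noteq> 0" shows "tv \<kappa> ray \<noteq> 0"
proof -
  have "\<sigma> * M \<noteq> 0" using \<sigma> M by (auto simp only:)
  then show ?thesis unfolding ray_def tv_single[OF assms r0(3)] using h_r0 assms by simp
qed

lemma h_y0: "h n1 y0 = 0" using h_zero_iff[OF y0(2)] y0(3) by simp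

lemma tv_Y: "\<kappa> \<noteq> 0 \<Longrightarrow> tv \<kappa> Y = 0"
  unfolding Y_def by (simp add: tv_single y0 h_y0)

text \<open>The expansion of \<open>Y\<close> starts with the first power of \<open>y\<close>, as
  \<open>v\<close> is 1 there, so its linear coefficient is the nonzero leading one.\<close>

lemma psi_y0: "psi n1 y0 \<noteq> 0"
proof (cases "M = 1")
  case True
  have M1: "k * M = k" for k using True by simp
  have "oa y0 - n1 * E = 1" using y0(3) unfolding v_def M1 .
  then have o1: "oa (y0 * t powi (- (n1 * E))) = 1" unfolding ord_shift[OF y0(1)] by simp
  define x where "x = y0 * t powi (- (n1 * E))"
  have x: "x \<noteq> 0" "oa x = 1" using y0(1) t(2) o1 by (auto simp: x_def)
  have "R a x = 0" using R_0_iff[OF a, of x] x by (simp add: vge_def)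
  then have "c1 a t x = R a (x / t)" by (simp add: c1_def[OF a t(2,3)] chom_simps)
  also have "\<dots> \<noteq> 0"
    using R_0_iff[OF a, of "x / t"] x t by (simp add: vge_def ord_divide[OF a])
  also have "c1 a t x = psi n1 y0" unfolding psi_def x_def using True by (simp only: if_True simp_thms)
  finally show ?thesis .
next
  case False
  have k: "n1 * E + 1 = M * oa y0" using y0(3) by (simp add: v_def algebra_simps)
  then have dv: "M dvd n1 * E + 1" and e: "(n1 * E + 1) div M = oa y0" using M by simp_all
  have "psi n1 y0 = R a (y0 * t powi (- oa y0))" using False dv e by (simp add: psi_def)
  also have "\<dots> \<noteq> 0"
    using R_0_iff[OF a, of "y0 * t powi (- oa y0)"] ord_shift[OF y0(1), of "- oa y0"] y0(1) t(2)
    by (simp add: vge_def)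
  finally show ?thesis .
qed

lemma tw_Y: "\<kappa> \<noteq> 0 \<Longrightarrow> tw \<kappa> Y \<noteq> 0"
  unfolding Y_def using psi_y0 by (simp add: tw_single y0)

lemma Stab_D:
  assumes "\<kappa> \<noteq> 0" "\<zeta> \<in> Stab \<iota> A (zpt \<kappa>)"
  shows "\<zeta> \<noteq> 0" "M dvd n - m \<Longrightarrow> \<zeta> powi n = \<zeta> powi m"
proof -
  have z: "\<zeta> ^ nat M = 1" using assms Stab_zpt by auto
  then show z0: "\<zeta> \<noteq> 0" using M by (auto simp: zero_power)
  assume "M dvd n - m"
  then obtain i where i: "n = m + M * i" by (metis add.commute diff_add_cancel dvdE)
  have "\<zeta> powi (M * i) = (\<zeta> ^ nat M) powi i" unfolding power_int_mult using M by (simp add: power_int_def)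
  then show "\<zeta> powi n = \<zeta> powi m" unfolding i using z z0 by (simp add: power_int_add)
qed

lemma tv_act:
  assumes "\<kappa> \<noteq> 0" "\<zeta> \<in> Stab \<iota> A (zpt \<kappa>)"
  shows "tv \<kappa> \<circ> act \<iota> \<zeta> = tv \<kappa>"
proof -
  have "tv \<kappa> \<circ> act \<iota> \<zeta> = fscale 1 (tv \<kappa>)" unfolding tv_def
  proof (rule tang_act[OF assms(1) euler_add euler_mult euler_iota])
    show "\<zeta> \<noteq> 0" using Stab_D[OF assms] by auto
    fix n x
    show "\<zeta> powi n * (of_int n * h n x) = 1 * (of_int n * h n x)"
      using Stab_D(2)[OF assms, of n 0] by (cases "M dvd n") (auto simp: h_def)
  qed
  then show ?thesis by (simp add: fscale_def)
qed

text \<open>For \<open>M > 1\<close>, \<open>psi\<close> lives in the degrees with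
  \<open>n * E + 1\<close> divisible by \<open>M\<close>; by coprimality these are the degrees
  congruent to \<open>q\<close>, so \<zeta> acts there as \<open>\<zeta> powi q\<close>. For
  \<open>M = 1\<close> the stabilizer is trivial.\<close>

lemma tw_act:
  assumes "\<kappa> \<noteq> 0" "\<zeta> \<in> Stab \<iota> A (zpt \<kappa>)"
  shows "tw \<kappa> \<circ> act \<iota> \<zeta> = fscale (\<zeta> powi q) (tw \<kappa>)"
  unfolding tw_def
proof (rule tang_act[OF assms(1) psi_add psi_mult psi_iota])
  show "\<zeta> \<noteq> 0" using Stab_D[OF assms] by auto
  fix n x
  show "\<zeta> powi n * psi n x = \<zeta> powi q * psi n x"
  proof (cases "M dvd n * E + 1")
    case True
    then have "M dvd (n * E + 1) - (q * E + 1)" using q(3) by (intro dvd_diff)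
    then have "M dvd (n - q) * E" by (simp add: algebra_simps)
    then have "M dvd n - q" using coprime by (simp add: coprime_commute coprime_dvd_mult_left_iff)
    then show ?thesis using Stab_D(2)[OF assms] by metis
  next
    case False
    then show ?thesis by (auto simp: psi_def)
  qed
qed

text \<open>\<open>ray\<close> and \<open>Y\<close> are local coordinates. Elements of positive
  valuation are multiples of \<open>Y\<close> up to factors nonzero at the point, functions in
  degree 0 are constants modulo \<open>P\<close>, and boundary elements are tied to powers of
  \<open>ray\<close> by \<open>ray_relation\<close>.\<close>

lemma tangent_zero:
  assumes l: "\<kappa> \<noteq> 0" and D: "\<delta> \<in> tangent_space (const \<circ> \<iota>) A (zpt \<kappa>)"
    and r: "\<delta> ray = 0" and y: "\<delta> Y = 0"
  shows "\<delta> f = 0"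
proof (cases "f \<in> A")
  case False
  then show ?thesis using D by (simp add: tangent_space_def)
next
  case f: True
  have dadd: "\<And>f g. f \<in> A \<Longrightarrow> g \<in> A \<Longrightarrow> \<delta> (f + g) = \<delta> f + \<delta> g"
    and dscale: "\<And>c f. f \<in> A \<Longrightarrow> \<delta> (j c * f) = c * \<delta> f"
    and dmult: "\<And>f g. f \<in> A \<Longrightarrow> g \<in> A \<Longrightarrow> \<delta> (f * g) = ev \<kappa> f * \<delta> g + ev \<kappa> g * \<delta> f"
    using D value_at_zpt[OF l] unfolding tangent_space_def j_def by auto
  have d1: "\<delta> 1 = 0" using dmult[of 1 1] sA(2) ev_j[of \<kappa> 1] chomD(3)[OF j_hom] by simp
  have d0: "\<delta> 0 = 0" using dadd[of 0 0] sA(1) by simp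
  have rL: "\<delta> (ray ^ L) = 0" for L
    by (induction L) (use d1 r ray sA(7)[OF ray] dmult in auto)
  have pos: "\<delta> (S n x) = 0" if x: "x \<in> CN 1 n" for n x
  proof (cases "x = 0")
    case False
    have xA: "S n x \<in> A" using x by (simp add: CN_def A_single)
    have xP: "ev \<kappa> (S n x) = 0" by (rule ev_P) (use x in \<open>simp add: single_P CN_def\<close>)
    have x1: "x \<in> CN (int 1) n" using x by simp
    obtain s L g where s: "s \<in> A\<^sub>0 - a" "g \<in> A" "(const s * ray ^ L) * S n x = g * Y ^ 1"
      using homogeneous_division[OF x1 False] by blast
    have sr: "const s * ray ^ L \<in> A" using s(1) by (intro sA(4) sA(7) ray) (simp add: A_const)
    have "ev \<kappa> (const s * ray ^ L) * \<delta> (S n x) = \<delta> (g * Y ^ 1)"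
      unfolding s(3)[symmetric] dmult[OF sr xA] xP by simp
    also have "\<dots> = 0" using dmult[OF s(2) Y(1)] y ev_P[OF Y_P] by simp
    finally have "ev \<kappa> (const s * ray ^ L) = 0 \<or> \<delta> (S n x) = 0" by simp
    moreover have "ev \<kappa> (const s * ray ^ L) \<noteq> 0"
    proof
      assume "ev \<kappa> (const s * ray ^ L) = 0"
      then have "const s * ray ^ L \<in> zpt \<kappa>" using sr by (simp add: zpt_def)
      moreover have "const s \<in> A - zpt \<kappa>" by (rule above_not_const[OF zpt_above[OF l] s(1)])
      moreover have "ray ^ L \<in> A - zpt \<kappa>"
        by (rule primeD(6)[OF A_ring Spm_prime[OF A_ring zpt_Spm[OF l]]]) (use ray ray_zpt[OF l] in blast)
      ultimately show False using primeD(4)[OF A_ring Spm_prime[OF A_ring zpt_Spm[OF l]]] by blast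
    qed
    ultimately show ?thesis by simp
  qed (use d0 in simp)
  have dconst: "\<delta> (const s) = 0" if s: "s \<in> A\<^sub>0" for s
  proof -
    have m: "s - \<iota> (R a s) \<in> a" by (rule R_in_A0[OF a s])
    then have "const (s - \<iota> (R a s)) \<in> P" using const_P ai(1)[OF a] by blast
    then have "\<delta> (const (s - \<iota> (R a s))) = 0"
      unfolding const_def by (intro pos) (simp add: single_P CN_def)
    moreover have "const s = const (s - \<iota> (R a s)) + j (R a s) * 1" by (simp add: j_def flip: const_simps)
    moreover have "\<delta> (j (R a s) * 1) = 0" using dscale[OF sA(2)] d1 by simp
    ultimately show ?thesis
      using dadd[of "const (s - \<iota> (R a s))" "j (R a s) * 1"] m ai(1)[OF a] j_mem by (simp add: A_const)
  qed
  have hom: "\<delta> (S n x) = 0" if x: "x \<in> C n" for n x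
  proof (cases "x = 0 \<or> 1 \<le> v n (oa x)")
    case True
    then show ?thesis using x by (intro pos) (auto simp: CN_def)
  next
    case False
    then have nz: "x \<noteq> 0" "v n (oa x) = 0" using C_v[OF x] by auto
    have xA: "S n x \<in> A" using x by (simp add: A_single)
    obtain s s' L where s: "s \<in> A\<^sub>0 - a" "s' \<in> A\<^sub>0 - a"
        and alt: "const s * S n x = const s' * ray ^ L \<or> const s * (S n x * ray ^ L) = const s'"
      using ray_relation[OF x nz] by blast
    have sA': "const s \<in> A" "const s' \<in> A" "ray ^ L \<in> A" using s sA(7)[OF ray] by (auto simp: A_const)
    have R0: "ev \<kappa> (const s) \<noteq> 0" using above_not_const[OF zpt_above[OF l] s(1)] by (auto simp: zpt_def)
    have rL0: "ev \<kappa> (ray ^ L) \<noteq> 0" using ev_power[OF l ray] ray_zpt[OF l] ray by (auto simp: zpt_def)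
    from alt show ?thesis
    proof
      assume e: "const s * S n x = const s' * ray ^ L"
      have "\<delta> (const s * S n x) = 0" unfolding e using dmult[OF sA'(2,3)] dconst s(2) rL by simp
      then show ?thesis using dmult[OF sA'(1) xA] dconst s(1) R0 by simp
    next
      assume e: "const s * (S n x * ray ^ L) = const s'"
      have "\<delta> (const s * (S n x * ray ^ L)) = 0" unfolding e using dconst s(2) by simp
      then have "\<delta> (S n x * ray ^ L) = 0" using dmult[OF sA'(1) sA(4)[OF xA sA'(3)]] dconst s(1) R0 by simp
      then show ?thesis using dmult[OF xA sA'(3)] rL rL0 by simp
    qed
  qed
  have "\<delta> (\<Sum>n\<in>I. S n (lookup f n)) = 0" for I
  proof (induction I rule: infinite_finite_induct)
    case (insert n I)
    have "(\<Sum>n\<in>I. S n (lookup f n)) \<in> A" by (rule sring_sum[OF A_ring]) (simp add: A_single A_lookup[OF f])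
    then show ?case using insert dadd[of "S n (lookup f n)" "\<Sum>n\<in>I. S n (lookup f n)"] hom[OF A_lookup[OF f], of n] A_lookup[OF f, of n]
      by (simp add: A_single)
  qed (use d0 in auto)
  then show ?thesis using sum_single_lookup[of f] by metis
qed

lemma tangent_subspace:
  assumes "\<delta> \<in> tangent_space \<iota>' B z" "\<epsilon> \<in> tangent_space \<iota>' B z"
  shows "\<delta> + \<epsilon> \<in> tangent_space \<iota>' B z" "fscale c \<delta> \<in> tangent_space \<iota>' B z"
  using assms unfolding tangent_space_def fscale_def by (auto simp: algebra_simps)

text \<open>The values of the two vectors at \<open>ray\<close> and \<open>Y\<close> form a
  triangular matrix with nonzero diagonal, since \<open>tv \<kappa> Y\<close> is 0; and a derivation
  is determined by these two values.\<close>

lemma tangent_basis: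
  assumes l: "\<kappa> \<noteq> 0"
  shows "tv \<kappa> \<noteq> tw \<kappa>" "T.independent {tv \<kappa>, tw \<kappa>}"
    "T.span {tv \<kappa>, tw \<kappa>} = tangent_space (const \<circ> \<iota>) A (zpt \<kappa>)"
proof -
  note nz = tv_ray[OF l] tv_Y[OF l] tw_Y[OF l]
  show ne: "tv \<kappa> \<noteq> tw \<kappa>" using nz(2,3) by auto
  show "T.independent {tv \<kappa>, tw \<kappa>}"
    unfolding T.independent_explicit_finite_subsets
  proof (intro allI impI)
    fix B c assume B: "B \<subseteq> {tv \<kappa>, tw \<kappa>}" "finite B" "(\<Sum>x\<in>B. fscale (c x) x) = 0"
    define b where "b x = (if x \<in> B then c x else 0)" for x
    have "(\<Sum>x\<in>B. fscale (c x) x) = (\<Sum>x\<in>{tv \<kappa>, tw \<kappa>}. fscale (b x) x)"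
      using B(1) by (intro sum.mono_neutral_cong_left) (auto simp: b_def fscale_def)
    also have "\<dots> = fscale (b (tv \<kappa>)) (tv \<kappa>) + fscale (b (tw \<kappa>)) (tw \<kappa>)" using ne by simp
    finally have e: "fscale (b (tv \<kappa>)) (tv \<kappa>) + fscale (b (tw \<kappa>)) (tw \<kappa>) = 0" using B(3) by simp
    from fun_cong[OF e, of Y] have w: "b (tw \<kappa>) = 0" using nz by (simp add: fscale_def)
    from fun_cong[OF e, of ray] have "b (tv \<kappa>) = 0" using w nz by (simp add: fscale_def)
    then show "\<forall>x\<in>B. c x = 0" using w B(1) by (auto simp: b_def split: if_splits)
  qed
  show "T.span {tv \<kappa>, tw \<kappa>} = tangent_space (const \<circ> \<iota>) A (zpt \<kappa>)"
  proof (intro equalityI subsetI)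
    have "T.subspace (tangent_space (const \<circ> \<iota>) A (zpt \<kappa>))"
    proof (rule T.subspaceI)
      have "fscale 0 (tv \<kappa>) \<in> tangent_space (const \<circ> \<iota>) A (zpt \<kappa>)"
        by (rule tangent_subspace(2)[OF tv_in[OF l] tv_in[OF l]])
      moreover have "fscale 0 (tv \<kappa>) = 0" by (auto simp: fscale_def)
      ultimately show "0 \<in> tangent_space (const \<circ> \<iota>) A (zpt \<kappa>)" by simp
    qed (use tangent_subspace in blast)+
    then show "\<delta> \<in> tangent_space (const \<circ> \<iota>) A (zpt \<kappa>)" if "\<delta> \<in> T.span {tv \<kappa>, tw \<kappa>}" for \<delta>
      using T.span_minimal[of "{tv \<kappa>, tw \<kappa>}"] tv_in[OF l] tw_in[OF l] that by blast
  next
    fix \<delta> assume D: "\<delta> \<in> tangent_space (const \<circ> \<iota>) A (zpt \<kappa>)"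
    \<comment> \<open>Solution of the triangular system: first match the value at \<open>Y\<close>,
      then the one at \<open>ray\<close>.\<close>
    define \<beta> where "\<beta> = \<delta> Y / tw \<kappa> Y"
    define \<alpha> where "\<alpha> = (\<delta> ray - \<beta> * tw \<kappa> ray) / tv \<kappa> ray"
    define \<epsilon> where "\<epsilon> = \<delta> + fscale (- 1) (fscale \<alpha> (tv \<kappa>) + fscale \<beta> (tw \<kappa>))"
    have "\<epsilon> \<in> tangent_space (const \<circ> \<iota>) A (zpt \<kappa>)"
      unfolding \<epsilon>_def
      using tangent_subspace(1)[OF D tangent_subspace(2)[OF tangent_subspace(1)[OF tangent_subspace(2)[OF tv_in[OF l] D] tangent_subspace(2)[OF tw_in[OF l] D]] D]] .
    moreover have "\<epsilon> ray = 0" "\<epsilon> Y = 0"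
      using nz by (simp_all add: \<epsilon>_def fscale_def \<alpha>_def \<beta>_def)
    ultimately have e0: "\<epsilon> f = 0" for f by (rule tangent_zero[OF l])
    have "\<delta> f = (fscale \<alpha> (tv \<kappa>) + fscale \<beta> (tw \<kappa>)) f" for f
      using e0[of f] unfolding \<epsilon>_def plus_fun_apply fscale_def eq_iff_diff_eq_0[of "\<delta> f"]
      by (simp add: algebra_simps)
    then have e: "\<delta> = fscale \<alpha> (tv \<kappa>) + fscale \<beta> (tw \<kappa>)" by (rule ext)
    show "\<delta> \<in> T.span {tv \<kappa>, tw \<kappa>}"
      unfolding e by (intro T.span_add T.span_scale T.span_base) auto
  qed
qed

lemma Orb_type: "orbit_type \<iota> A Orb M q"
  unfolding orbit_type_def
proof (intro conjI ballI Orb_nonfixed_orbit q(1,2))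
  fix z assume "z \<in> Orb"
  then obtain \<kappa> where l: "\<kappa> \<noteq> 0" "z = zpt \<kappa>" by (auto simp: Orb_def)
  show "finite (Stab \<iota> A z)" "int (card (Stab \<iota> A z)) = M" using card_Stab l by auto
  show "\<exists>v w. v \<noteq> w \<and> \<not> T.dependent {v, w} \<and> T.span {v, w} = tangent_space (const \<circ> \<iota>) A z \<and>
     (\<forall>\<zeta>\<in>Stab \<iota> A z. v \<circ> act \<iota> \<zeta> = v \<and> w \<circ> act \<iota> \<zeta> = fscale (\<zeta> powi q) w)"
    unfolding l(2)
    by (intro exI[of _ "tv \<kappa>"] exI[of _ "tw \<kappa>"] conjI ballI tangent_basis[OF l(1)] tv_act[OF l(1)] tw_act[OF l(1)])
qed

end

section \<open>The Zariski topology\<close>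

text \<open>The generating sets already form a basis, because the sets where \<open>f\<close> and
  where \<open>g\<close> are nonzero intersect in the set of \<open>f * g\<close>.\<close>

lemma zariski_basis:
  assumes A: "sring A" and U: "openin (zariski A) U"
  shows "U \<subseteq> Spm A \<and> (\<forall>z\<in>U. \<exists>f\<in>A. f \<notin> z \<and> {w \<in> Spm A. f \<notin> w} \<subseteq> U)"
proof -
  have "generate_topology_on {{z \<in> Spm A. f \<notin> z} | f. f \<in> A} U"
    using U by (simp add: zariski_def openin_topology_generated_by_iff)
  then show ?thesis
  proof (induction U rule: generate_topology_on.induct)
    case Empty
    then show ?case by simp
  next
    case (Int U W)
    show ?case
    proof (intro conjI ballI)
      show "U \<inter> W \<subseteq> Spm A" using Int by blast
      fix z assume z: "z \<in> U \<inter> W"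
      obtain f where f: "f \<in> A" "f \<notin> z" "{w \<in> Spm A. f \<notin> w} \<subseteq> U" using Int z by blast
      obtain g where g: "g \<in> A" "g \<notin> z" "{w \<in> Spm A. g \<notin> w} \<subseteq> W" using Int z by blast
      have zS: "z \<in> Spm A" using Int z by blast
      have fg: "f * g \<in> A - z" by (rule primeD(4)[OF A Spm_prime[OF A zS]]) (use f g in auto)
      have "{w \<in> Spm A. f * g \<notin> w} \<subseteq> U \<inter> W"
      proof
        fix w assume "w \<in> {w \<in> Spm A. f * g \<notin> w}"
        then have w: "w \<in> Spm A" "f * g \<notin> w" by auto
        have "f \<notin> w" "g \<notin> w"
          using w(2) idealD(5)[OF A Spm_ideal[OF A w(1)] g(1), of f]
            idealD(4)[OF A Spm_ideal[OF A w(1)] f(1), of g] by auto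
        then show "w \<in> U \<inter> W" using f(3) g(3) w(1) by auto
      qed
      then show "\<exists>f\<in>A. f \<notin> z \<and> {w \<in> Spm A. f \<notin> w} \<subseteq> U \<inter> W"
        using fg by (intro bexI[of _ "f * g"]) auto
    qed
  next
    case (UN K)
    show ?case
    proof (intro conjI ballI)
      show "\<Union>K \<subseteq> Spm A" using UN by blast
      fix z assume "z \<in> \<Union>K"
      then obtain U where U: "U \<in> K" "z \<in> U" by blast
      with UN[OF U(1)] obtain f where "f \<in> A" "f \<notin> z" "{w \<in> Spm A. f \<notin> w} \<subseteq> U" by blast
      then show "\<exists>f\<in>A. f \<notin> z \<and> {w \<in> Spm A. f \<notin> w} \<subseteq> \<Union>K"
        using U(1) by (intro bexI[of _ f] conjI order_trans[OF _ Union_upper[of U K]])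
    qed
  next
    case (Basis U)
    then obtain f where "f \<in> A" "U = {z \<in> Spm A. f \<notin> z}" by blast
    then show ?case by auto
  qed
qed

lemma openin_zariski: "f \<in> A \<Longrightarrow> openin (zariski A) {w \<in> Spm A. f \<notin> w}"
  unfolding zariski_def by (rule topology_generated_by_Basis) blast

lemma topspace_zariski: assumes A: "sring A" shows "topspace (zariski A) = Spm A"
proof
  show "topspace (zariski A) \<subseteq> Spm A" using zariski_basis[OF A openin_topspace] by blast
  have "{w \<in> Spm A. 1 \<notin> w} \<subseteq> topspace (zariski A)"
    by (rule openin_subset[OF openin_zariski]) (rule sringD(2)[OF A])
  then show "Spm A \<subseteq> topspace (zariski A)" using Spm_iff[OF A] by blast
qed

lemma zariski_closure:
  assumes A: "sring A" and Y: "Y \<subseteq> Spm A"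
  shows "zariski A closure_of Y = {z \<in> Spm A. vanishing_ideal A Y \<subseteq> z}"
proof (intro equalityI subsetI)
  fix z assume z: "z \<in> zariski A closure_of Y"
  then have zS: "z \<in> Spm A" using topspace_zariski[OF A] by (auto simp: in_closure_of)
  have "f \<in> z" if f: "f \<in> vanishing_ideal A Y" for f
  proof (rule ccontr)
    assume "f \<notin> z"
    then have "z \<in> {w \<in> Spm A. f \<notin> w}" using zS by simp
    moreover have "openin (zariski A) {w \<in> Spm A. f \<notin> w}"
      by (rule openin_zariski) (use f in \<open>simp add: vanishing_ideal_def\<close>)
    ultimately have "\<exists>y. y \<in> Y \<and> y \<in> {w \<in> Spm A. f \<notin> w}"
      using z[unfolded in_closure_of, THEN conjunct2, THEN spec[of _ "{w \<in> Spm A. f \<notin> w}"]] by (simp only: simp_thms)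
    then show False using f by (auto simp: vanishing_ideal_def)
  qed
  then show "z \<in> {z \<in> Spm A. vanishing_ideal A Y \<subseteq> z}" using zS by blast
next
  fix z assume z: "z \<in> {z \<in> Spm A. vanishing_ideal A Y \<subseteq> z}"
  show "z \<in> zariski A closure_of Y"
    unfolding in_closure_of topspace_zariski[OF A]
  proof (intro conjI allI impI)
    show "z \<in> Spm A" using z by simp
    fix U assume U: "z \<in> U \<and> openin (zariski A) U"
    then obtain f where f: "f \<in> A" "f \<notin> z" "{w \<in> Spm A. f \<notin> w} \<subseteq> U"
      using zariski_basis[OF A, of U] U by metis
    have "f \<notin> vanishing_ideal A Y" using z f(2) by auto
    then obtain y where y: "y \<in> Y" "f \<notin> y" using f(1) by (auto simp: vanishing_ideal_def)
    then have "y \<in> {w \<in> Spm A. f \<notin> w}" using Y by auto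
    then show "\<exists>y. y \<in> Y \<and> y \<in> U" using f(3) y(1) by (intro exI[of _ y]) auto
  qed
qed

lemma prime_divisor_eq:
  assumes A: "sring A" and Y: "prime_divisor A Y"
  shows "Y = {z \<in> Spm A. vanishing_ideal A Y \<subseteq> z}" "primeideal (vanishing_ideal A Y) (subr A)" "Y \<noteq> {}"
proof -
  have c: "closedin (zariski A) Y" and h: "has_height A (vanishing_ideal A Y) 1"
    using Y by (auto simp: prime_divisor_def)
  have "Y \<subseteq> Spm A" using closedin_subset[OF c] topspace_zariski[OF A] by simp
  from zariski_closure[OF A this] show "Y = {z \<in> Spm A. vanishing_ideal A Y \<subseteq> z}"
    using closure_of_closedin[OF c] by simp
  show P: "primeideal (vanishing_ideal A Y) (subr A)" using h by (auto simp: has_height_def prime_chain_def)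
  show "Y \<noteq> {}"
  proof
    assume "Y = {}"
    then have "1 \<in> vanishing_ideal A Y" using sringD(2)[OF A] by (simp add: vanishing_ideal_def)
    then show False using primeD(2)[OF A P] by blast
  qed
qed

text \<open>Otherwise zero, \<open>P\<close> and \<open>Q\<close> would form a chain too long for
  height one.\<close>

lemma height_one_minimal:
  fixes A :: "'r::idom set"
  assumes A: "sring A" and Q: "has_height A Q 1" and P: "primeideal P (subr A)" "P \<noteq> {0}" "P \<subseteq> Q"
  shows "P = Q"
proof (rule ccontr)
  assume "P \<noteq> Q"
  have z: "primeideal {0} (subr A)"
    unfolding primeideal_subr_iff[OF A] ideal_subr_iff[OF A] using sringD(1)[OF A] by auto
  have "{0} \<subset> P" using P(2) idealD(2)[OF A primeD(1)[OF A P(1)]] by auto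
  moreover have "primeideal Q (subr A)" using Q by (auto simp: has_height_def prime_chain_def)
  ultimately have "prime_chain A (Suc 1) (\<lambda>i. if i = 0 then {0} else if i = 1 then P else Q)"
    unfolding prime_chain_def using z P \<open>P \<noteq> Q\<close> by auto
  then show False using Q unfolding has_height_def by force
qed

section \<open>Pullback of a point\<close>

context curve begin

text \<open>Near \<open>a\<close> the equation is \<open>t\<close>, on the open set where
  \<open>s\<close> is nonzero and \<open>t\<close> therefore has no further zero. Near any other
  point it is 1, on an open set avoiding \<open>a\<close>.\<close>

lemma local_equation:
  assumes a: "a \<in> Spm A\<^sub>0" and b: "b \<in> Spm A\<^sub>0"
  shows "\<exists>W f. openin (zariski A\<^sub>0) W \<and> b \<in> W \<and> f \<noteq> 0 \<and> (\<forall>c\<in>W. ord c f = of_bool (c = a))"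
proof (cases "b = a")
  case True
  obtain t s where t: "t \<in> a" "t \<noteq> 0" "ord a t = 1" and s: "s \<in> A\<^sub>0 - a"
      "\<And>b. b \<in> Spm A\<^sub>0 \<Longrightarrow> b \<noteq> a \<Longrightarrow> ord b t \<le> ord b s"
    using uniformizer_with_bound[OF a] by metis
  have "ord c t = of_bool (c = a)" if c: "c \<in> {c \<in> Spm A\<^sub>0. s \<notin> c}" for c
  proof (cases "c = a")
    case False
    have "ord c s = 0" by (rule ord_0_if_notin) (use c s(1) in auto)
    then show ?thesis using s(2)[of c] ord_nonneg[of c t] c False t(1,2) ai(1)[OF a] by force
  qed (use t in simp)
  then show ?thesis using openin_zariski[of s A\<^sub>0] s(1) t(2) a True
    by (intro exI[of _ "{c \<in> Spm A\<^sub>0. s \<notin> c}"] exI[of _ t]) auto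
next
  case False
  obtain x where x: "x \<in> a" "x \<notin> b" using Spm_diff[OF A0 b a False] by blast
  have "ord c 1 = of_bool (c = a)" if "c \<in> {c \<in> Spm A\<^sub>0. x \<notin> c}" for c
    using that x(1) ord_1[of c] by auto
  then show ?thesis using openin_zariski[of x A\<^sub>0] x b ai(1)[OF a]
    by (intro exI[of _ "{c \<in> Spm A\<^sub>0. x \<notin> c}"] exI[of _ 1]) auto
qed

end

context dpd begin

lemma proj_ideal:
  assumes Q: "ideal Q (subr A)"
  shows "ideal (proj A\<^sub>0 Q) (subr A\<^sub>0)"
  unfolding ideal_subr_iff[OF A0]
proof (intro conjI ballI)
  note Qi = idealD[OF A_ring Q]
  show "proj A\<^sub>0 Q \<subseteq> A\<^sub>0" by (auto simp: proj_def)
  show "0 \<in> proj A\<^sub>0 Q" using s0(1) Qi(2) by (simp add: proj_def const_simps)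
  show "x + y \<in> proj A\<^sub>0 Q" if "x \<in> proj A\<^sub>0 Q" "y \<in> proj A\<^sub>0 Q" for x y
    using that s0(6) Qi(3) by (simp add: proj_def const_simps)
  show "x * y \<in> proj A\<^sub>0 Q" if "x \<in> A\<^sub>0" "y \<in> proj A\<^sub>0 Q" for x y
    using that s0(4) Qi(4) by (simp add: proj_def const_simps A_const)
qed

text \<open>Contracting a maximal ideal gives a maximal ideal here because the residue field is
  complex: the inverse of \<open>x\<close> modulo \<open>z\<close> is a constant, and constants lie
  in \<open>A\<^sub>0\<close>.\<close>

lemma proj_Spm: assumes z: "z \<in> Spm A" shows "proj A\<^sub>0 z \<in> Spm A\<^sub>0"
proof -
  note zi = idealD[OF A_ring Spm_ideal[OF A_ring z]]
  have cA: "\<iota> c \<in> A\<^sub>0" for c using A0_iota by auto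
  show ?thesis unfolding Spm_iff[OF A0]
  proof (intro conjI ballI proj_ideal[OF Spm_ideal[OF A_ring z]])
    show "1 \<notin> proj A\<^sub>0 z" using z Spm_iff[OF A_ring, of z] by (simp add: proj_def const_simps)
    fix x assume x: "x \<in> A\<^sub>0 - proj A\<^sub>0 z"
    then obtain c where c: "const x - j c \<in> z" using A_residue[OF z, of "const x"] by (auto simp: A_const)
    have c0: "c \<noteq> 0" using c x chomD(4)[OF j_hom] by (auto simp: proj_def)
    define y where "y = - \<iota> (inverse c)"
    have "1 - x * \<iota> (inverse c) = (x - \<iota> c) * y"
      using c0 by (simp add: y_def algebra_simps chom_simps(3) flip: chom_simps(2))
    moreover have "const ((x - \<iota> c) * y) \<in> z"
    proof -
      have "const (x - \<iota> c) = const x - j c" by (simp add: j_def const_def single_diff)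
      then have "const ((x - \<iota> c) * y) = (const x - j c) * const y" by (simp only: const_simps)
      then show ?thesis using zi(5)[OF _ c, of "const y"] s0(5)[OF cA] by (simp add: A_const y_def)
    qed
    moreover have "1 - x * \<iota> (inverse c) \<in> A\<^sub>0" using x cA s0(2,3,4) by auto
    ultimately have "1 - x * \<iota> (inverse c) \<in> proj A\<^sub>0 z" by (simp add: proj_def)
    then show "\<exists>y\<in>A\<^sub>0. 1 - x * y \<in> proj A\<^sub>0 z" using cA by blast
  qed
qed

text \<open>The description in \<open>pullback_divisor\<close> denotes as soon as every local
  equation at every point of \<open>Y\<close> gives the same order; some local equation exists by
  \<open>local_equation\<close>.\<close>

lemma pullback_eq:
  assumes a: "a \<in> Spm A\<^sub>0" and Y: "prime_divisor A Y"
    and k: "\<And>z f. z \<in> Y \<Longrightarrow> f \<noteq> 0 \<Longrightarrow> ord (proj A\<^sub>0 z) f = of_bool (proj A\<^sub>0 z = a) \<Longrightarrow>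
      frac_ord A (vanishing_ideal A Y) (const f) = k"
  shows "pullback_divisor A\<^sub>0 A (\<lambda>b. of_bool (b = a)) Y = k"
proof -
  obtain z where z: "z \<in> Y" using prime_divisor_eq(3)[OF A_ring Y] by blast
  then have "z \<in> Spm A" using prime_divisor_eq(1)[OF A_ring Y] by blast
  then obtain W f where W: "openin (zariski A\<^sub>0) W" "proj A\<^sub>0 z \<in> W" "f \<noteq> 0" "\<forall>b\<in>W. ord b f = of_bool (b = a)"
    using local_equation[OF a proj_Spm] by blast
  have "(THE k. \<exists>z\<in>Y. \<exists>W f. openin (zariski A\<^sub>0) W \<and> proj A\<^sub>0 z \<in> W \<and> f \<noteq> 0 \<and>
      (\<forall>b\<in>W. ord b f = of_bool (b = a)) \<and> k = frac_ord A (vanishing_ideal A Y) (const f)) = k"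
  proof (rule the_equality)
    show "\<exists>z\<in>Y. \<exists>W f. openin (zariski A\<^sub>0) W \<and> proj A\<^sub>0 z \<in> W \<and> f \<noteq> 0 \<and>
      (\<forall>b\<in>W. ord b f = of_bool (b = a)) \<and> k = frac_ord A (vanishing_ideal A Y) (const f)"
      using z W k[OF z W(3)] by (intro bexI[OF _ z] exI[of _ W] exI[of _ f]) simp
    fix l assume "\<exists>z\<in>Y. \<exists>W f. openin (zariski A\<^sub>0) W \<and> proj A\<^sub>0 z \<in> W \<and> f \<noteq> 0 \<and>
      (\<forall>b\<in>W. ord b f = of_bool (b = a)) \<and> l = frac_ord A (vanishing_ideal A Y) (const f)"
    then obtain z W f where "z \<in> Y" "proj A\<^sub>0 z \<in> W" "f \<noteq> 0" "\<forall>b\<in>W. ord b f = of_bool (b = a)"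
        "l = frac_ord A (vanishing_ideal A Y) (const f)" by blast
    then show "l = k" using k[of z f] by simp
  qed
  then show ?thesis using Y by (simp add: pullback_divisor_def)
qed

lemma pullback_off_fibre:
  assumes a: "a \<in> Spm A\<^sub>0" and Y: "prime_divisor A Y" and x: "x \<in> a" "const x \<notin> vanishing_ideal A Y"
  shows "pullback_divisor A\<^sub>0 A (\<lambda>b. of_bool (b = a)) Y = 0"
proof (rule pullback_eq[OF a Y])
  fix z f assume z: "z \<in> Y" and f: "f \<noteq> 0" "ord (proj A\<^sub>0 z) f = of_bool (proj A\<^sub>0 z = a)"
  let ?Q = "vanishing_ideal A Y"
  note Q = prime_divisor_eq(2)[OF A_ring Y]
  note Qp = primeD[OF A_ring Q]
  define b where "b = proj A\<^sub>0 z"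
  have zS: "z \<in> Spm A" and Qz: "?Q \<subseteq> z" using z prime_divisor_eq(1)[OF A_ring Y] by auto
  have b: "b \<in> Spm A\<^sub>0" unfolding b_def by (rule proj_Spm[OF zS])
  have unit: "frac_ord A ?Q (const f) = 0" if "s \<in> A\<^sub>0" "s' \<in> A\<^sub>0" "const s \<notin> ?Q" "const s' \<notin> ?Q" "f * s = s'" for s s'
    by (rule frac_ord_unit[OF A_ring Q, of "const s'" "const s"])
      (use that in \<open>auto simp: A_const simp flip: const_simps\<close>)
  define Q0 where "Q0 = proj A\<^sub>0 ?Q"
  have Q0: "primeideal Q0 (subr A\<^sub>0)"
    unfolding primeideal_subr_iff[OF A0]
  proof (intro conjI ballI impI)
    show "ideal Q0 (subr A\<^sub>0)" unfolding Q0_def by (rule proj_ideal[OF Qp(1)])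
    show "1 \<notin> Q0" using Qp(2) by (simp add: Q0_def proj_def const_simps)
    show "x \<in> Q0 \<or> y \<in> Q0" if "x \<in> A\<^sub>0" "y \<in> A\<^sub>0" "x * y \<in> Q0" for x y
      using that Qp(3)[of "const x" "const y"] by (simp add: Q0_def proj_def const_simps A_const)
  qed
  have Q0b: "Q0 \<subseteq> b" using Qz by (auto simp: Q0_def b_def proj_def)
  \<comment> \<open>If the contraction \<open>Q0\<close> is zero, the divisor dominates the curve
    and every nonzero function on the curve is a unit along it. Otherwise the divisor lies over the
    one point \<open>b\<close>, which differs from \<open>a\<close> because of \<open>x\<close>, and
    \<open>f\<close> has order 0 at \<open>b\<close>.\<close>
  show "frac_ord A ?Q (const f) = 0"
  proof (cases "Q0 = {0}")
    case True
    obtain g h where gh: "g \<in> A\<^sub>0" "h \<in> A\<^sub>0" "g \<noteq> 0" "h \<noteq> 0" "f = g / h" using nonzero_frac[OF b f(1)] by blast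
    then have "g \<notin> Q0" "h \<notin> Q0" using True by auto
    then show ?thesis using unit[of h g] gh by (simp add: Q0_def proj_def)
  next
    case False
    obtain t where t: "unif A\<^sub>0 b t" using uniformizer_exists[OF b] by metis
    have eq: "Q0 = b" using unif_no_between[OF t Q0 _ False] Q0b by blast
    have "b \<noteq> a"
    proof
      assume "b = a"
      then have "const x \<in> ?Q" using eq x(1) by (auto simp: Q0_def proj_def)
      then show False using x(2) by blast
    qed
    then have "ord b f = ord b 1" using f(2) ord_1[OF b] by (simp add: b_def)
    then obtain s s' where s: "s \<in> A\<^sub>0 - b" "s' \<in> A\<^sub>0 - b" "s * f = s' * 1"
      using same_ord[OF b f(1), of 1] by auto
    have "const s \<notin> ?Q" "const s' \<notin> ?Q" using s(1,2) unfolding eq[symmetric] by (auto simp: Q0_def proj_def)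
    then show ?thesis using unit[of s s'] s by (simp add: mult.commute)
  qed
qed

lemma proj_act_pt: "\<zeta> \<noteq> 0 \<Longrightarrow> proj A\<^sub>0 (act_pt \<iota> A \<zeta> z) = proj A\<^sub>0 z"
proof -
  have "act \<iota> \<zeta> (const x) = const x" for x
    by (rule poly_mapping_eqI) (auto simp: lookup_act const_def lookup_single when_def chom_simps)
  then show ?thesis by (auto simp: proj_def act_pt_def A_const)
qed

end

section \<open>The divisor of a boundary ray\<close>

context face begin

definition Cl :: "(int \<Rightarrow>\<^sub>0 'k) set set" where "Cl = {z \<in> Spm A. P \<subseteq> z}"

lemma const_a_P: "x \<in> a \<Longrightarrow> const x \<in> P" using const_P ai(1)[OF a] by blast

lemma above_contains:
  assumes Q: "primeideal Q (subr A)" "\<And>x. x \<in> a \<Longrightarrow> const x \<in> Q"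
  shows "above Q"
proof -
  note Qp = primeD[OF A_ring Q(1)]
  have "proj A\<^sub>0 Q = a"
    by (rule Spm_eqI[OF A0 a proj_ideal[OF Qp(1)]]) (use Q(2) ai(1)[OF a] Qp(2) in \<open>auto simp: proj_def const_simps\<close>)
  then show ?thesis using Q(1) by (simp add: above_def)
qed

lemma Cl_above: "z \<in> Cl \<Longrightarrow> above z"
  using above_contains[OF Spm_prime[OF A_ring]] const_a_P by (auto simp: Cl_def)

lemma Cl_closure: "zariski A closure_of Orb = Cl"
  using zariski_closure[OF A_ring Orb_Spm] vanishing_Orb by (simp add: Cl_def)

lemma Orb_Cl: "Orb \<subseteq> Cl"
  using Orb_Spm vanishing_Orb by (auto simp: Cl_def vanishing_ideal_def)

lemma vanishing_Cl: "vanishing_ideal A Cl = P"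
proof
  show "P \<subseteq> vanishing_ideal A Cl" using Pi(1) by (auto simp: vanishing_ideal_def Cl_def)
  have "vanishing_ideal A Cl \<subseteq> vanishing_ideal A Orb" using Orb_Cl by (auto simp: vanishing_ideal_def)
  then show "vanishing_ideal A Cl \<subseteq> P" unfolding vanishing_Orb .
qed

lemma Cl_prime_divisor: "prime_divisor A Cl"
  unfolding prime_divisor_def vanishing_Cl
  using closedin_closure_of[of "zariski A" Orb] Cl_closure unif_height[OF unif_P] by simp

lemma divisor_u: "principal_divisor A u Cl = - E"
  using Cl_prime_divisor frac_ord_u by (simp add: principal_divisor_def vanishing_Cl)

lemma pullback_Cl: "pullback_divisor A\<^sub>0 A (\<lambda>b. of_bool (b = a)) Cl = M"
proof (rule pullback_eq[OF a Cl_prime_divisor])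
  fix z f assume z: "z \<in> Cl" and f: "f \<noteq> 0" "ord (proj A\<^sub>0 z) f = of_bool (proj A\<^sub>0 z = a)"
  have "proj A\<^sub>0 z = a" using Cl_above[OF z] by (simp add: above_def)
  then show "frac_ord A (vanishing_ideal A Cl) (const f) = M"
    using frac_ord_const[OF f(1)] f(2) by (simp add: vanishing_Cl)
qed

lemma P_nonzero: "P \<noteq> {0}" using Y_P Y(2) by auto

lemma prime_divisor_above:
  assumes Z: "prime_divisor A Z" and P: "P \<subseteq> vanishing_ideal A Z"
  shows "Z = Cl"
proof -
  have "P = vanishing_ideal A Z"
    by (rule height_one_minimal[OF A_ring _ P_prime P_nonzero P]) (use Z in \<open>simp add: prime_divisor_def\<close>)
  then show ?thesis using prime_divisor_eq(1)[OF A_ring Z] by (simp add: Cl_def)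
qed

lemma pullback_not_above:
  assumes "prime_divisor A Z" "\<not> above (vanishing_ideal A Z)"
  shows "pullback_divisor A\<^sub>0 A (\<lambda>b. of_bool (b = a)) Z = 0"
  using pullback_off_fibre[OF a assms(1)] above_contains[OF prime_divisor_eq(2)[OF A_ring assms(1)]] assms(2) by blast

lemma fibre_above: "z \<in> Spm A \<Longrightarrow> proj A\<^sub>0 z = a \<Longrightarrow> above z"
  using Spm_prime[OF A_ring] by (simp add: above_def)

context
  assumes eq: "E * M' = M * E'"
begin

text \<open>The ray is invertible over \<open>a\<close>, so no point of the fibre is missing from
  the orbit; the orbit is then closed.\<close>

lemma fibre_single: "{z \<in> Spm A. proj A\<^sub>0 z = a} = Orb"
  unfolding Orb_eq using ray_unit_above[OF fibre_above eq] by blast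

lemma Cl_single: "Cl = Orb"
proof
  show "Cl \<subseteq> Orb" unfolding fibre_single[symmetric] using Cl_above by (auto simp: above_def Cl_def)
qed (rule Orb_Cl)

lemma pullback_single: "pullback_divisor A\<^sub>0 A (\<lambda>b. of_bool (b = a)) = (\<lambda>Z. M * of_bool (Z = Orb))"
proof
  fix Z
  show "pullback_divisor A\<^sub>0 A (\<lambda>b. of_bool (b = a)) Z = M * of_bool (Z = Orb)"
  proof (cases "Z = Orb")
    case True
    then show ?thesis using pullback_Cl Cl_single by simp
  next
    case False
    show ?thesis
    proof (cases "prime_divisor A Z")
      case pd: True
      have "\<not> above (vanishing_ideal A Z)"
        using prime_divisor_above[OF pd P_subset_above] ray_unit_above[OF _ eq] False Cl_single by blast
      then show ?thesis using pullback_not_above[OF pd] False by simp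
    qed (use False in \<open>simp add: pullback_divisor_def\<close>)
  qed
qed

lemma trivial_stabilizer:
  assumes "M = 1" "z \<in> Spm A" "proj A\<^sub>0 z = a"
  shows "card (Stab \<iota> A z) = 1"
proof -
  have "z \<in> Orb" unfolding fibre_single[symmetric] using assms(2,3) by simp
  then obtain \<kappa> where "\<kappa> \<noteq> 0" "z = zpt \<kappa>" unfolding Orb_def by blast
  then show ?thesis using card_Stab[of \<kappa>] assms(1) by simp
qed

end

end

section \<open>Fibres with a fixed point\<close>

locale two_faces =
  fp: face \<iota> A\<^sub>0 Dp Dm a M E M' E' 1 q + fm: face \<iota> A\<^sub>0 Dp Dm a M' E' M E "- 1" q'
  for \<iota> :: "complex \<Rightarrow> 'k::field" and A\<^sub>0 Dp Dm a M E M' E' q q' +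
  assumes strict: "M * E' < E * M'"
begin

text \<open>The valuation of each ray along the other one is the determinant
  \<open>E * M' - M * E'\<close>, positive by strictness.\<close>

lemma ray_other: "fp.ray \<in> fm.P" "fm.ray \<in> fp.P"
proof -
  have "fm.v (1 * M) (1 * E) = E * M' - M * E'" "fp.v (- 1 * M') (- 1 * E') = E * M' - M * E'"
    by (simp_all add: fm.v_def fp.v_def algebra_simps)
  then show "fp.ray \<in> fm.P" "fm.ray \<in> fp.P"
    using strict fp.r0 fm.r0 unfolding fp.ray_def fm.ray_def fp.single_P fm.single_P by auto
qed

text \<open>The apex of the cone: all elements of nonzero degree vanish there, and degree 0 is
  evaluated at \<open>a\<close>.\<close>

definition z0 :: "(int \<Rightarrow>\<^sub>0 'k) set" where "z0 = {f \<in> fp.A. lookup f 0 \<in> a}"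

text \<open>If \<open>x * y\<close> did not vanish at \<open>a\<close>, the exponent of
  \<open>x\<close> and its negative would both lie in the cone; but with distinct slopes the cone
  contains no line.\<close>

lemma opposite_degrees:
  assumes x: "x \<in> fp.C n" and y: "y \<in> fp.C (- n)" and n: "n \<noteq> 0"
  shows "x * y \<in> a"
proof -
  have xy: "x * y \<in> A\<^sub>0" using fp.C_mult[OF x y] by (simp add: fp.C0_eq)
  show ?thesis
  proof (cases "x = 0 \<or> y = 0")
    case True
    then show ?thesis using fp.ai(2)[OF fp.a] by auto
  next
    case False
    then have nz: "x \<noteq> 0" "y \<noteq> 0" by auto
    have "0 < fp.oa x + fp.oa y"
    proof (rule ccontr)
      assume "\<not> 0 < fp.oa x + fp.oa y"
      moreover have "0 \<le> fp.oa x + fp.oa y" using fp.ord_nonneg[OF fp.a xy] nz fp.ord_mult[OF fp.a nz] by simp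
      ultimately have e: "fp.oa x + fp.oa y = 0" by simp
      have "fp.v n (fp.oa x) + fp.v (- n) (fp.oa y) = 0" "fm.v n (fp.oa x) + fm.v (- n) (fp.oa y) = 0"
        using fp.v_add(1)[of n "- n" "fp.oa x" "fp.oa y"] fm.v_add(1)[of n "- n" "fp.oa x" "fp.oa y"] e
        by (simp_all add: fp.v_0 fm.v_0)
      then have "fp.v n (fp.oa x) = 0" "fm.v n (fp.oa x) = 0"
        using fp.C_v[OF x nz(1)] fp.C_v[OF y nz(2)] fm.C_v[OF x nz(1)] fm.C_v[OF y nz(2)] by linarith+
      then have k: "fp.oa x * M = n * E" "fp.oa x * M' = n * E'" by (simp_all add: fp.v_def fm.v_def)
      have "n * (E * M') = (fp.oa x * M) * M'" unfolding k(1) by simp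
      also have "\<dots> = (fp.oa x * M') * M" by simp
      also have "\<dots> = n * (M * E')" unfolding k(2) by simp
      finally show False using n strict by simp
    qed
    then show ?thesis using fp.ord_pos_iff[OF fp.a xy] nz fp.ord_mult[OF fp.a nz] by simp
  qed
qed

lemma z0_ideal: "ideal z0 (subr fp.A)"
  unfolding ideal_subr_iff[OF fp.A_ring]
proof (intro conjI ballI)
  note ai = fp.ai[OF fp.a]
  show "z0 \<subseteq> fp.A" by (auto simp: z0_def)
  show "0 \<in> z0" using fp.sA(1) ai(2) by (simp add: z0_def)
  show "f + g \<in> z0" if "f \<in> z0" "g \<in> z0" for f g
    using that fp.sA(6) ai(3) by (simp add: z0_def lookup_add)
  show "f * g \<in> z0" if f: "f \<in> fp.A" and g: "g \<in> z0" for f g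
  proof -
    have gA: "g \<in> fp.A" and g0: "lookup g 0 \<in> a" using g by (auto simp: z0_def)
    have "lookup f n * lookup g (0 - n) \<in> a" for n
    proof (cases "n = 0")
      case True
      then show ?thesis using ai(4)[OF _ g0] fp.A_lookup[OF f, of 0] by (simp add: fp.C0_eq)
    next
      case False
      then show ?thesis using opposite_degrees[OF fp.A_lookup[OF f] _ False] fp.A_lookup[OF gA, of "- n"] by simp
    qed
    then have "lookup (f * g) 0 \<in> a"
      unfolding lookup_times_int by (intro ideal_sum[OF fp.A0 Spm_ideal[OF fp.A0 fp.a]])
    then show ?thesis using fp.sA(4)[OF f gA] by (simp add: z0_def)
  qed
qed

lemma off_degree_zero:
  assumes Q: "fp.above Q" "fp.ray \<in> Q" "fm.ray \<in> Q" and x: "x \<in> fp.C n" "n \<noteq> 0"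
  shows "Poly_Mapping.single n x \<in> Q"
proof -
  have m: "fm.above Q" using Q(1) by (simp add: fp.above_def fm.above_def)
  show ?thesis
  proof (cases "0 < n")
    case True
    show ?thesis by (rule fp.degree_sign_above[OF Q(1,2) x(1)]) (use True in simp)
  next
    case False
    show ?thesis by (rule fm.degree_sign_above[OF m Q(3) x(1)]) (use False x(2) in simp)
  qed
qed

lemma z0_subset:
  assumes Q: "fp.above Q" "fp.ray \<in> Q" "fm.ray \<in> Q"
  shows "z0 \<subseteq> Q"
proof
  fix f assume f: "f \<in> z0"
  then have fA: "f \<in> fp.A" by (simp add: z0_def)
  show "f \<in> Q"
  proof (rule fp.above_sum[OF Q(1) fA])
    fix n
    show "Poly_Mapping.single n (lookup f n) \<in> Q"
    proof (cases "n = 0")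
      case True
      have "lookup f 0 \<in> a" using f by (simp add: z0_def)
      then show ?thesis using fp.above_const[OF Q(1)] fp.ai(1)[OF fp.a] True by (simp add: const_def)
    next
      case False
      then show ?thesis using off_degree_zero[OF Q fp.A_lookup[OF fA]] by blast
    qed
  qed
qed

text \<open>The two rays force everything of positive and of negative degree into \<open>z\<close>,
  so membership depends on the degree 0 part alone.\<close>

lemma both_rays:
  assumes z: "z \<in> Spm fp.A" "proj A\<^sub>0 z = a" "fp.ray \<in> z" "fm.ray \<in> z"
  shows "z = z0"
proof
  have ab: "fp.above z" by (rule fp.fibre_above[OF z(1,2)])
  note zi = idealD[OF fp.A_ring Spm_ideal[OF fp.A_ring z(1)]]
  show sub: "z0 \<subseteq> z" by (rule z0_subset[OF ab z(3,4)])
  show "z \<subseteq> z0"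
  proof
    fix f assume f: "f \<in> z"
    then have fA: "f \<in> fp.A" by (rule zi(1))
    have f0: "lookup f 0 \<in> A\<^sub>0" using fp.A_lookup[OF fA, of 0] by (simp add: fp.C0_eq)
    have "f - const (lookup f 0) \<in> z0"
      unfolding z0_def using fp.sA(3)[OF fA] f0 fp.ai(2)[OF fp.a]
      by (simp add: fp.A_const lookup_minus) (simp add: const_def)
    then have "f - (f - const (lookup f 0)) \<in> z" using zi(7)[OF f] sub by blast
    then have "const (lookup f 0) \<in> z" by simp
    then show "f \<in> z0" using fp.above_const[OF ab f0] fA by (simp add: z0_def)
  qed
qed

text \<open>Maximality comes indirectly: a maximal ideal containing \<open>z0\<close> lies over
  \<open>a\<close> and contains both rays, so it is \<open>z0\<close> itself by
  \<open>both_rays\<close>.\<close>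

lemma z0: "z0 \<in> Spm fp.A" "proj A\<^sub>0 z0 = a" "fp.ray \<in> z0" "fm.ray \<in> z0"
proof -
  have r: "fp.ray \<in> z0" "fm.ray \<in> z0"
    unfolding z0_def using fp.ray fm.ray fp.ai(2)[OF fp.a] fp.M fm.M
    by (auto simp: fp.ray_def fm.ray_def lookup_single)
  have "1 \<notin> z0" using fp.ap(2)[OF fp.a] by (simp add: z0_def lookup_one)
  then obtain z where z: "z \<in> Spm fp.A" "z0 \<subseteq> z" using exists_Spm[OF fp.A_ring z0_ideal] by blast
  have "const x \<in> z" if "x \<in> a" for x
    using z(2) that fp.ai(1)[OF fp.a that] by (auto simp: z0_def fp.A_const) (simp add: const_def fp.A_single fp.C0_eq subset_iff)
  then have "fp.above z" by (rule fp.above_contains[OF Spm_prime[OF fp.A_ring z(1)]])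
  then have p: "proj A\<^sub>0 z = a" by (simp add: fp.above_def)
  have "z = z0" by (rule both_rays[OF z(1) p]) (use r z(2) in auto)
  then show "z0 \<in> Spm fp.A" "proj A\<^sub>0 z0 = a" "fp.ray \<in> z0" "fm.ray \<in> z0" using z(1) p r by auto
qed

lemma z0_fixed: "z0 \<in> fixed_points \<iota> fp.A"
proof -
  have "act_pt \<iota> fp.A \<zeta> z0 = z0" for \<zeta>
    unfolding act_pt_def z0_def using fp.act_A by (auto simp: lookup_act fp.chom_simps)
  then show ?thesis using z0(1) by (simp add: fixed_points_def)
qed

lemma fibre_fixed: "{z \<in> Spm fp.A. proj A\<^sub>0 z = a} \<inter> fixed_points \<iota> fp.A = {z0}"
proof (intro equalityI subsetI)
  fix z assume z: "z \<in> {z \<in> Spm fp.A. proj A\<^sub>0 z = a} \<inter> fixed_points \<iota> fp.A"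
  then have "z \<notin> fp.Orb" "z \<notin> fm.Orb" using fp.Orb_nonfixed fm.Orb_nonfixed by auto
  then have "fp.ray \<in> z" "fm.ray \<in> z" using z by (auto simp: fp.Orb_eq fm.Orb_eq)
  then show "z \<in> {z0}" using both_rays z by auto
qed (use z0 z0_fixed in auto)

lemma fibre_nonfixed: "{z \<in> Spm fp.A. proj A\<^sub>0 z = a} - fixed_points \<iota> fp.A = fp.Orb \<union> fm.Orb"
proof (intro equalityI subsetI)
  fix z assume z: "z \<in> {z \<in> Spm fp.A. proj A\<^sub>0 z = a} - fixed_points \<iota> fp.A"
  then have "z \<noteq> z0" using z0_fixed by auto
  then show "z \<in> fp.Orb \<union> fm.Orb" using both_rays z by (auto simp: fp.Orb_eq fm.Orb_eq)
next
  fix z assume z: "z \<in> fp.Orb \<union> fm.Orb"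
  then have "z \<notin> fixed_points \<iota> fp.A" using fp.Orb_nonfixed fm.Orb_nonfixed by auto
  then show "z \<in> {z \<in> Spm fp.A. proj A\<^sub>0 z = a} - fixed_points \<iota> fp.A" using z by (auto simp: fp.Orb_eq fm.Orb_eq)
qed

lemma Orb_ne: "fp.Orb \<noteq> fm.Orb"
proof
  assume e: "fp.Orb = fm.Orb"
  have "fp.zpt 1 \<in> fp.Orb" by (auto simp: fp.Orb_def)
  then have "fp.ray \<notin> fp.zpt 1" "fm.P \<subseteq> fp.zpt 1"
    using fm.Orb_Cl unfolding e by (auto simp: fp.ray_zpt fm.Cl_def)
  then show False using ray_other by blast
qed

lemma Cl_ne: "fp.Cl \<noteq> fm.Cl"
proof
  assume "fp.Cl = fm.Cl"
  then have "fp.P = fm.P" using fp.vanishing_Cl fm.vanishing_Cl by simp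
  then show False using ray_other fp.ray_P by simp
qed

text \<open>Each prime contains the ray of the other, so a common point of the closures contains
  both rays. Conversely, a degree 0 part of positive valuation vanishes at \<open>a\<close>.\<close>

lemma Cl_inter: "fp.Cl \<inter> fm.Cl = {z0}"
proof (intro equalityI subsetI)
  fix z assume z: "z \<in> fp.Cl \<inter> fm.Cl"
  then have "fp.above z" using fp.Cl_above by blast
  then have "proj A\<^sub>0 z = a" by (simp add: fp.above_def)
  moreover have "z \<in> Spm fp.A" "fp.ray \<in> z" "fm.ray \<in> z"
    using z ray_other by (auto simp: fp.Cl_def fm.Cl_def)
  ultimately show "z \<in> {z0}" using both_rays by simp
next
  have ab: "fp.above z0" by (rule fp.fibre_above[OF z0(1,2)])
  have sub: "f \<in> z0" if "f \<in> fp.A" "lookup f 0 = 0 \<or> 1 \<le> fp.oa (lookup f 0) * N" "0 < N" for f N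
  proof -
    have f0: "lookup f 0 \<in> A\<^sub>0" using fp.A_lookup[OF that(1), of 0] by (simp add: fp.C0_eq)
    have "lookup f 0 \<in> a"
    proof (cases "lookup f 0 = 0")
      case False
      then have "0 < fp.oa (lookup f 0) * N" using that by auto
      then have "0 < fp.oa (lookup f 0)" using that(3) by (simp add: zero_less_mult_iff)
      then show ?thesis using fp.ord_pos_iff[OF fp.a f0 False] by blast
    qed (use fp.ai(2)[OF fp.a] in simp)
    then show ?thesis using that(1) by (simp add: z0_def)
  qed
  have "fp.P \<subseteq> z0"
  proof
    fix f assume f: "f \<in> fp.P"
    then have "lookup f 0 = 0 \<or> 1 \<le> fp.v 0 (fp.oa (lookup f 0))" by (simp add: fp.P_def fp.PP_def gr_def fp.CN_def)
    then show "f \<in> z0" using sub[OF fp.Pi(1)[OF f], of M] fp.M by (simp add: fp.v_0)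
  qed
  moreover have "fm.P \<subseteq> z0"
  proof
    fix f assume f: "f \<in> fm.P"
    then have "lookup f 0 = 0 \<or> 1 \<le> fm.v 0 (fp.oa (lookup f 0))" by (simp add: fm.P_def fm.PP_def gr_def fm.CN_def)
    then show "f \<in> z0" using sub[OF fm.Pi(1)[OF f], of M'] fm.M by (simp add: fm.v_0)
  qed
  ultimately show "z \<in> fp.Cl \<inter> fm.Cl" if "z \<in> {z0}" for z
    using that z0(1) by (simp add: fp.Cl_def fm.Cl_def)
qed

text \<open>The closures of the two orbits are thus the only prime divisors in the fibre.\<close>

lemma above_minimal:
  assumes Q: "fp.above Q"
  shows "fp.P \<subseteq> Q \<or> fm.P \<subseteq> Q"
proof (cases "fp.ray \<in> Q \<and> fm.ray \<in> Q")
  case True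
  have "z0 \<subseteq> Q" by (rule z0_subset[OF Q]) (use True in auto)
  moreover have "fp.P \<subseteq> z0" using Cl_inter by (auto simp: fp.Cl_def)
  ultimately show ?thesis by blast
next
  case False
  then show ?thesis using fp.P_subset_above[OF Q] fm.P_subset_above[of Q] Q by (auto simp: fp.above_def fm.above_def)
qed

lemma pullback_two: "pullback_divisor A\<^sub>0 fp.A (\<lambda>b. of_bool (b = a)) =
    (\<lambda>Y. M * of_bool (Y = fp.Cl) + M' * of_bool (Y = fm.Cl))"
proof
  fix Y
  consider "Y = fp.Cl" | "Y = fm.Cl" | "Y \<noteq> fp.Cl" "Y \<noteq> fm.Cl" by blast
  then show "pullback_divisor A\<^sub>0 fp.A (\<lambda>b. of_bool (b = a)) Y = M * of_bool (Y = fp.Cl) + M' * of_bool (Y = fm.Cl)"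
  proof cases
    case 1
    then show ?thesis using fp.pullback_Cl Cl_ne by simp
  next
    case 2
    then show ?thesis using fm.pullback_Cl Cl_ne by simp
  next
    case 3
    show ?thesis
    proof (cases "prime_divisor fp.A Y")
      case pd: True
      have "\<not> fp.above (vanishing_ideal fp.A Y)"
        using fp.prime_divisor_above[OF pd] fm.prime_divisor_above[OF pd] 3 above_minimal by blast
      then show ?thesis using fp.pullback_not_above[OF pd] 3 by simp
    qed (use 3 in \<open>simp add: pullback_divisor_def\<close>)
  qed
qed

end

section \<open>The orbits over a given point\<close>

text \<open>Uniqueness of the reduced form of the fraction \<open>E / M = E' / M'\<close>.\<close>

lemma coprime_cross_eq:
  fixes M E M' E' :: int
  assumes M: "0 < M" "0 < M'" and c: "coprime E M" "coprime E' M'" and e: "E * M' = M * E'"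
  shows "M' = M \<and> E' = E"
proof -
  have "M dvd E * M'" unfolding e by simp
  then have 1: "M dvd M'" using c(1) by (simp add: coprime_commute coprime_dvd_mult_right_iff)
  have "M' dvd M * E'" unfolding e[symmetric] by simp
  then have "M' dvd M" using c(2) by (simp add: coprime_commute coprime_dvd_mult_left_iff)
  then have "M' = M" using 1 M zdvd_antisym_nonneg[of M' M] by simp
  moreover have "E' = E" using e M calculation by simp
  ultimately show ?thesis by simp
qed

lemma le_fraction_iff:
  fixes n k E M :: int
  assumes "0 < M"
  shows "of_int n * (of_int E / of_int M) \<le> (of_int k :: rat) \<longleftrightarrow> 0 \<le> k * M - n * E"
proof -
  have "of_int n * (of_int E / of_int M) \<le> (of_int k :: rat) \<longleftrightarrow> (of_int (n * E) :: rat) \<le> of_int (k * M)"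
    using assms by (simp add: field_simps)
  also have "\<dots> \<longleftrightarrow> 0 \<le> k * M - n * E" unfolding of_int_le_iff by linarith
  finally show ?thesis .
qed

context dpd begin

text \<open>Off the supports both slopes are 0, so the face has \<open>M = 1\<close> and
  \<open>E = 0\<close>; the fibre is one orbit with trivial stabilizer.\<close>

lemma exceptional_over_support:
  assumes "exceptional_orbit \<iota> A Ob"
  shows "proj A\<^sub>0 ` Ob \<subseteq> supp Dp \<union> supp Dm"
proof
  obtain z where z: "z \<in> Spm A" "Ob = orbit Cstar (act_pt \<iota> A) z"
    using assms by (auto simp: exceptional_orbit_def nonfixed_orbits_def orbits_def)
  fix b assume "b \<in> proj A\<^sub>0 ` Ob"
  then have b: "b = proj A\<^sub>0 z" using z(2) proj_act_pt by (auto simp: orbit_def Cstar_carrier)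
  show "b \<in> supp Dp \<union> supp Dm"
  proof (rule ccontr)
    assume "b \<notin> supp Dp \<union> supp Dm"
    then have D: "Dp b = 0" "Dm b = 0" by (auto simp: supp_def)
    interpret face \<iota> A\<^sub>0 Dp Dm b 1 0 1 0 1 0
      by unfold_locales (use D proj_Spm[OF z(1)] b in auto)
    have "z \<in> Orb" using fibre_single z(1) b by auto
    then obtain \<kappa> where "\<kappa> \<noteq> 0" "z = zpt \<kappa>" by (auto simp: Orb_def)
    then have "Ob = Orb" using z(2) Orb_orbit by simp
    then have "card (Stab \<iota> A z) \<noteq> 1" using assms \<open>z \<in> Orb\<close> by (simp add: exceptional_orbit_def)
    then show False using trivial_stabilizer[OF _ _ z(1)] b by simp
  qed
qed

context
  fixes a ep mp em mm qp qm
  assumes a: "a \<in> Spm A\<^sub>0" and m: "mp > 0" "mm < 0" and g: "gcd ep mp = 1" "gcd em mm = 1"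
    and D: "Dp a = - of_int ep / of_int mp" "Dm a = of_int em / of_int mm"
    and q: "0 \<le> qp" "qp < mp" "[qp * ep = - 1] (mod mp)" "0 \<le> qm" "qm < - mm" "[qm * em = 1] (mod mm)"
begin

text \<open>As \<open>mm\<close> is negative, \<open>Dm a\<close> is written as
  \<open>(- em) / (- mm)\<close> to obtain the positive denominator that a face requires.\<close>

lemma cones:
  "- (of_int n * Dp a) \<le> of_int k \<longleftrightarrow> 0 \<le> k * mp - n * ep"
  "of_int n * Dm a \<le> of_int k \<longleftrightarrow> 0 \<le> k * (- mm) - n * (- em)"
  using le_fraction_iff[OF m(1), of n ep k] le_fraction_iff[of "- mm" n "- em" k] m by (simp_all add: D)

lemma sum_D: "Dp a + Dm a = of_int (mp * em - ep * mm) / of_int (mp * mm)"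
  using m by (simp add: D field_simps)

text \<open>The determinant of the two slopes is the numerator in \<open>sum_D\<close>, while the
  denominator \<open>mp * mm\<close> is negative; so its sign is opposite to that of
  \<open>Dp a + Dm a\<close>.\<close>

lemma order_of_slopes: "0 \<le> ep * (- mm) - mp * (- em)"
  "Dp a + Dm a < 0 \<Longrightarrow> 0 < ep * (- mm) - mp * (- em)" "Dp a + Dm a = 0 \<Longrightarrow> ep * (- mm) = mp * (- em)"
proof -
  have neg_m: "mp * mm < 0" using m by (simp add: mult_pos_neg)
  then have neg': "(of_int (mp * mm) :: rat) < 0" by (simp only: of_int_less_0_iff)
  have "(of_int (mp * em - ep * mm) :: rat) / of_int (mp * mm) \<le> 0" using neg[OF a] sum_D by simp
  then have "(0::rat) \<le> of_int (mp * em - ep * mm)" using neg' unfolding divide_le_0_iff by linarith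
  then have "0 \<le> mp * em - ep * mm" by (simp only: of_int_0_le_iff)
  then show "0 \<le> ep * (- mm) - mp * (- em)" by simp
  show "ep * (- mm) = mp * (- em)" if "Dp a + Dm a = 0"
  proof -
    have "(of_int (mp * em - ep * mm) :: rat) = 0" using that neg' unfolding sum_D divide_eq_0_iff by linarith
    then show ?thesis by (unfold of_int_eq_0_iff) simp
  qed
  show "0 < ep * (- mm) - mp * (- em)" if "Dp a + Dm a < 0"
  proof -
    have "mp * em - ep * mm \<noteq> 0" using that unfolding sum_D by (metis div_0 less_irrefl of_int_0)
    then show ?thesis using \<open>0 \<le> mp * em - ep * mm\<close> by simp
  qed
qed

lemma cop: "coprime ep mp" "coprime (- em) (- mm)"
  using g by (auto simp: coprime_iff_gcd_eq_1)

text \<open>The congruences for \<open>qp\<close> and \<open>qm\<close> have opposite signs, which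
  the replacement of \<open>em\<close> by \<open>- em\<close> compensates; both become the condition
  on \<open>q\<close> in a face.\<close>

lemma q_dvd: "mp dvd qp * ep + 1" "- mm dvd qm * (- em) + 1"
proof -
  show "mp dvd qp * ep + 1" using q(3) by (simp add: cong_iff_dvd_diff)
  have "mm dvd qm * em - 1" using q(6) by (simp add: cong_iff_dvd_diff)
  then have "mm dvd - (qm * em - 1)" by (simp only: dvd_minus_iff)
  then show "- mm dvd qm * (- em) + 1" by simp
qed

lemma face_plus: "face \<iota> A\<^sub>0 Dp Dm a mp ep (- mm) (- em) 1 qp"
  by unfold_locales
    (use a cones m cop order_of_slopes(1) q q_dvd coprime_cross_eq[of mp "- mm" ep "- em"] in auto)

lemma face_minus: "face \<iota> A\<^sub>0 Dp Dm a (- mm) (- em) mp ep (- 1) qm"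
  by unfold_locales
    (use order_of_slopes(1)[unfolded mult.commute[of ep] mult.commute[of mp]] a cones m cop order_of_slopes(1) q q_dvd coprime_cross_eq[of "- mm" mp "- em" ep] in auto)

lemma one_orbit:
  assumes "Dp a + Dm a = 0"
  shows "\<exists>Orb. {z \<in> Spm A. proj A\<^sub>0 z = a} = Orb \<and>
             orbit_type \<iota> A Orb mp qp \<and>
             pullback_divisor A\<^sub>0 A (\<lambda>b. of_bool (b = a)) = (\<lambda>Y. mp * of_bool (Y = Orb)) \<and>
             principal_divisor A u Orb = - ep"
proof -
  interpret face \<iota> A\<^sub>0 Dp Dm a mp ep "- mm" "- em" 1 qp by (rule face_plus)
  note e = order_of_slopes(3)[OF assms]
  show ?thesis
    using fibre_single[OF e] Orb_type pullback_single[OF e] divisor_u[unfolded Cl_single[OF e]]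
    by (intro exI[of _ Orb] conjI)
qed

lemma two_orbits:
  assumes "Dp a + Dm a < 0"
  shows "\<exists>Orbp Orbm z\<^sub>0 Clp Clm. Orbp \<noteq> Orbm \<and>
             {z \<in> Spm A. proj A\<^sub>0 z = a} - fixed_points \<iota> A = Orbp \<union> Orbm \<and>
             {z \<in> Spm A. proj A\<^sub>0 z = a} \<inter> fixed_points \<iota> A = {z\<^sub>0} \<and>
             orbit_type \<iota> A Orbp mp qp \<and>
             orbit_type \<iota> A Orbm (- mm) qm \<and>
             Clp = zariski A closure_of Orbp \<and>
             Clm = zariski A closure_of Orbm \<and>
             Clp \<inter> Clm = {z\<^sub>0} \<and>
             pullback_divisor A\<^sub>0 A (\<lambda>b. of_bool (b = a)) =
               (\<lambda>Y. mp * of_bool (Y = Clp) - mm * of_bool (Y = Clm)) \<and>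
             principal_divisor A u Clp = - ep \<and>
             principal_divisor A u Clm = em"
proof -
  interpret two_faces \<iota> A\<^sub>0 Dp Dm a mp ep "- mm" "- em" qp qm
    by (intro two_faces.intro two_faces_axioms.intro face_plus face_minus)
      (use order_of_slopes(2)[OF assms] in simp)
  have p: "pullback_divisor A\<^sub>0 A (\<lambda>b. of_bool (b = a)) =
               (\<lambda>Y. mp * of_bool (Y = fp.Cl) - mm * of_bool (Y = fm.Cl))"
    unfolding pullback_two by (simp add: fun_eq_iff)
  have u: "principal_divisor A u fm.Cl = em" using fm.divisor_u by simp
  show ?thesis
    using Orb_ne fibre_nonfixed fibre_fixed fp.Orb_type fm.Orb_type fp.Cl_closure[symmetric]
      fm.Cl_closure[symmetric] Cl_inter p fp.divisor_u u
    by (intro exI[of _ fp.Orb] exI[of _ fm.Orb] exI[of _ z0] exI[of _ fp.Cl] exI[of _ fm.Cl] conjI)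
qed

end

end

theorem theorem4p18:
  fixes \<iota> :: "complex \<Rightarrow> 'k::field"
    and A\<^sub>0 :: "'k set"
    and Dp Dm :: "'k set \<Rightarrow> rat"
    and A :: "(int \<Rightarrow>\<^sub>0 'k) set"
    and V F :: "(int \<Rightarrow>\<^sub>0 'k) set set"
  assumes "smooth_affine_curve \<iota> A\<^sub>0"
    and "Q_divisor A\<^sub>0 Dp" and "Q_divisor A\<^sub>0 Dm"
    and "\<forall>a\<in>Spm A\<^sub>0. Dp a + Dm a \<le> 0"
    and "A = dpd_algebra A\<^sub>0 Dp Dm"
    and "V = Spm A"
    and "F = fixed_points \<iota> A"
  shows "(\<forall>Orb. exceptional_orbit \<iota> A Orb \<longrightarrow> proj A\<^sub>0 ` Orb \<subseteq> supp Dp \<union> supp Dm) \<and>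
    (\<forall>a \<in> supp Dp \<union> supp Dm. \<forall>ep mp em mm qp qm :: int.
       mp > 0 \<longrightarrow> mm < 0 \<longrightarrow> gcd ep mp = 1 \<longrightarrow> gcd em mm = 1 \<longrightarrow>
       Dp a = - of_int ep / of_int mp \<longrightarrow> Dm a = of_int em / of_int mm \<longrightarrow>
       (Dp a = 0 \<longrightarrow> mp = 1) \<longrightarrow> (Dm a = 0 \<longrightarrow> mm = - 1) \<longrightarrow>
       0 \<le> qp \<longrightarrow> qp < mp \<longrightarrow> [qp * ep = - 1] (mod mp) \<longrightarrow>
       0 \<le> qm \<longrightarrow> qm < - mm \<longrightarrow> [qm * em = 1] (mod mm) \<longrightarrow>
       (Dp a + Dm a = 0 \<longrightarrow>
          (\<exists>Orb. {z \<in> V. proj A\<^sub>0 z = a} = Orb \<and>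
             orbit_type \<iota> A Orb mp qp \<and>
             pullback_divisor A\<^sub>0 A (\<lambda>b. of_bool (b = a)) = (\<lambda>Y. mp * of_bool (Y = Orb)) \<and>
             principal_divisor A u Orb = - ep)) \<and>
       (Dp a + Dm a < 0 \<longrightarrow>
          (\<exists>Orbp Orbm z\<^sub>0 Clp Clm. Orbp \<noteq> Orbm \<and>
             {z \<in> V. proj A\<^sub>0 z = a} - F = Orbp \<union> Orbm \<and>
             {z \<in> V. proj A\<^sub>0 z = a} \<inter> F = {z\<^sub>0} \<and>
             orbit_type \<iota> A Orbp mp qp \<and>
             orbit_type \<iota> A Orbm (- mm) qm \<and>
             Clp = zariski A closure_of Orbp \<and>
             Clm = zariski A closure_of Orbm \<and>
             Clp \<inter> Clm = {z\<^sub>0} \<and>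
             pullback_divisor A\<^sub>0 A (\<lambda>b. of_bool (b = a)) =
               (\<lambda>Y. mp * of_bool (Y = Clp) - mm * of_bool (Y = Clm)) \<and>
             principal_divisor A u Clp = - ep \<and>
             principal_divisor A u Clm = em)))"
proof -
  interpret D: dpd \<iota> A\<^sub>0 Dp Dm
    by unfold_locales (use assms(1-4) in auto)
  have A: "A = D.A" using assms(5) by (simp add: D.A_def)
  have supp: "a \<in> Spm A\<^sub>0" if "a \<in> supp Dp \<union> supp Dm" for a
    using that D.finite_support(2) by blast
  show ?thesis
    unfolding assms(6,7) A
  proof (intro conjI allI ballI impI)
    show "proj A\<^sub>0 ` Orb \<subseteq> supp Dp \<union> supp Dm" if "exceptional_orbit \<iota> D.A Orb" for Orb
      using that by (rule D.exceptional_over_support)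
  qed (erule D.one_orbit[OF supp] D.two_orbits[OF supp]; assumption)+
qed

end
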